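(* Work in homotopy type theory with a univalent universe $\mathcal{U}$ and truncations. Let $A$ be a $1$-type whose loop spaces have braidings, i.e. for all $a:A$ and $p,q : a = a$ we have $p \cdot q = q \cdot p$. Then $A$ is set-based representable: there exists a family $A_1 : \|A\|_0 \to \mathcal{U}$ such that for all $a : A$ we have an equivalence $A_1(|a|) \simeq (a = a)$ (equivalently, the function $\omega_A : A \to \mathcal{U}$, $\omega_A(a) := (a = a)$, factors through $|{-}| : A \to \|A\|_0$).
   Context: $\|A\|_0$ is the $0$-truncation (set truncation) of $A$ with projection $|{-}|$. A $1$-type is a type all of whose identity types are sets ($0$-types). $p \cdot q$ denotes path concatenation. *)

theory Defs
  imports Main
begin

text \<open>
  A deep embedding of homotopy type theory: Martin-Loef type theory with a cumulative
  hierarchy of Russell universes, \<open>\<Pi>\<close>, \<open>\<Sigma>\<close>, coproduct, empty, unit, natural number and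
  identity types, function extensionality, univalence, and n-truncations for every n.
  The presentation follows the appendix of the HoTT book (typed judgemental equality,
  induction principles with explicit motives).  An object-level theorem is a closed type
  that is derivably inhabited in the empty context.

  An embedding that renders hypothetical judgements by HOL implications and open terms by
  HOL functions would be inconsistent with univalence, because HOL functions can
  distinguish equivalent types; hence the explicit syntax.
\<close>

section \<open>Raw syntax\<close>

text \<open>
  De Bruijn indices.  Binding structure: the second argument of \<open>Pi\<close>, \<open>Lam\<close> and \<open>Sig\<close> binds
  one variable; in the eliminators the motive \<open>C\<close> binds the scrutinee, except that in \<open>IndEq\<close>
  it binds two end points and a path between them.  The remaining binders are stated at the
  constructors.  Innermost variables have the smallest index.

  The numeric argument of the truncation constructs is the truncation level shifted by two,
  so that \<open>Trunc 0\<close>, \<open>Trunc 1\<close> and \<open>Trunc 2\<close> are the (-2)-truncation, the propositional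
  truncation and the set truncation.
\<close>

datatype tm =
    Var nat
  | U nat
  | Pi tm tm
  | Lam tm tm
  | App tm tm
  | Sig tm tm
  | Tuple tm tm
  | IndSig tm tm tm          (* IndSig C g p: g binds the two components *)
  | Coprod tm tm
  | InL tm
  | InR tm
  | IndCoprod tm tm tm tm    (* IndCoprod C c d e: c and d bind one variable each *)
  | Empty
  | IndEmpty tm tm
  | Unit
  | Star
  | IndUnit tm tm tm
  | Natural
  | Zero
  | Succ tm
  | IndNatural tm tm tm tm   (* IndNatural C c d n: d binds a number and the recursive result *)
  | Eq tm tm tm              (* Eq A a b: the identity type a = b in A *)
  | Refl tm
  | IndEq tm tm tm tm tm     (* IndEq C c a b p: c binds one variable *)
  | Funext tm tm
  | Univalence tm tm
  | Trunc nat tm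
  | Tr nat tm
  | TruncIsTrunc nat tm
  | IndTrunc nat tm tm tm tm (* IndTrunc n C h g t: h binds the scrutinee, g a point of A *)

section \<open>Renaming and substitution\<close>

definition up_ren :: "(nat \<Rightarrow> nat) \<Rightarrow> nat \<Rightarrow> nat" where
  "up_ren \<rho> = case_nat 0 (\<lambda>n. Suc (\<rho> n))"

primrec ren :: "(nat \<Rightarrow> nat) \<Rightarrow> tm \<Rightarrow> tm" where
  "ren \<rho> (Var n) = Var (\<rho> n)"
| "ren \<rho> (U i) = U i"
| "ren \<rho> (Pi A B) = Pi (ren \<rho> A) (ren (up_ren \<rho>) B)"
| "ren \<rho> (Lam A b) = Lam (ren \<rho> A) (ren (up_ren \<rho>) b)"
| "ren \<rho> (App f a) = App (ren \<rho> f) (ren \<rho> a)"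
| "ren \<rho> (Sig A B) = Sig (ren \<rho> A) (ren (up_ren \<rho>) B)"
| "ren \<rho> (Tuple a b) = Tuple (ren \<rho> a) (ren \<rho> b)"
| "ren \<rho> (IndSig C g p) = IndSig (ren (up_ren \<rho>) C) (ren (up_ren (up_ren \<rho>)) g) (ren \<rho> p)"
| "ren \<rho> (Coprod A B) = Coprod (ren \<rho> A) (ren \<rho> B)"
| "ren \<rho> (InL a) = InL (ren \<rho> a)"
| "ren \<rho> (InR b) = InR (ren \<rho> b)"
| "ren \<rho> (IndCoprod C c d e) =
     IndCoprod (ren (up_ren \<rho>) C) (ren (up_ren \<rho>) c) (ren (up_ren \<rho>) d) (ren \<rho> e)"
| "ren \<rho> Empty = Empty"
| "ren \<rho> (IndEmpty C e) = IndEmpty (ren (up_ren \<rho>) C) (ren \<rho> e)"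
| "ren \<rho> Unit = Unit"
| "ren \<rho> Star = Star"
| "ren \<rho> (IndUnit C c e) = IndUnit (ren (up_ren \<rho>) C) (ren \<rho> c) (ren \<rho> e)"
| "ren \<rho> Natural = Natural"
| "ren \<rho> Zero = Zero"
| "ren \<rho> (Succ n) = Succ (ren \<rho> n)"
| "ren \<rho> (IndNatural C c d n) =
     IndNatural (ren (up_ren \<rho>) C) (ren \<rho> c) (ren (up_ren (up_ren \<rho>)) d) (ren \<rho> n)"
| "ren \<rho> (Eq A a b) = Eq (ren \<rho> A) (ren \<rho> a) (ren \<rho> b)"
| "ren \<rho> (Refl a) = Refl (ren \<rho> a)"
| "ren \<rho> (IndEq C c a b p) =
     IndEq (ren (up_ren (up_ren (up_ren \<rho>))) C) (ren (up_ren \<rho>) c) (ren \<rho> a) (ren \<rho> b) (ren \<rho> p)"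
| "ren \<rho> (Funext f g) = Funext (ren \<rho> f) (ren \<rho> g)"
| "ren \<rho> (Univalence A B) = Univalence (ren \<rho> A) (ren \<rho> B)"
| "ren \<rho> (Trunc n A) = Trunc n (ren \<rho> A)"
| "ren \<rho> (Tr n a) = Tr n (ren \<rho> a)"
| "ren \<rho> (TruncIsTrunc n A) = TruncIsTrunc n (ren \<rho> A)"
| "ren \<rho> (IndTrunc n C h g t) =
     IndTrunc n (ren (up_ren \<rho>) C) (ren (up_ren \<rho>) h) (ren (up_ren \<rho>) g) (ren \<rho> t)"

definition lift :: "nat \<Rightarrow> tm \<Rightarrow> tm" where
  "lift k = ren (\<lambda>n. n + k)"

definition up :: "(nat \<Rightarrow> tm) \<Rightarrow> nat \<Rightarrow> tm" where
  "up \<sigma> = case_nat (Var 0) (\<lambda>n. lift 1 (\<sigma> n))"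

primrec subst :: "(nat \<Rightarrow> tm) \<Rightarrow> tm \<Rightarrow> tm" where
  "subst \<sigma> (Var n) = \<sigma> n"
| "subst \<sigma> (U i) = U i"
| "subst \<sigma> (Pi A B) = Pi (subst \<sigma> A) (subst (up \<sigma>) B)"
| "subst \<sigma> (Lam A b) = Lam (subst \<sigma> A) (subst (up \<sigma>) b)"
| "subst \<sigma> (App f a) = App (subst \<sigma> f) (subst \<sigma> a)"
| "subst \<sigma> (Sig A B) = Sig (subst \<sigma> A) (subst (up \<sigma>) B)"
| "subst \<sigma> (Tuple a b) = Tuple (subst \<sigma> a) (subst \<sigma> b)"
| "subst \<sigma> (IndSig C g p) = IndSig (subst (up \<sigma>) C) (subst (up (up \<sigma>)) g) (subst \<sigma> p)"
| "subst \<sigma> (Coprod A B) = Coprod (subst \<sigma> A) (subst \<sigma> B)"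
| "subst \<sigma> (InL a) = InL (subst \<sigma> a)"
| "subst \<sigma> (InR b) = InR (subst \<sigma> b)"
| "subst \<sigma> (IndCoprod C c d e) =
     IndCoprod (subst (up \<sigma>) C) (subst (up \<sigma>) c) (subst (up \<sigma>) d) (subst \<sigma> e)"
| "subst \<sigma> Empty = Empty"
| "subst \<sigma> (IndEmpty C e) = IndEmpty (subst (up \<sigma>) C) (subst \<sigma> e)"
| "subst \<sigma> Unit = Unit"
| "subst \<sigma> Star = Star"
| "subst \<sigma> (IndUnit C c e) = IndUnit (subst (up \<sigma>) C) (subst \<sigma> c) (subst \<sigma> e)"
| "subst \<sigma> Natural = Natural"
| "subst \<sigma> Zero = Zero"
| "subst \<sigma> (Succ n) = Succ (subst \<sigma> n)"
| "subst \<sigma> (IndNatural C c d n) =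
     IndNatural (subst (up \<sigma>) C) (subst \<sigma> c) (subst (up (up \<sigma>)) d) (subst \<sigma> n)"
| "subst \<sigma> (Eq A a b) = Eq (subst \<sigma> A) (subst \<sigma> a) (subst \<sigma> b)"
| "subst \<sigma> (Refl a) = Refl (subst \<sigma> a)"
| "subst \<sigma> (IndEq C c a b p) =
     IndEq (subst (up (up (up \<sigma>))) C) (subst (up \<sigma>) c) (subst \<sigma> a) (subst \<sigma> b) (subst \<sigma> p)"
| "subst \<sigma> (Funext f g) = Funext (subst \<sigma> f) (subst \<sigma> g)"
| "subst \<sigma> (Univalence A B) = Univalence (subst \<sigma> A) (subst \<sigma> B)"
| "subst \<sigma> (Trunc n A) = Trunc n (subst \<sigma> A)"
| "subst \<sigma> (Tr n a) = Tr n (subst \<sigma> a)"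
| "subst \<sigma> (TruncIsTrunc n A) = TruncIsTrunc n (subst \<sigma> A)"
| "subst \<sigma> (IndTrunc n C h g t) =
     IndTrunc n (subst (up \<sigma>) C) (subst (up \<sigma>) h) (subst (up \<sigma>) g) (subst \<sigma> t)"

text \<open>
  \<open>inst1 a\<close>, \<open>inst2 a b\<close> and \<open>inst3 a b c\<close> replace the innermost one, two or three variables,
  the last argument going to index 0.  \<open>repl k a\<close> replaces variable 0 by a term \<open>a\<close> that lives
  in a context with \<open>k\<close> fresh variables in place of variable 0.
\<close>

definition inst1 :: "tm \<Rightarrow> tm \<Rightarrow> tm" where
  "inst1 a = subst (case_nat a Var)"

definition inst2 :: "tm \<Rightarrow> tm \<Rightarrow> tm \<Rightarrow> tm" where
  "inst2 a b = subst (case_nat b (case_nat a Var))"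

definition inst3 :: "tm \<Rightarrow> tm \<Rightarrow> tm \<Rightarrow> tm \<Rightarrow> tm" where
  "inst3 a b c = subst (case_nat c (case_nat b (case_nat a Var)))"

definition repl :: "nat \<Rightarrow> tm \<Rightarrow> tm \<Rightarrow> tm" where
  "repl k a = subst (case_nat a (\<lambda>n. Var (n + k)))"

section \<open>Defined types and terms\<close>

definition Arr :: "tm \<Rightarrow> tm \<Rightarrow> tm" where
  "Arr A B = Pi A (lift 1 B)"

definition Prod :: "tm \<Rightarrow> tm \<Rightarrow> tm" where
  "Prod A B = Sig A (lift 1 B)"

text \<open>
  \<open>is_trunc k A\<close> says that \<open>A\<close> is a (k-2)-type: contractible for \<open>k = 0\<close>, and otherwise all
  identity types are (k-3)-types.
\<close>

primrec is_trunc :: "nat \<Rightarrow> tm \<Rightarrow> tm" where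
  "is_trunc 0 A = Sig A (Pi (lift 1 A) (Eq (lift 2 A) (Var 1) (Var 0)))"
| "is_trunc (Suc k) A = Pi A (Pi (lift 1 A) (is_trunc k (Eq (lift 2 A) (Var 1) (Var 0))))"

text \<open>
  Bi-invertible maps: \<open>f\<close> from \<open>A\<close> to \<open>B\<close> has a right inverse and a left inverse.
\<close>

definition is_equiv :: "tm \<Rightarrow> tm \<Rightarrow> tm \<Rightarrow> tm" where
  "is_equiv A B f = Prod
     (Sig (Arr B A)
       (Pi (lift 1 B) (Eq (lift 2 B) (App (lift 2 f) (App (Var 1) (Var 0))) (Var 0))))
     (Sig (Arr B A)
       (Pi (lift 1 A) (Eq (lift 2 A) (App (Var 1) (App (lift 2 f) (Var 0))) (Var 0))))"

definition equiv_type :: "tm \<Rightarrow> tm \<Rightarrow> tm" where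
  "equiv_type A B = Sig (Arr A B) (is_equiv (lift 1 A) (lift 1 B) (Var 0))"

definition id_equiv :: "tm \<Rightarrow> tm" where
  "id_equiv A = (let i = Lam A (Var 0); h = Tuple i (Lam A (Refl (Var 0)))
                 in Tuple i (Tuple h h))"

text \<open>
  The canonical map from \<open>A = B\<close> in \<open>U i\<close> to the type of equivalences, sending \<open>refl\<close> to the
  identity equivalence.
\<close>

definition id_to_equiv :: "nat \<Rightarrow> tm \<Rightarrow> tm \<Rightarrow> tm" where
  "id_to_equiv i A B = Lam (Eq (U i) A B)
     (IndEq (equiv_type (Var 2) (Var 1)) (id_equiv (Var 0)) (lift 1 A) (lift 1 B) (Var 0))"

text \<open>
  For \<open>f\<close> and \<open>g\<close> in \<open>Pi A B\<close>: pointwise equality, and the canonical map to it from \<open>f = g\<close>.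
  The family \<open>B\<close> has one bound variable, which the weakening in the motive must avoid.
\<close>

definition homotopy :: "tm \<Rightarrow> tm \<Rightarrow> tm \<Rightarrow> tm \<Rightarrow> tm" where
  "homotopy A B f g = Pi A (Eq B (App (lift 1 f) (Var 0)) (App (lift 1 g) (Var 0)))"

definition happly :: "tm \<Rightarrow> tm \<Rightarrow> tm \<Rightarrow> tm \<Rightarrow> tm" where
  "happly A B f g = Lam (Eq (Pi A B) f g)
     (IndEq (homotopy (lift 4 A) (ren (up_ren (\<lambda>n. n + 4)) B) (Var 2) (Var 1))
            (Lam (lift 2 A) (Refl (App (Var 1) (Var 0))))
            (lift 1 f) (lift 1 g) (Var 0))"

section \<open>Judgements\<close>

text \<open>
  Contexts are lists with the most recently declared variable first.  Well-formed types are
  the terms inhabiting some universe.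

  In the rules for \<open>IndEq\<close> the motive lives over two points and a path; the substitution
  \<open>case_nat (Refl (Var 0)) (case_nat (Var 0) Var)\<close> restricts it to the diagonal, with one
  variable for the common point: it sends the path to reflexivity, both points to \<open>Var 0\<close>,
  and variable \<open>n + 3\<close> to \<open>Var (n + 1)\<close>.
\<close>

inductive
  ctx :: "tm list \<Rightarrow> bool" and
  has_type :: "tm list \<Rightarrow> tm \<Rightarrow> tm \<Rightarrow> bool" ("_ \<turnstile> _ \<Colon> _" [50, 50, 50] 50) and
  jeq :: "tm list \<Rightarrow> tm \<Rightarrow> tm \<Rightarrow> tm \<Rightarrow> bool" ("_ \<turnstile> _ \<doteq> _ \<Colon> _" [50, 50, 50, 50] 50)
where
  ctx_empty: "ctx []"
| ctx_extend: "\<Gamma> \<turnstile> A \<Colon> U i \<Longrightarrow> ctx (A # \<Gamma>)"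

| var: "\<lbrakk>ctx \<Gamma>; n < length \<Gamma>\<rbrakk> \<Longrightarrow> \<Gamma> \<turnstile> Var n \<Colon> lift (Suc n) (\<Gamma> ! n)"
| conv: "\<lbrakk>\<Gamma> \<turnstile> a \<Colon> A; \<Gamma> \<turnstile> A \<doteq> B \<Colon> U i\<rbrakk> \<Longrightarrow> \<Gamma> \<turnstile> a \<Colon> B"
| jeq_refl: "\<Gamma> \<turnstile> a \<Colon> A \<Longrightarrow> \<Gamma> \<turnstile> a \<doteq> a \<Colon> A"
| jeq_sym: "\<Gamma> \<turnstile> a \<doteq> b \<Colon> A \<Longrightarrow> \<Gamma> \<turnstile> b \<doteq> a \<Colon> A"
| jeq_trans: "\<lbrakk>\<Gamma> \<turnstile> a \<doteq> b \<Colon> A; \<Gamma> \<turnstile> b \<doteq> c \<Colon> A\<rbrakk> \<Longrightarrow> \<Gamma> \<turnstile> a \<doteq> c \<Colon> A"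
| jeq_conv: "\<lbrakk>\<Gamma> \<turnstile> a \<doteq> b \<Colon> A; \<Gamma> \<turnstile> A \<doteq> B \<Colon> U i\<rbrakk> \<Longrightarrow> \<Gamma> \<turnstile> a \<doteq> b \<Colon> B"

| univ: "ctx \<Gamma> \<Longrightarrow> \<Gamma> \<turnstile> U i \<Colon> U (Suc i)"
| cumul: "\<Gamma> \<turnstile> A \<Colon> U i \<Longrightarrow> \<Gamma> \<turnstile> A \<Colon> U (Suc i)"
| jeq_cumul: "\<Gamma> \<turnstile> A \<doteq> B \<Colon> U i \<Longrightarrow> \<Gamma> \<turnstile> A \<doteq> B \<Colon> U (Suc i)"

| pi_form: "\<lbrakk>\<Gamma> \<turnstile> A \<Colon> U i; A # \<Gamma> \<turnstile> B \<Colon> U i\<rbrakk> \<Longrightarrow> \<Gamma> \<turnstile> Pi A B \<Colon> U i"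
| pi_intro: "\<lbrakk>\<Gamma> \<turnstile> A \<Colon> U i; A # \<Gamma> \<turnstile> b \<Colon> B\<rbrakk> \<Longrightarrow> \<Gamma> \<turnstile> Lam A b \<Colon> Pi A B"
| pi_elim: "\<lbrakk>\<Gamma> \<turnstile> f \<Colon> Pi A B; \<Gamma> \<turnstile> a \<Colon> A\<rbrakk> \<Longrightarrow> \<Gamma> \<turnstile> App f a \<Colon> inst1 a B"
| pi_comp: "\<lbrakk>A # \<Gamma> \<turnstile> b \<Colon> B; \<Gamma> \<turnstile> a \<Colon> A\<rbrakk> \<Longrightarrow>
    \<Gamma> \<turnstile> App (Lam A b) a \<doteq> inst1 a b \<Colon> inst1 a B"
| pi_uniq: "\<Gamma> \<turnstile> f \<Colon> Pi A B \<Longrightarrow> \<Gamma> \<turnstile> f \<doteq> Lam A (App (lift 1 f) (Var 0)) \<Colon> Pi A B"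
| pi_form_cong: "\<lbrakk>\<Gamma> \<turnstile> A \<doteq> A' \<Colon> U i; A # \<Gamma> \<turnstile> B \<doteq> B' \<Colon> U i\<rbrakk> \<Longrightarrow>
    \<Gamma> \<turnstile> Pi A B \<doteq> Pi A' B' \<Colon> U i"
| pi_intro_cong: "\<lbrakk>\<Gamma> \<turnstile> A \<doteq> A' \<Colon> U i; A # \<Gamma> \<turnstile> b \<doteq> b' \<Colon> B\<rbrakk> \<Longrightarrow>
    \<Gamma> \<turnstile> Lam A b \<doteq> Lam A' b' \<Colon> Pi A B"
| pi_elim_cong: "\<lbrakk>\<Gamma> \<turnstile> f \<doteq> f' \<Colon> Pi A B; \<Gamma> \<turnstile> a \<doteq> a' \<Colon> A\<rbrakk> \<Longrightarrow>
    \<Gamma> \<turnstile> App f a \<doteq> App f' a' \<Colon> inst1 a B"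

| sig_form: "\<lbrakk>\<Gamma> \<turnstile> A \<Colon> U i; A # \<Gamma> \<turnstile> B \<Colon> U i\<rbrakk> \<Longrightarrow> \<Gamma> \<turnstile> Sig A B \<Colon> U i"
| sig_intro: "\<lbrakk>A # \<Gamma> \<turnstile> B \<Colon> U i; \<Gamma> \<turnstile> a \<Colon> A; \<Gamma> \<turnstile> b \<Colon> inst1 a B\<rbrakk> \<Longrightarrow>
    \<Gamma> \<turnstile> Tuple a b \<Colon> Sig A B"
| sig_elim: "\<lbrakk>Sig A B # \<Gamma> \<turnstile> C \<Colon> U i; B # A # \<Gamma> \<turnstile> g \<Colon> repl 2 (Tuple (Var 1) (Var 0)) C;
    \<Gamma> \<turnstile> p \<Colon> Sig A B\<rbrakk> \<Longrightarrow> \<Gamma> \<turnstile> IndSig C g p \<Colon> inst1 p C"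
| sig_comp: "\<lbrakk>Sig A B # \<Gamma> \<turnstile> C \<Colon> U i; B # A # \<Gamma> \<turnstile> g \<Colon> repl 2 (Tuple (Var 1) (Var 0)) C;
    \<Gamma> \<turnstile> a \<Colon> A; \<Gamma> \<turnstile> b \<Colon> inst1 a B\<rbrakk> \<Longrightarrow>
    \<Gamma> \<turnstile> IndSig C g (Tuple a b) \<doteq> inst2 a b g \<Colon> inst1 (Tuple a b) C"
| sig_form_cong: "\<lbrakk>\<Gamma> \<turnstile> A \<doteq> A' \<Colon> U i; A # \<Gamma> \<turnstile> B \<doteq> B' \<Colon> U i\<rbrakk> \<Longrightarrow>
    \<Gamma> \<turnstile> Sig A B \<doteq> Sig A' B' \<Colon> U i"
| sig_intro_cong: "\<lbrakk>A # \<Gamma> \<turnstile> B \<Colon> U i; \<Gamma> \<turnstile> a \<doteq> a' \<Colon> A; \<Gamma> \<turnstile> b \<doteq> b' \<Colon> inst1 a B\<rbrakk> \<Longrightarrow>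
    \<Gamma> \<turnstile> Tuple a b \<doteq> Tuple a' b' \<Colon> Sig A B"
| sig_elim_cong: "\<lbrakk>Sig A B # \<Gamma> \<turnstile> C \<doteq> C' \<Colon> U i;
    B # A # \<Gamma> \<turnstile> g \<doteq> g' \<Colon> repl 2 (Tuple (Var 1) (Var 0)) C; \<Gamma> \<turnstile> p \<doteq> p' \<Colon> Sig A B\<rbrakk> \<Longrightarrow>
    \<Gamma> \<turnstile> IndSig C g p \<doteq> IndSig C' g' p' \<Colon> inst1 p C"

| coprod_form: "\<lbrakk>\<Gamma> \<turnstile> A \<Colon> U i; \<Gamma> \<turnstile> B \<Colon> U i\<rbrakk> \<Longrightarrow> \<Gamma> \<turnstile> Coprod A B \<Colon> U i"
| coprod_intro_l: "\<lbrakk>\<Gamma> \<turnstile> A \<Colon> U i; \<Gamma> \<turnstile> B \<Colon> U i; \<Gamma> \<turnstile> a \<Colon> A\<rbrakk> \<Longrightarrow> \<Gamma> \<turnstile> InL a \<Colon> Coprod A B"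
| coprod_intro_r: "\<lbrakk>\<Gamma> \<turnstile> A \<Colon> U i; \<Gamma> \<turnstile> B \<Colon> U i; \<Gamma> \<turnstile> b \<Colon> B\<rbrakk> \<Longrightarrow> \<Gamma> \<turnstile> InR b \<Colon> Coprod A B"
| coprod_elim: "\<lbrakk>Coprod A B # \<Gamma> \<turnstile> C \<Colon> U i; A # \<Gamma> \<turnstile> c \<Colon> repl 1 (InL (Var 0)) C;
    B # \<Gamma> \<turnstile> d \<Colon> repl 1 (InR (Var 0)) C; \<Gamma> \<turnstile> e \<Colon> Coprod A B\<rbrakk> \<Longrightarrow>
    \<Gamma> \<turnstile> IndCoprod C c d e \<Colon> inst1 e C"
| coprod_comp_l: "\<lbrakk>Coprod A B # \<Gamma> \<turnstile> C \<Colon> U i; A # \<Gamma> \<turnstile> c \<Colon> repl 1 (InL (Var 0)) C;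
    B # \<Gamma> \<turnstile> d \<Colon> repl 1 (InR (Var 0)) C; \<Gamma> \<turnstile> a \<Colon> A\<rbrakk> \<Longrightarrow>
    \<Gamma> \<turnstile> IndCoprod C c d (InL a) \<doteq> inst1 a c \<Colon> inst1 (InL a) C"
| coprod_comp_r: "\<lbrakk>Coprod A B # \<Gamma> \<turnstile> C \<Colon> U i; A # \<Gamma> \<turnstile> c \<Colon> repl 1 (InL (Var 0)) C;
    B # \<Gamma> \<turnstile> d \<Colon> repl 1 (InR (Var 0)) C; \<Gamma> \<turnstile> b \<Colon> B\<rbrakk> \<Longrightarrow>
    \<Gamma> \<turnstile> IndCoprod C c d (InR b) \<doteq> inst1 b d \<Colon> inst1 (InR b) C"
| coprod_form_cong: "\<lbrakk>\<Gamma> \<turnstile> A \<doteq> A' \<Colon> U i; \<Gamma> \<turnstile> B \<doteq> B' \<Colon> U i\<rbrakk> \<Longrightarrow>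
    \<Gamma> \<turnstile> Coprod A B \<doteq> Coprod A' B' \<Colon> U i"
| coprod_intro_l_cong: "\<lbrakk>\<Gamma> \<turnstile> A \<Colon> U i; \<Gamma> \<turnstile> B \<Colon> U i; \<Gamma> \<turnstile> a \<doteq> a' \<Colon> A\<rbrakk> \<Longrightarrow>
    \<Gamma> \<turnstile> InL a \<doteq> InL a' \<Colon> Coprod A B"
| coprod_intro_r_cong: "\<lbrakk>\<Gamma> \<turnstile> A \<Colon> U i; \<Gamma> \<turnstile> B \<Colon> U i; \<Gamma> \<turnstile> b \<doteq> b' \<Colon> B\<rbrakk> \<Longrightarrow>
    \<Gamma> \<turnstile> InR b \<doteq> InR b' \<Colon> Coprod A B"
| coprod_elim_cong: "\<lbrakk>Coprod A B # \<Gamma> \<turnstile> C \<doteq> C' \<Colon> U i;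
    A # \<Gamma> \<turnstile> c \<doteq> c' \<Colon> repl 1 (InL (Var 0)) C; B # \<Gamma> \<turnstile> d \<doteq> d' \<Colon> repl 1 (InR (Var 0)) C;
    \<Gamma> \<turnstile> e \<doteq> e' \<Colon> Coprod A B\<rbrakk> \<Longrightarrow>
    \<Gamma> \<turnstile> IndCoprod C c d e \<doteq> IndCoprod C' c' d' e' \<Colon> inst1 e C"

| empty_form: "ctx \<Gamma> \<Longrightarrow> \<Gamma> \<turnstile> Empty \<Colon> U i"
| empty_elim: "\<lbrakk>Empty # \<Gamma> \<turnstile> C \<Colon> U i; \<Gamma> \<turnstile> e \<Colon> Empty\<rbrakk> \<Longrightarrow> \<Gamma> \<turnstile> IndEmpty C e \<Colon> inst1 e C"
| empty_elim_cong: "\<lbrakk>Empty # \<Gamma> \<turnstile> C \<doteq> C' \<Colon> U i; \<Gamma> \<turnstile> e \<doteq> e' \<Colon> Empty\<rbrakk> \<Longrightarrow>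
    \<Gamma> \<turnstile> IndEmpty C e \<doteq> IndEmpty C' e' \<Colon> inst1 e C"

| unit_form: "ctx \<Gamma> \<Longrightarrow> \<Gamma> \<turnstile> Unit \<Colon> U i"
| unit_intro: "ctx \<Gamma> \<Longrightarrow> \<Gamma> \<turnstile> Star \<Colon> Unit"
| unit_elim: "\<lbrakk>Unit # \<Gamma> \<turnstile> C \<Colon> U i; \<Gamma> \<turnstile> c \<Colon> inst1 Star C; \<Gamma> \<turnstile> e \<Colon> Unit\<rbrakk> \<Longrightarrow>
    \<Gamma> \<turnstile> IndUnit C c e \<Colon> inst1 e C"
| unit_comp: "\<lbrakk>Unit # \<Gamma> \<turnstile> C \<Colon> U i; \<Gamma> \<turnstile> c \<Colon> inst1 Star C\<rbrakk> \<Longrightarrow>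
    \<Gamma> \<turnstile> IndUnit C c Star \<doteq> c \<Colon> inst1 Star C"
| unit_elim_cong: "\<lbrakk>Unit # \<Gamma> \<turnstile> C \<doteq> C' \<Colon> U i; \<Gamma> \<turnstile> c \<doteq> c' \<Colon> inst1 Star C;
    \<Gamma> \<turnstile> e \<doteq> e' \<Colon> Unit\<rbrakk> \<Longrightarrow> \<Gamma> \<turnstile> IndUnit C c e \<doteq> IndUnit C' c' e' \<Colon> inst1 e C"

| natural_form: "ctx \<Gamma> \<Longrightarrow> \<Gamma> \<turnstile> Natural \<Colon> U i"
| natural_intro_zero: "ctx \<Gamma> \<Longrightarrow> \<Gamma> \<turnstile> Zero \<Colon> Natural"
| natural_intro_succ: "\<Gamma> \<turnstile> n \<Colon> Natural \<Longrightarrow> \<Gamma> \<turnstile> Succ n \<Colon> Natural"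
| natural_elim: "\<lbrakk>Natural # \<Gamma> \<turnstile> C \<Colon> U i; \<Gamma> \<turnstile> c \<Colon> inst1 Zero C;
    C # Natural # \<Gamma> \<turnstile> d \<Colon> repl 2 (Succ (Var 1)) C; \<Gamma> \<turnstile> n \<Colon> Natural\<rbrakk> \<Longrightarrow>
    \<Gamma> \<turnstile> IndNatural C c d n \<Colon> inst1 n C"
| natural_comp_zero: "\<lbrakk>Natural # \<Gamma> \<turnstile> C \<Colon> U i; \<Gamma> \<turnstile> c \<Colon> inst1 Zero C;
    C # Natural # \<Gamma> \<turnstile> d \<Colon> repl 2 (Succ (Var 1)) C\<rbrakk> \<Longrightarrow>
    \<Gamma> \<turnstile> IndNatural C c d Zero \<doteq> c \<Colon> inst1 Zero C"
| natural_comp_succ: "\<lbrakk>Natural # \<Gamma> \<turnstile> C \<Colon> U i; \<Gamma> \<turnstile> c \<Colon> inst1 Zero C;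
    C # Natural # \<Gamma> \<turnstile> d \<Colon> repl 2 (Succ (Var 1)) C; \<Gamma> \<turnstile> n \<Colon> Natural\<rbrakk> \<Longrightarrow>
    \<Gamma> \<turnstile> IndNatural C c d (Succ n) \<doteq> inst2 n (IndNatural C c d n) d \<Colon> inst1 (Succ n) C"
| natural_intro_succ_cong: "\<Gamma> \<turnstile> n \<doteq> n' \<Colon> Natural \<Longrightarrow> \<Gamma> \<turnstile> Succ n \<doteq> Succ n' \<Colon> Natural"
| natural_elim_cong: "\<lbrakk>Natural # \<Gamma> \<turnstile> C \<doteq> C' \<Colon> U i; \<Gamma> \<turnstile> c \<doteq> c' \<Colon> inst1 Zero C;
    C # Natural # \<Gamma> \<turnstile> d \<doteq> d' \<Colon> repl 2 (Succ (Var 1)) C; \<Gamma> \<turnstile> n \<doteq> n' \<Colon> Natural\<rbrakk> \<Longrightarrow>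
    \<Gamma> \<turnstile> IndNatural C c d n \<doteq> IndNatural C' c' d' n' \<Colon> inst1 n C"

| eq_form: "\<lbrakk>\<Gamma> \<turnstile> A \<Colon> U i; \<Gamma> \<turnstile> a \<Colon> A; \<Gamma> \<turnstile> b \<Colon> A\<rbrakk> \<Longrightarrow> \<Gamma> \<turnstile> Eq A a b \<Colon> U i"
| eq_intro: "\<lbrakk>\<Gamma> \<turnstile> A \<Colon> U i; \<Gamma> \<turnstile> a \<Colon> A\<rbrakk> \<Longrightarrow> \<Gamma> \<turnstile> Refl a \<Colon> Eq A a a"
| eq_elim: "\<lbrakk>Eq (lift 2 A) (Var 1) (Var 0) # lift 1 A # A # \<Gamma> \<turnstile> C \<Colon> U i;
    A # \<Gamma> \<turnstile> c \<Colon> subst (case_nat (Refl (Var 0)) (case_nat (Var 0) Var)) C;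
    \<Gamma> \<turnstile> a \<Colon> A; \<Gamma> \<turnstile> b \<Colon> A; \<Gamma> \<turnstile> p \<Colon> Eq A a b\<rbrakk> \<Longrightarrow>
    \<Gamma> \<turnstile> IndEq C c a b p \<Colon> inst3 a b p C"
| eq_comp: "\<lbrakk>Eq (lift 2 A) (Var 1) (Var 0) # lift 1 A # A # \<Gamma> \<turnstile> C \<Colon> U i;
    A # \<Gamma> \<turnstile> c \<Colon> subst (case_nat (Refl (Var 0)) (case_nat (Var 0) Var)) C; \<Gamma> \<turnstile> a \<Colon> A\<rbrakk> \<Longrightarrow>
    \<Gamma> \<turnstile> IndEq C c a a (Refl a) \<doteq> inst1 a c \<Colon> inst3 a a (Refl a) C"
| eq_form_cong: "\<lbrakk>\<Gamma> \<turnstile> A \<doteq> A' \<Colon> U i; \<Gamma> \<turnstile> a \<doteq> a' \<Colon> A; \<Gamma> \<turnstile> b \<doteq> b' \<Colon> A\<rbrakk> \<Longrightarrow>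
    \<Gamma> \<turnstile> Eq A a b \<doteq> Eq A' a' b' \<Colon> U i"
| eq_intro_cong: "\<lbrakk>\<Gamma> \<turnstile> A \<Colon> U i; \<Gamma> \<turnstile> a \<doteq> a' \<Colon> A\<rbrakk> \<Longrightarrow> \<Gamma> \<turnstile> Refl a \<doteq> Refl a' \<Colon> Eq A a a"
| eq_elim_cong: "\<lbrakk>Eq (lift 2 A) (Var 1) (Var 0) # lift 1 A # A # \<Gamma> \<turnstile> C \<doteq> C' \<Colon> U i;
    A # \<Gamma> \<turnstile> c \<doteq> c' \<Colon> subst (case_nat (Refl (Var 0)) (case_nat (Var 0) Var)) C;
    \<Gamma> \<turnstile> a \<doteq> a' \<Colon> A; \<Gamma> \<turnstile> b \<doteq> b' \<Colon> A; \<Gamma> \<turnstile> p \<doteq> p' \<Colon> Eq A a b\<rbrakk> \<Longrightarrow>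
    \<Gamma> \<turnstile> IndEq C c a b p \<doteq> IndEq C' c' a' b' p' \<Colon> inst3 a b p C"

| funext: "\<lbrakk>\<Gamma> \<turnstile> Pi A B \<Colon> U i; \<Gamma> \<turnstile> f \<Colon> Pi A B; \<Gamma> \<turnstile> g \<Colon> Pi A B\<rbrakk> \<Longrightarrow>
    \<Gamma> \<turnstile> Funext f g \<Colon> is_equiv (Eq (Pi A B) f g) (homotopy A B f g) (happly A B f g)"
| funext_cong: "\<lbrakk>\<Gamma> \<turnstile> Pi A B \<Colon> U i; \<Gamma> \<turnstile> f \<doteq> f' \<Colon> Pi A B; \<Gamma> \<turnstile> g \<doteq> g' \<Colon> Pi A B\<rbrakk> \<Longrightarrow>
    \<Gamma> \<turnstile> Funext f g \<doteq> Funext f' g'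
      \<Colon> is_equiv (Eq (Pi A B) f g) (homotopy A B f g) (happly A B f g)"

| univalence: "\<lbrakk>\<Gamma> \<turnstile> A \<Colon> U i; \<Gamma> \<turnstile> B \<Colon> U i\<rbrakk> \<Longrightarrow>
    \<Gamma> \<turnstile> Univalence A B \<Colon> is_equiv (Eq (U i) A B) (equiv_type A B) (id_to_equiv i A B)"
| univalence_cong: "\<lbrakk>\<Gamma> \<turnstile> A \<doteq> A' \<Colon> U i; \<Gamma> \<turnstile> B \<doteq> B' \<Colon> U i\<rbrakk> \<Longrightarrow>
    \<Gamma> \<turnstile> Univalence A B \<doteq> Univalence A' B'
      \<Colon> is_equiv (Eq (U i) A B) (equiv_type A B) (id_to_equiv i A B)"

| trunc_form: "\<Gamma> \<turnstile> A \<Colon> U i \<Longrightarrow> \<Gamma> \<turnstile> Trunc k A \<Colon> U i"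
| trunc_intro: "\<lbrakk>\<Gamma> \<turnstile> A \<Colon> U i; \<Gamma> \<turnstile> a \<Colon> A\<rbrakk> \<Longrightarrow> \<Gamma> \<turnstile> Tr k a \<Colon> Trunc k A"
| trunc_is_trunc: "\<Gamma> \<turnstile> A \<Colon> U i \<Longrightarrow> \<Gamma> \<turnstile> TruncIsTrunc k A \<Colon> is_trunc k (Trunc k A)"
| trunc_elim: "\<lbrakk>Trunc k A # \<Gamma> \<turnstile> C \<Colon> U i; Trunc k A # \<Gamma> \<turnstile> h \<Colon> is_trunc k C;
    A # \<Gamma> \<turnstile> g \<Colon> repl 1 (Tr k (Var 0)) C; \<Gamma> \<turnstile> t \<Colon> Trunc k A\<rbrakk> \<Longrightarrow>
    \<Gamma> \<turnstile> IndTrunc k C h g t \<Colon> inst1 t C"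
| trunc_comp: "\<lbrakk>Trunc k A # \<Gamma> \<turnstile> C \<Colon> U i; Trunc k A # \<Gamma> \<turnstile> h \<Colon> is_trunc k C;
    A # \<Gamma> \<turnstile> g \<Colon> repl 1 (Tr k (Var 0)) C; \<Gamma> \<turnstile> a \<Colon> A\<rbrakk> \<Longrightarrow>
    \<Gamma> \<turnstile> IndTrunc k C h g (Tr k a) \<doteq> inst1 a g \<Colon> inst1 (Tr k a) C"
| trunc_form_cong: "\<Gamma> \<turnstile> A \<doteq> A' \<Colon> U i \<Longrightarrow> \<Gamma> \<turnstile> Trunc k A \<doteq> Trunc k A' \<Colon> U i"
| trunc_intro_cong: "\<lbrakk>\<Gamma> \<turnstile> A \<Colon> U i; \<Gamma> \<turnstile> a \<doteq> a' \<Colon> A\<rbrakk> \<Longrightarrow>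
    \<Gamma> \<turnstile> Tr k a \<doteq> Tr k a' \<Colon> Trunc k A"
| trunc_is_trunc_cong: "\<Gamma> \<turnstile> A \<doteq> A' \<Colon> U i \<Longrightarrow>
    \<Gamma> \<turnstile> TruncIsTrunc k A \<doteq> TruncIsTrunc k A' \<Colon> is_trunc k (Trunc k A)"
| trunc_elim_cong: "\<lbrakk>Trunc k A # \<Gamma> \<turnstile> C \<doteq> C' \<Colon> U i; Trunc k A # \<Gamma> \<turnstile> h \<doteq> h' \<Colon> is_trunc k C;
    A # \<Gamma> \<turnstile> g \<doteq> g' \<Colon> repl 1 (Tr k (Var 0)) C; \<Gamma> \<turnstile> t \<doteq> t' \<Colon> Trunc k A\<rbrakk> \<Longrightarrow>
    \<Gamma> \<turnstile> IndTrunc k C h g t \<doteq> IndTrunc k C' h' g' t' \<Colon> inst1 t C"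

section \<open>Braided loop spaces and set-based representability\<close>

abbreviation is_set :: "tm \<Rightarrow> tm" where
  "is_set A \<equiv> is_trunc 2 A"

abbreviation is_1type :: "tm \<Rightarrow> tm" where
  "is_1type A \<equiv> Pi A (Pi (lift 1 A) (is_set (Eq (lift 2 A) (Var 1) (Var 0))))"

abbreviation set_trunc :: "tm \<Rightarrow> tm" where
  "set_trunc A \<equiv> Trunc 2 A"

abbreviation set_proj :: "tm \<Rightarrow> tm" where
  "set_proj a \<equiv> Tr 2 a"

text \<open>
  Concatenation of \<open>p : a = b\<close> and \<open>q : b = c\<close> by path induction on \<open>p\<close>, so that
  concatenating \<open>refl\<close> with \<open>q\<close> is judgementally \<open>q\<close>.
\<close>

definition concat_path :: "tm \<Rightarrow> tm \<Rightarrow> tm \<Rightarrow> tm \<Rightarrow> tm \<Rightarrow> tm \<Rightarrow> tm" where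
  "concat_path A a b c p q = App
     (IndEq (Arr (Eq (lift 3 A) (Var 1) (lift 3 c)) (Eq (lift 3 A) (Var 2) (lift 3 c)))
            (Lam (Eq (lift 1 A) (Var 0) (lift 1 c)) (Var 0))
            a b p)
     q"

definition braided_loops :: "tm \<Rightarrow> tm" where
  "braided_loops A =
     Pi A
       (Pi (Eq (lift 1 A) (Var 0) (Var 0))
         (Pi (Eq (lift 2 A) (Var 1) (Var 1))
           (Eq (Eq (lift 3 A) (Var 2) (Var 2))
             (concat_path (lift 3 A) (Var 2) (Var 2) (Var 2) (Var 1) (Var 0))
             (concat_path (lift 3 A) (Var 2) (Var 2) (Var 2) (Var 0) (Var 1)))))"

definition set_based_representable :: "nat \<Rightarrow> tm \<Rightarrow> tm" where
  "set_based_representable i A =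
     Sig (Arr (set_trunc A) (U i))
       (Pi (lift 1 A)
         (equiv_type (App (Var 1) (set_proj (Var 0))) (Eq (lift 2 A) (Var 0) (Var 0))))"

end

theory Submission
  imports Defs
begin

text \<open>
  Let \<open>A\<^sub>1 x\<close> be the type of functions assigning a loop at \<open>b\<close> to every \<open>b : A\<close> with \<open>x = |b|\<close>.
  Evaluation at \<open>a\<close> and \<open>refl\<close> is a map from \<open>A\<^sub>1 |a|\<close> to \<open>a = a\<close>.  A proposition depending on
  \<open>b : A\<close> that holds at \<open>a\<close> holds whenever \<open>|a| = |b|\<close>: propositions form a set by univalence, so the family
  extends to the truncation.  As equality of loops is a proposition, this makes evaluation
  injective.  For a loop \<open>l\<close> at \<open>a\<close>, the type of loops \<open>y\<close> at \<open>b\<close> with \<open>l \<cdot> r = r \<cdot> y\<close> for all \<open>r : a = b\<close> is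
  contractible for \<open>b = a\<close> by the braiding, hence it is contractible for all \<open>b\<close> with \<open>|a| = |b|\<close>,
  and the centres form an element of \<open>A\<^sub>1 |a|\<close> whose value at \<open>a\<close> is \<open>l\<close>.

  No proof term is written out: \<open>inh \<Gamma> A\<close> only asserts that \<open>A\<close> has some inhabitant in context \<open>\<Gamma>\<close>,
  and every step inside type theory is an admissible rule for \<open>inh\<close>, valid in all contexts.
\<close>

section \<open>Substitution algebra\<close>

text \<open>The obstacle is that recursion on \<open>set_trunc A\<close> reaches only sets, whereas
  the wanted family takes values in a universe, which is not a set. A type of functions out of
  \<open>A\<close> needs no such recursion; the only maps extended along the truncation take values
  in the set of propositions. The price is that only propositions travel along |a| = |b|, and no
  path from a to b can be extracted from it. A loop l at a therefore cannot be moved to b directly: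
  its conjugate r^-1 . l . r depends on a path r. Demanding l . r = r . y for every r says, without
  inverses, that y is the conjugate along all r at once. At b = a the trivial r forces y = l, and
  that l qualifies is the braiding itself. Because \<open>A\<close> is a 1-type the demand is a
  proposition, so loops satisfying it are compared by their underlying loops alone. What travels to
  b is the contractibility of the type of such y, not any loop.\<close>

lemma up_ren_simps [simp]: "up_ren \<rho> 0 = 0" "up_ren \<rho> (Suc n) = Suc (\<rho> n)"
  by (simp_all add: up_ren_def)

lemma up_simps [simp]: "up \<sigma> 0 = Var 0" "up \<sigma> (Suc n) = ren Suc (\<sigma> n)"
  by (simp_all add: up_def lift_def)

lemma up_ren_comp: "(\<lambda>n. up_ren \<rho> (up_ren \<rho>' n)) = up_ren (\<lambda>n. \<rho> (\<rho>' n))"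
  by (auto simp: fun_eq_iff up_ren_def split: nat.split)

lemma ren_ren: "ren \<rho> (ren \<rho>' t) = ren (\<lambda>n. \<rho> (\<rho>' n)) t"
  by (induction t arbitrary: \<rho> \<rho>') (simp_all add: up_ren_comp)

lemma up_Var: "up (\<lambda>n. Var (\<rho> n)) = (\<lambda>n. Var (up_ren \<rho> n))"
  by (auto simp: fun_eq_iff up_def up_ren_def lift_def split: nat.split)

lemma ren_eq_subst: "ren \<rho> t = subst (\<lambda>n. Var (\<rho> n)) t"
  by (induction t arbitrary: \<rho>) (simp_all add: up_Var)

lemma up_up_ren: "(\<lambda>n. up \<sigma> (up_ren \<rho> n)) = up (\<lambda>n. \<sigma> (\<rho> n))"
  by (auto simp: fun_eq_iff up_def up_ren_def split: nat.split)

lemma subst_ren: "subst \<sigma> (ren \<rho> t) = subst (\<lambda>n. \<sigma> (\<rho> n)) t"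
  by (induction t arbitrary: \<sigma> \<rho>) (simp_all add: up_up_ren)

lemma ren_up: "(\<lambda>n. ren (up_ren \<rho>) (up \<sigma> n)) = up (\<lambda>n. ren \<rho> (\<sigma> n))"
  by (auto simp: fun_eq_iff up_def lift_def ren_ren split: nat.split)

lemma ren_subst: "ren \<rho> (subst \<sigma> t) = subst (\<lambda>n. ren \<rho> (\<sigma> n)) t"
  by (induction t arbitrary: \<sigma> \<rho>) (simp_all add: ren_up)

lemma subst_up: "(\<lambda>n. subst (up \<sigma>) (up \<tau> n)) = up (\<lambda>n. subst \<sigma> (\<tau> n))"
  by (auto simp: fun_eq_iff up_def lift_def subst_ren ren_subst split: nat.split)

lemma subst_subst: "subst \<sigma> (subst \<tau> t) = subst (\<lambda>n. subst \<sigma> (\<tau> n)) t"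
  by (induction t arbitrary: \<sigma> \<tau>) (simp_all add: subst_up)

lemma up_Var_id [simp]: "up Var = Var"
  by (auto simp: fun_eq_iff up_def lift_def split: nat.split)

lemma subst_Var [simp]: "subst Var t = t"
  by (induction t) simp_all

text \<open>
  The simplifier does not descend into the branches of a \<open>case\<close> expression, so the extension of a
  substitution gets its own constant.
\<close>

definition scons :: "tm \<Rightarrow> (nat \<Rightarrow> tm) \<Rightarrow> nat \<Rightarrow> tm" where
  "scons a \<sigma> = case_nat a \<sigma>"

lemma scons_simps [simp]: "scons a \<sigma> 0 = a" "scons a \<sigma> (Suc n) = \<sigma> n"
  by (simp_all add: scons_def)

lemma subst_scons: "subst \<tau> (scons a \<sigma> n) = scons (subst \<tau> a) (\<lambda>m. subst \<tau> (\<sigma> m)) n"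
  by (cases n) simp_all

lemma scons_Var: "scons (Var 0) (\<lambda>n. Var (Suc n)) = Var"
  by (auto simp: fun_eq_iff scons_def split: nat.split)

lemma scons_shift: "scons (Var k) (\<lambda>n. Var (Suc (n + k))) = (\<lambda>n. Var (n + k))"
  by (auto simp: fun_eq_iff scons_def split: nat.split)

lemma up_scons: "up \<sigma> = scons (Var 0) (\<lambda>n. subst (\<lambda>m. Var (Suc m)) (\<sigma> n))"
  by (simp add: up_def scons_def lift_def ren_eq_subst)

lemma up_ren_scons: "(\<lambda>n. Var (up_ren \<rho> n)) = scons (Var 0) (\<lambda>n. Var (Suc (\<rho> n)))"
  by (auto simp: fun_eq_iff scons_def split: nat.split)

lemma lift_subst: "lift k t = subst (\<lambda>n. Var (n + k)) t"
  by (simp add: lift_def ren_eq_subst)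

lemma inst1_subst: "inst1 a = subst (scons a Var)"
  by (simp add: inst1_def scons_def)

lemma inst2_subst: "inst2 a b = subst (scons b (scons a Var))"
  by (simp add: inst2_def scons_def)

lemma inst3_subst: "inst3 a b c = subst (scons c (scons b (scons a Var)))"
  by (simp add: inst3_def scons_def)

lemma repl_subst: "repl k a = subst (scons a (\<lambda>n. Var (n + k)))"
  by (simp add: repl_def scons_def)

lemma case_nat_scons: "subst (case_nat a (case_nat b \<sigma>)) = subst (scons a (scons b \<sigma>))"
  by (simp add: scons_def)

text \<open>
  Normal forms: the only operation left is \<open>subst\<close>, indices and shifts are written with \<open>Suc\<close>.
\<close>

lemmas sub = subst_subst subst_scons scons_Var scons_shift [of "Suc 0", simplified]
  scons_shift [of "Suc (Suc 0)", simplified] scons_shift [of "Suc (Suc (Suc 0))", simplified]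
  scons_shift [of "Suc (Suc (Suc (Suc 0)))", simplified]
  up_scons up_ren_scons lift_subst inst1_subst inst2_subst inst3_subst repl_subst ren_eq_subst
  case_nat_scons numeral_eq_Suc

declare ren.simps [simp del] up_simps [simp del]

section \<open>Admissibility of substitution\<close>

text \<open>The commutation rules from here to \<open>subst_happly\<close> turn the substituted form
  of a typing rule into an instance of the same rule. The shifts match the numbers of binders below
  which rules and defined types weaken a term.\<close>

lemma subst_lift [simp]:
  "subst (up \<sigma>) (lift 1 t) = lift 1 (subst \<sigma> t)"
  "subst (up (up \<sigma>)) (lift 2 t) = lift 2 (subst \<sigma> t)"
  "subst (up (up (up \<sigma>))) (lift 3 t) = lift 3 (subst \<sigma> t)"
  "subst (up (up (up (up \<sigma>)))) (lift 4 t) = lift 4 (subst \<sigma> t)"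
  by (simp_all add: sub)

lemma subst_inst1 [simp]: "subst \<sigma> (inst1 a B) = inst1 (subst \<sigma> a) (subst (up \<sigma>) B)"
  and subst_inst2 [simp]: "subst \<sigma> (inst2 a b B) = inst2 (subst \<sigma> a) (subst \<sigma> b) (subst (up (up \<sigma>))
      B)"
  and subst_inst3 [simp]:
    "subst \<sigma> (inst3 a b c B) = inst3 (subst \<sigma> a) (subst \<sigma> b) (subst \<sigma> c) (subst (up (up (up \<sigma>))) B)"
  and subst_repl1 [simp]: "subst (up \<sigma>) (repl 1 t B) = repl 1 (subst (up \<sigma>) t) (subst (up \<sigma>) B)"
  and subst_repl2 [simp]:
    "subst (up (up \<sigma>)) (repl 2 t B) = repl 2 (subst (up (up \<sigma>)) t) (subst (up \<sigma>) B)"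
  and subst_diag [simp]:
    "subst (up \<sigma>) (subst (case_nat (Refl (Var 0)) (case_nat (Var 0) Var)) B) =
       subst (case_nat (Refl (Var 0)) (case_nat (Var 0) Var)) (subst (up (up (up \<sigma>))) B)"
  and subst_up4 [simp]:
    "subst (up (up (up (up (up \<sigma>))))) (ren (up_ren (\<lambda>n. n + 4)) B) =
       ren (up_ren (\<lambda>n. n + 4)) (subst (up \<sigma>) B)"
  by (simp_all add: sub)

lemma up_Suc [simp]: "up \<sigma> 0 = Var 0" "up (up \<sigma>) 1 = Var 1"
  "up (up (up \<sigma>)) 2 = Var 2" "up (up (up (up \<sigma>))) 3 = Var 3"
  "up (up (up \<sigma>)) 1 = Var 1" "up (up (up (up \<sigma>))) 2 = Var 2"
  by (simp_all add: sub)

lemma subst_Arr [simp]: "subst \<sigma> (Arr A B) = Arr (subst \<sigma> A) (subst \<sigma> B)"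
  and subst_Prod [simp]: "subst \<sigma> (Prod A B) = Prod (subst \<sigma> A) (subst \<sigma> B)"
  by (simp_all add: Arr_def Prod_def del: One_nat_def)

lemma subst_is_trunc [simp]: "subst \<sigma> (is_trunc k A) = is_trunc k (subst \<sigma> A)"
  by (induction k arbitrary: \<sigma> A) (simp_all del: One_nat_def)

lemma subst_is_equiv [simp]:
  "subst \<sigma> (is_equiv A B f) = is_equiv (subst \<sigma> A) (subst \<sigma> B) (subst \<sigma> f)"
  by (simp add: is_equiv_def del: One_nat_def)

lemma subst_equiv_type [simp]: "subst \<sigma> (equiv_type A B) = equiv_type (subst \<sigma> A) (subst \<sigma> B)"
  by (simp add: equiv_type_def del: One_nat_def)

lemma subst_id_to_equiv [simp]:
  "subst \<sigma> (id_to_equiv i A B) = id_to_equiv i (subst \<sigma> A) (subst \<sigma> B)"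
  by (simp add: id_to_equiv_def id_equiv_def Let_def del: One_nat_def)

lemma subst_homotopy [simp]:
  "subst \<sigma> (homotopy A B f g) = homotopy (subst \<sigma> A) (subst (up \<sigma>) B) (subst \<sigma> f) (subst \<sigma> g)"
  by (simp add: homotopy_def del: One_nat_def)

lemma subst_happly [simp]:
  "subst \<sigma> (happly A B f g) = happly (subst \<sigma> A) (subst (up \<sigma>) B) (subst \<sigma> f) (subst \<sigma> g)"
  by (simp add: happly_def del: One_nat_def)

text \<open>
  The predicate \<open>S\<close> is a class of substitutions closed under passing below a binder.  Weakening is
  needed to see that all well-typed substitutions form such a class, and renamings are the
  class from which weakening is obtained.  The predicate \<open>ok\<close> records the induction hypothesis
  for the types declared in a context, because some rules extend the context by a
  type without a premise on that type.
\<close>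

locale subst_class =
  fixes S :: "(nat \<Rightarrow> tm) \<Rightarrow> tm list \<Rightarrow> tm list \<Rightarrow> bool"
  assumes S_var: "\<lbrakk>S \<sigma> \<Gamma> \<Delta>; ctx \<Delta>; n < length \<Gamma>\<rbrakk> \<Longrightarrow>
      \<Delta> \<turnstile> \<sigma> n \<Colon> subst \<sigma> (lift (Suc n) (\<Gamma> ! n))"
    and S_up: "\<lbrakk>S \<sigma> \<Gamma> \<Delta>; \<Delta> \<turnstile> subst \<sigma> A \<Colon> U i\<rbrakk> \<Longrightarrow> S (up \<sigma>) (A # \<Gamma>) (subst \<sigma> A # \<Delta>)"
begin

definition adm :: "(nat \<Rightarrow> tm) \<Rightarrow> tm list \<Rightarrow> tm list \<Rightarrow> bool" where
  "adm \<sigma> \<Gamma> \<Delta> \<longleftrightarrow> S \<sigma> \<Gamma> \<Delta> \<and> ctx \<Delta>"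

primrec ok :: "tm list \<Rightarrow> bool" where
  "ok [] \<longleftrightarrow> True"
| "ok (A # \<Gamma>) \<longleftrightarrow> (\<forall>\<sigma> \<Delta>. adm \<sigma> \<Gamma> \<Delta> \<longrightarrow> (\<exists>i. \<Delta> \<turnstile> subst \<sigma> A \<Colon> U i)) \<and> ok \<Gamma>"

lemma adm_up:
  "ok (A # \<Gamma>) \<Longrightarrow> adm \<sigma> \<Gamma> \<Delta> \<Longrightarrow> adm (up \<sigma>) (A # \<Gamma>) (subst \<sigma> A # \<Delta>)"
  by (auto simp: adm_def intro: S_up ctx_extend)

lemma adm_ctx: "adm \<sigma> \<Gamma> \<Delta> \<Longrightarrow> ctx \<Delta>"
  by (simp add: adm_def)

text \<open>Induction hypotheses read off below up to three binders; three is the maximum, since the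
  motive of \<open>IndEq\<close> binds two end points and a path. The conjunct \<open>ok\<close>
  supplies the well-typedness of the types passed on the way.\<close>

lemma IH0: "ok \<Gamma> \<and> (\<forall>\<sigma> \<Delta>. adm \<sigma> \<Gamma> \<Delta> \<longrightarrow> P \<sigma> \<Delta>) \<Longrightarrow> adm \<sigma> \<Gamma> \<Delta> \<Longrightarrow> P \<sigma> \<Delta>"
  and IH1: "ok (A # \<Gamma>) \<and> (\<forall>\<sigma> \<Delta>. adm \<sigma> (A # \<Gamma>) \<Delta> \<longrightarrow> P \<sigma> \<Delta>) \<Longrightarrow> adm \<sigma> \<Gamma> \<Delta> \<Longrightarrow>
    P (up \<sigma>) (subst \<sigma> A # \<Delta>)"
  and IH2: "ok (B # A # \<Gamma>) \<and> (\<forall>\<sigma> \<Delta>. adm \<sigma> (B # A # \<Gamma>) \<Delta> \<longrightarrow> P \<sigma> \<Delta>) \<Longrightarrow> adm \<sigma> \<Gamma> \<Delta> \<Longrightarrow>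
    P (up (up \<sigma>)) (subst (up \<sigma>) B # subst \<sigma> A # \<Delta>)"
  and IH3: "ok (C # B # A # \<Gamma>) \<and> (\<forall>\<sigma> \<Delta>. adm \<sigma> (C # B # A # \<Gamma>) \<Delta> \<longrightarrow> P \<sigma> \<Delta>) \<Longrightarrow>
    adm \<sigma> \<Gamma> \<Delta> \<Longrightarrow>
    P (up (up (up \<sigma>))) (subst (up (up \<sigma>)) C # subst (up \<sigma>) B # subst \<sigma> A # \<Delta>)"
  by (simp_all add: adm_up del: ok.simps) (metis adm_up ok.simps(2))+

lemma subst_admissible:
  "ctx \<Gamma> \<Longrightarrow> ok \<Gamma>"
  "\<Gamma> \<turnstile> t \<Colon> A \<Longrightarrow> ok \<Gamma> \<and> (\<forall>\<sigma> \<Delta>. adm \<sigma> \<Gamma> \<Delta> \<longrightarrow> \<Delta> \<turnstile> subst \<sigma> t \<Colon> subst \<sigma> A)"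
  "\<Gamma> \<turnstile> t \<doteq> u \<Colon> A \<Longrightarrow> ok \<Gamma> \<and> (\<forall>\<sigma> \<Delta>. adm \<sigma> \<Gamma> \<Delta> \<longrightarrow> \<Delta> \<turnstile> subst \<sigma> t \<doteq> subst \<sigma> u \<Colon> subst \<sigma> A)"
proof (induction rule: ctx_has_type_jeq.inducts)
  case ctx_empty then show ?case by simp
next
  case ctx_extend then show ?case by auto
next
  case var then show ?case by (auto simp: adm_def intro: S_var)
\<comment> \<open>Every other rule is closed under substitution by one argument: specialise the
  hypotheses below the binders, normalise with the commutation rules, and apply the rule
  itself.\<close>
qed (rule conjI, blast, intro allI impI, frule adm_ctx,
    ((drule (1) IH0 | drule (1) IH1 | drule (1) IH2 | drule (1) IH3)+)?,
    (simp del: ok.simps One_nat_def)?, (rule ctx_has_type_jeq.intros; assumption))+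

end

lemma ctx_of_judgement:
  "ctx \<Gamma> \<Longrightarrow> True"
  "\<Gamma> \<turnstile> t \<Colon> A \<Longrightarrow> ctx \<Gamma>"
  "\<Gamma> \<turnstile> t \<doteq> u \<Colon> A \<Longrightarrow> ctx \<Gamma>"
  by (induction rule: ctx_has_type_jeq.inducts) auto

section \<open>Admissible rules for inhabitation\<close>

text \<open>The universe index is forgotten; where a formation rule asks for one universe for two
  types, cumulativity recovers a common index in \<open>isty_pair\<close>.\<close>

definition isty :: "tm list \<Rightarrow> tm \<Rightarrow> bool" where
  "isty \<Gamma> A \<longleftrightarrow> (\<exists>i. \<Gamma> \<turnstile> A \<Colon> U i)"

definition inh :: "tm list \<Rightarrow> tm \<Rightarrow> bool" where
  "inh \<Gamma> A \<longleftrightarrow> (\<exists>t. \<Gamma> \<turnstile> t \<Colon> A)"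

lemma ctx_Nil [simp]: "ctx []"
  by (rule ctx_empty)

lemma ctx_Cons [simp]: "ctx (A # \<Gamma>) \<longleftrightarrow> isty \<Gamma> A"
  unfolding isty_def by (auto intro: ctx_extend elim: ctx.cases)

lemma isty_ctx: "isty \<Gamma> A \<Longrightarrow> ctx \<Gamma>"
  by (auto simp: isty_def dest: ctx_of_judgement)

lemma inhI: "\<Gamma> \<turnstile> t \<Colon> A \<Longrightarrow> inh \<Gamma> A"
  by (auto simp: inh_def)

lemma inhE: "inh \<Gamma> A \<Longrightarrow> (\<And>t. \<Gamma> \<turnstile> t \<Colon> A \<Longrightarrow> P) \<Longrightarrow> P"
  by (auto simp: inh_def)

section \<open>Renamings, weakening and well-typed substitutions\<close>

definition is_ren :: "(nat \<Rightarrow> tm) \<Rightarrow> tm list \<Rightarrow> tm list \<Rightarrow> bool" where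
  "is_ren \<sigma> \<Gamma> \<Delta> \<longleftrightarrow> (\<exists>\<rho>. \<sigma> = (\<lambda>n. Var (\<rho> n)) \<and> (\<forall>n < length \<Gamma>. \<rho> n < length \<Delta> \<and>
     lift (Suc (\<rho> n)) (\<Delta> ! \<rho> n) = subst \<sigma> (lift (Suc n) (\<Gamma> ! n))))"

text \<open>A renaming sends variables to variables, so the variable rule alone types its entries.
  This makes weakening derivable at this point.\<close>

interpretation ren: subst_class is_ren
proof
  fix \<sigma> \<Gamma> \<Delta> n assume "is_ren \<sigma> \<Gamma> \<Delta>" "ctx \<Delta>" "n < length \<Gamma>"
  then show "\<Delta> \<turnstile> \<sigma> n \<Colon> subst \<sigma> (lift (Suc n) (\<Gamma> ! n))"
    unfolding is_ren_def by (metis var)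
next
  fix \<sigma> \<Gamma> \<Delta> A i assume "is_ren \<sigma> \<Gamma> \<Delta>"
  then obtain \<rho> where \<sigma>: "\<sigma> = (\<lambda>n. Var (\<rho> n))" and \<rho>: "\<And>n. n < length \<Gamma> \<Longrightarrow> \<rho> n < length \<Delta> \<and>
      lift (Suc (\<rho> n)) (\<Delta> ! \<rho> n) = subst \<sigma> (lift (Suc n) (\<Gamma> ! n))"
    unfolding is_ren_def by blast
  have "up_ren \<rho> n < length (subst \<sigma> A # \<Delta>) \<and>
      lift (Suc (up_ren \<rho> n)) ((subst \<sigma> A # \<Delta>) ! up_ren \<rho> n) =
      subst (up \<sigma>) (lift (Suc n) ((A # \<Gamma>) ! n))" if "n < length (A # \<Gamma>)" for n
  proof (cases n)
    case 0 then show ?thesis by (simp add: sub \<sigma>)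
  next
    case (Suc m)
    have "lift (Suc (Suc (\<rho> m))) (\<Delta> ! \<rho> m) = lift 1 (lift (Suc (\<rho> m)) (\<Delta> ! \<rho> m))"
      by (simp add: sub)
    also have "\<dots> = lift 1 (subst \<sigma> (lift (Suc m) (\<Gamma> ! m)))"
      using \<rho>[of m] that Suc by simp
    finally show ?thesis using Suc that \<rho>[of m] by (simp add: sub \<sigma>)
  qed
  moreover have "up \<sigma> = (\<lambda>n. Var (up_ren \<rho> n))" by (simp add: \<sigma> up_Var)
  ultimately show "is_ren (up \<sigma>) (A # \<Gamma>) (subst \<sigma> A # \<Delta>)"
    unfolding is_ren_def by blast
qed

lemma is_ren_weaken: "is_ren (\<lambda>n. Var (Suc n)) \<Gamma> (B # \<Gamma>)"
  unfolding is_ren_def by (intro exI[of _ Suc]) (simp add: sub)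

lemma weaken: "\<Gamma> \<turnstile> t \<Colon> A \<Longrightarrow> isty \<Gamma> B \<Longrightarrow> B # \<Gamma> \<turnstile> lift 1 t \<Colon> lift 1 A"
  using ren.subst_admissible(2) is_ren_weaken by (auto simp: ren.adm_def lift_subst)

definition wf_subst :: "(nat \<Rightarrow> tm) \<Rightarrow> tm list \<Rightarrow> tm list \<Rightarrow> bool" where
  "wf_subst \<sigma> \<Gamma> \<Delta> \<longleftrightarrow> (\<forall>n < length \<Gamma>. \<Delta> \<turnstile> \<sigma> n \<Colon> subst \<sigma> (lift (Suc n) (\<Gamma> ! n)))"

text \<open>Passing below a binder shifts every entry, and \<open>weaken\<close> types the shifted
  entries in the extended context.\<close>

interpretation subst: subst_class wf_subst
proof
  fix \<sigma> \<Gamma> \<Delta> A i assume s: "wf_subst \<sigma> \<Gamma> \<Delta>" and A: "\<Delta> \<turnstile> subst \<sigma> A \<Colon> U i"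
  have "subst \<sigma> A # \<Delta> \<turnstile> up \<sigma> n \<Colon> subst (up \<sigma>) (lift (Suc n) ((A # \<Gamma>) ! n))"
    if "n < length (A # \<Gamma>)" for n
  proof (cases n)
    case 0
    then show ?thesis using var[of "subst \<sigma> A # \<Delta>" 0] A by (auto simp: sub isty_def)
  next
    case (Suc m)
    then have "\<Delta> \<turnstile> \<sigma> m \<Colon> subst \<sigma> (lift (Suc m) (\<Gamma> ! m))"
      using s that by (simp add: wf_subst_def)
    from weaken[OF this, of "subst \<sigma> A"] show ?thesis using A Suc by (auto simp: sub isty_def)
  qed
  then show "wf_subst (up \<sigma>) (A # \<Gamma>) (subst \<sigma> A # \<Delta>)" by (simp add: wf_subst_def)
qed (simp add: wf_subst_def)

lemma subst_type: "\<lbrakk>\<Gamma> \<turnstile> t \<Colon> A; wf_subst \<sigma> \<Gamma> \<Delta>; ctx \<Delta>; subst \<sigma> A = B\<rbrakk> \<Longrightarrow> \<Delta> \<turnstile> subst \<sigma> t \<Colon> B"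
  using subst.subst_admissible(2) by (auto simp: subst.adm_def)

lemma subst_isty: "\<lbrakk>isty \<Gamma> A; wf_subst \<sigma> \<Gamma> \<Delta>; ctx \<Delta>\<rbrakk> \<Longrightarrow> isty \<Delta> (subst \<sigma> A)"
  using subst_type[where A = "U i" and B = "U i" for i] unfolding isty_def
  by (metis subst.simps(2))

lemma subst_inh: "\<lbrakk>inh \<Gamma> A; wf_subst \<sigma> \<Gamma> \<Delta>; ctx \<Delta>; subst \<sigma> A = B\<rbrakk> \<Longrightarrow> inh \<Delta> B"
  by (auto simp: inh_def dest: subst_type)

lemma var_type [intro!]: "\<lbrakk>ctx \<Gamma>; n < length \<Gamma>; lift (Suc n) (\<Gamma> ! n) = A\<rbrakk> \<Longrightarrow> \<Gamma> \<turnstile> Var n \<Colon> A"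
  using var by blast

text \<open>This rule and the shifts that follow reduce the well-typedness of an explicit
  substitution to typing its finitely many new entries, which automation can do.\<close>

lemma wf_subst_scons [simp]:
  "wf_subst (scons a \<sigma>) (A # \<Gamma>) \<Delta> \<longleftrightarrow> \<Delta> \<turnstile> a \<Colon> subst \<sigma> A \<and> wf_subst \<sigma> \<Gamma> \<Delta>"
  by (auto simp: wf_subst_def sub less_Suc_eq_0_disj)

lemma wf_subst_shift [intro!]:
  "ctx \<Gamma> \<Longrightarrow> wf_subst Var \<Gamma> \<Gamma>"
  "ctx (B # \<Gamma>) \<Longrightarrow> wf_subst (\<lambda>n. Var (Suc n)) \<Gamma> (B # \<Gamma>)"
  "ctx (C # B # \<Gamma>) \<Longrightarrow> wf_subst (\<lambda>n. Var (Suc (Suc n))) \<Gamma> (C # B # \<Gamma>)"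
  "ctx (D # C # B # \<Gamma>) \<Longrightarrow> wf_subst (\<lambda>n. Var (Suc (Suc (Suc n)))) \<Gamma> (D # C # B # \<Gamma>)"
  "ctx (E # D # C # B # \<Gamma>) \<Longrightarrow>
     wf_subst (\<lambda>n. Var (Suc (Suc (Suc (Suc n))))) \<Gamma> (E # D # C # B # \<Gamma>)"
  "ctx (F # E # D # C # B # \<Gamma>) \<Longrightarrow>
     wf_subst (\<lambda>n. Var (Suc (Suc (Suc (Suc (Suc n)))))) \<Gamma> (F # E # D # C # B # \<Gamma>)"
  by (auto simp: wf_subst_def sub )

lemma has_type_mono: "\<Gamma> \<turnstile> A \<Colon> U i \<Longrightarrow> i \<le> j \<Longrightarrow> \<Gamma> \<turnstile> A \<Colon> U j"
  by (induction j) (auto simp: le_Suc_eq intro: cumul)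

lemma isty_pair:
  assumes "isty \<Gamma> A" "isty \<Delta> B"
  obtains i where "\<Gamma> \<turnstile> A \<Colon> U i" "\<Delta> \<turnstile> B \<Colon> U i"
  using assms unfolding isty_def by (meson has_type_mono max.cobounded1 max.cobounded2)

section \<open>Formation of types, and weakening of types and inhabitants\<close>

lemma isty_univ [intro!]: "ctx \<Gamma> \<Longrightarrow> isty \<Gamma> (U i)"
  using univ by (auto simp: isty_def)

lemma isty_Unit [intro!]: "ctx \<Gamma> \<Longrightarrow> isty \<Gamma> Unit"
  using unit_form by (auto simp: isty_def)

lemma isty_Pi [intro!]: "\<lbrakk>isty \<Gamma> A; isty (A # \<Gamma>) B\<rbrakk> \<Longrightarrow> isty \<Gamma> (Pi A B)"
  by (erule (1) isty_pair) (auto simp: isty_def intro: pi_form)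

lemma isty_Sig [intro!]: "\<lbrakk>isty \<Gamma> A; isty (A # \<Gamma>) B\<rbrakk> \<Longrightarrow> isty \<Gamma> (Sig A B)"
  by (erule (1) isty_pair) (auto simp: isty_def intro: sig_form)

lemma isty_Eq [intro!]: "\<lbrakk>isty \<Gamma> A; \<Gamma> \<turnstile> a \<Colon> A; \<Gamma> \<turnstile> b \<Colon> A\<rbrakk> \<Longrightarrow> isty \<Gamma> (Eq A a b)"
  by (auto simp: isty_def intro: eq_form)

lemma isty_Trunc [intro!]: "isty \<Gamma> A \<Longrightarrow> isty \<Gamma> (Trunc k A)"
  by (auto simp: isty_def intro: trunc_form)

lemma isty_U: "\<Gamma> \<turnstile> A \<Colon> U i \<Longrightarrow> isty \<Gamma> A"
  by (auto simp: isty_def)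

lemma isty_lift: "\<lbrakk>isty \<Gamma> A; isty \<Gamma> B\<rbrakk> \<Longrightarrow> isty (B # \<Gamma>) (lift 1 A)"
  unfolding lift_subst by (erule subst_isty) (auto simp: isty_ctx)

lemma isty_contr_tail:
  assumes A: "isty \<Gamma> A"
  shows "isty (A # \<Gamma>) (Pi (lift 1 A) (Eq (lift 2 A) (Var 1) (Var 0)))"
  using A isty_ctx[OF A] by (auto simp: sub intro!: subst_isty[OF A])

lemma weaken2: "\<Gamma> \<turnstile> t \<Colon> A \<Longrightarrow> ctx (C # B # \<Gamma>) \<Longrightarrow> C # B # \<Gamma> \<turnstile> lift 2 t \<Colon> lift 2 A"
  unfolding lift_subst by (erule subst_type) (auto simp: sub)

lemma inh_lift: "\<lbrakk>inh \<Gamma> A; isty \<Gamma> B\<rbrakk> \<Longrightarrow> inh (B # \<Gamma>) (lift 1 A)"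
  unfolding inh_def by (blast intro: weaken)

lemma inh_lift2: "\<lbrakk>inh \<Gamma> A; ctx (C # B # \<Gamma>)\<rbrakk> \<Longrightarrow> inh (C # B # \<Gamma>) (lift 2 A)"
  unfolding inh_def by (blast intro: weaken2)

lemma isty_is_trunc: "isty \<Gamma> A \<Longrightarrow> isty \<Gamma> (is_trunc k A)"
proof (induction k arbitrary: \<Gamma> A)
  case 0
  show ?case unfolding is_trunc.simps by (rule isty_Sig[OF 0 isty_contr_tail[OF 0]])
next
  case (Suc k)
  note A = Suc.prems
  have "isty (lift 1 A # A # \<Gamma>) (Eq (lift 2 A) (Var 1) (Var 0))"
    using A isty_ctx[OF A] by (auto simp: sub intro!: subst_isty[OF A])
  from Suc.IH[OF this] show ?case
    unfolding is_trunc.simps by (intro isty_Pi A isty_lift[OF A A])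
qed

lemma isty_is_1type: "isty \<Gamma> A \<Longrightarrow> isty \<Gamma> (is_1type A)"
  using isty_is_trunc[of \<Gamma> A "Suc 2"] by (simp only: is_trunc.simps(2))

lemma lam_type: "\<lbrakk>isty \<Gamma> A; A # \<Gamma> \<turnstile> b \<Colon> B\<rbrakk> \<Longrightarrow> \<Gamma> \<turnstile> Lam A b \<Colon> Pi A B"
  by (auto simp: isty_def intro: pi_intro)

lemma app_type: "\<lbrakk>\<Gamma> \<turnstile> f \<Colon> Pi A B; \<Gamma> \<turnstile> a \<Colon> A; inst1 a B = C\<rbrakk> \<Longrightarrow> \<Gamma> \<turnstile> App f a \<Colon> C"
  using pi_elim by blast

lemma app_Arr: "\<lbrakk>\<Gamma> \<turnstile> f \<Colon> Arr A B; \<Gamma> \<turnstile> a \<Colon> A\<rbrakk> \<Longrightarrow> \<Gamma> \<turnstile> App f a \<Colon> B"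
  unfolding Arr_def by (erule app_type) (simp_all add: sub)

lemma isty_Arr [intro!]: "\<lbrakk>isty \<Gamma> A; isty \<Gamma> B\<rbrakk> \<Longrightarrow> isty \<Gamma> (Arr A B)"
  unfolding Arr_def by (auto simp: sub isty_ctx intro!: subst_isty[of \<Gamma> B])

lemma isty_Prod [intro!]: "\<lbrakk>isty \<Gamma> A; isty \<Gamma> B\<rbrakk> \<Longrightarrow> isty \<Gamma> (Prod A B)"
  unfolding Prod_def by (auto simp: sub isty_ctx intro!: subst_isty[of \<Gamma> B])

lemma refl_type: "\<lbrakk>isty \<Gamma> A; \<Gamma> \<turnstile> a \<Colon> A\<rbrakk> \<Longrightarrow> \<Gamma> \<turnstile> Refl a \<Colon> Eq A a a"
  by (auto simp: isty_def intro: eq_intro)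

lemma Tr_type: "\<lbrakk>isty \<Gamma> A; \<Gamma> \<turnstile> a \<Colon> A\<rbrakk> \<Longrightarrow> \<Gamma> \<turnstile> Tr k a \<Colon> Trunc k A"
  by (auto simp: isty_def intro: trunc_intro)

section \<open>Rules for bare inhabitation\<close>

lemma inh_refl: "\<lbrakk>isty \<Gamma> A; \<Gamma> \<turnstile> a \<Colon> A\<rbrakk> \<Longrightarrow> inh \<Gamma> (Eq A a a)"
  by (blast intro: inhI refl_type)

lemma inh_Pi: "isty \<Gamma> A \<Longrightarrow> inh (A # \<Gamma>) B \<Longrightarrow> inh \<Gamma> (Pi A B)"
  by (auto simp: inh_def intro: lam_type)

lemma inh_app: "\<lbrakk>inh \<Gamma> (Pi A B); \<Gamma> \<turnstile> a \<Colon> A; inst1 a B = C\<rbrakk> \<Longrightarrow> inh \<Gamma> C"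
  by (auto simp: inh_def intro: app_type)

text \<open>From left to right, the function is weakened and applied to the new variable.\<close>

lemma inh_lam_iff: "isty \<Gamma> A \<Longrightarrow> inh \<Gamma> (Pi A B) \<longleftrightarrow> inh (A # \<Gamma>) B"
proof (intro iffI inh_Pi)
  assume A: "isty \<Gamma> A" and AB: "inh \<Gamma> (Pi A B)"
  have "inh (A # \<Gamma>) (Pi (lift 1 A) (ren (up_ren Suc) B))"
    by (rule subst_inh[OF AB]) (use A in \<open>auto simp: sub isty_ctx\<close>)
  then show "inh (A # \<Gamma>) B"
    by (rule inh_app[where a = "Var 0"]) (use A in \<open>auto simp: sub isty_ctx intro!: var_type\<close>)
qed

lemma inh_conv: "inh \<Gamma> A \<Longrightarrow> \<Gamma> \<turnstile> A \<doteq> B \<Colon> U i \<Longrightarrow> inh \<Gamma> B"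
  by (auto simp: inh_def intro: conv)

lemma pair_type: "\<lbrakk>isty (A # \<Gamma>) B; \<Gamma> \<turnstile> a \<Colon> A; \<Gamma> \<turnstile> b \<Colon> inst1 a B\<rbrakk> \<Longrightarrow> \<Gamma> \<turnstile> Tuple a b \<Colon> Sig A B"
  by (auto simp: isty_def intro: sig_intro)

lemma inh_pair: "\<lbrakk>isty (A # \<Gamma>) B; \<Gamma> \<turnstile> a \<Colon> A; inh \<Gamma> (inst1 a B)\<rbrakk> \<Longrightarrow> inh \<Gamma> (Sig A B)"
  by (auto simp: inh_def intro: pair_type)

lemma inh_Sig_ind:
  "\<lbrakk>isty (Sig A B # \<Gamma>) C; inh (B # A # \<Gamma>) (repl 2 (Tuple (Var 1) (Var 0)) C); \<Gamma> \<turnstile> p \<Colon> Sig A B;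
    inst1 p C = C'\<rbrakk> \<Longrightarrow> inh \<Gamma> C'"
  unfolding inh_def isty_def by (blast intro: sig_elim)

lemma ind_eq:
  "\<lbrakk>isty (Eq (lift 2 A) (Var 1) (Var 0) # lift 1 A # A # \<Gamma>) C;
    A # \<Gamma> \<turnstile> c \<Colon> subst (scons (Refl (Var 0)) (scons (Var 0) Var)) C;
    \<Gamma> \<turnstile> a \<Colon> A; \<Gamma> \<turnstile> b \<Colon> A; \<Gamma> \<turnstile> p \<Colon> Eq A a b; inst3 a b p C = C'\<rbrakk> \<Longrightarrow> \<Gamma> \<turnstile> IndEq C c a b p \<Colon> C'"
  unfolding isty_def scons_def by (blast intro: eq_elim)

lemma inh_J:
  "\<lbrakk>isty (Eq (lift 2 A) (Var 1) (Var 0) # lift 1 A # A # \<Gamma>) C;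
    inh (A # \<Gamma>) (subst (scons (Refl (Var 0)) (scons (Var 0) Var)) C);
    \<Gamma> \<turnstile> a \<Colon> A; \<Gamma> \<turnstile> b \<Colon> A; \<Gamma> \<turnstile> p \<Colon> Eq A a b; inst3 a b p C = C'\<rbrakk> \<Longrightarrow> inh \<Gamma> C'"
  unfolding inh_def isty_def scons_def by (blast intro: eq_elim)

text \<open>Path induction into the type of functions from the fibre over x to the fibre over y, so
  that transport is ordinary application. The shift by 3 skips the two end points and the path of
  the motive.\<close>

definition transp :: "tm \<Rightarrow> tm \<Rightarrow> tm \<Rightarrow> tm \<Rightarrow> tm \<Rightarrow> tm" where
  "transp A B a b p = IndEq
     (Arr (subst (scons (Var 2) (\<lambda>n. Var (n + 3))) B) (subst (scons (Var 1) (\<lambda>n. Var (n + 3))) B))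
     (Lam B (Var 0)) a b p"

lemma subst_transp [simp]:
  "subst \<sigma> (transp A B a b p) =
     transp (subst \<sigma> A) (subst (up \<sigma>) B) (subst \<sigma> a) (subst \<sigma> b) (subst \<sigma> p)"
  by (simp add: transp_def sub Arr_def)

lemma transp_motive:
  assumes A: "isty \<Gamma> A" and B: "isty (A # \<Gamma>) B"
  shows "isty (Eq (lift 2 A) (Var 1) (Var 0) # lift 1 A # A # \<Gamma>)
    (Arr (subst (scons (Var 2) (\<lambda>n. Var (n + 3))) B) (subst (scons (Var 1) (\<lambda>n. Var (n + 3))) B))"
  using assms isty_ctx [OF A]
  by (auto simp: sub Arr_def intro!: subst_isty [OF B] subst_isty [OF A])

lemma transp_base:
  assumes A: "isty \<Gamma> A" and B: "isty (A # \<Gamma>) B"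
  shows "A # \<Gamma> \<turnstile> Lam B (Var 0) \<Colon> subst (case_nat (Refl (Var 0)) (case_nat (Var 0) Var))
    (Arr (subst (scons (Var 2) (\<lambda>n. Var (n + 3))) B) (subst (scons (Var 1) (\<lambda>n. Var (n + 3))) B))"
  using assms isty_ctx [OF A] by (auto simp: sub Arr_def intro!: lam_type)

lemma transp_type:
  assumes A: "isty \<Gamma> A" and B: "isty (A # \<Gamma>) B"
    and "\<Gamma> \<turnstile> a \<Colon> A" "\<Gamma> \<turnstile> b \<Colon> A" "\<Gamma> \<turnstile> p \<Colon> Eq A a b" "\<Gamma> \<turnstile> u \<Colon> inst1 a B" "inst1 b B = C"
  shows "\<Gamma> \<turnstile> App (transp A B a b p) u \<Colon> C"
proof -
  obtain i where "Eq (lift 2 A) (Var 1) (Var 0) # lift 1 A # A # \<Gamma> \<turnstile> Arr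
    (subst (scons (Var 2) (\<lambda>n. Var (n + 3))) B) (subst (scons (Var 1) (\<lambda>n. Var (n + 3))) B) \<Colon> U i"
    using transp_motive[OF A B] unfolding isty_def by blast
  from eq_elim[OF this transp_base[OF A B] assms(3-5)]
  show ?thesis using assms(6,7) unfolding transp_def by (auto simp: sub Arr_def intro!: app_type)
qed

lemma transp_refl:
  assumes A: "isty \<Gamma> A" and B: "isty (A # \<Gamma>) B" and a: "\<Gamma> \<turnstile> a \<Colon> A" and u: "\<Gamma> \<turnstile> u \<Colon> inst1 a B"
    and B': "inst1 a B = B'"
  shows "\<Gamma> \<turnstile> App (transp A B a a (Refl a)) u \<doteq> u \<Colon> B'"
proof -
  obtain i where "Eq (lift 2 A) (Var 1) (Var 0) # lift 1 A # A # \<Gamma> \<turnstile> Arr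
    (subst (scons (Var 2) (\<lambda>n. Var (n + 3))) B) (subst (scons (Var 1) (\<lambda>n. Var (n + 3))) B) \<Colon> U i"
    using transp_motive[OF A B] unfolding isty_def by blast
  from eq_comp[OF this transp_base[OF A B] a]
  have "\<Gamma> \<turnstile> transp A B a a (Refl a) \<doteq> Lam (inst1 a B) (Var 0) \<Colon> Pi (inst1 a B) (lift 1 (inst1 a B))"
    unfolding transp_def by (simp add: sub Arr_def)
  from pi_elim_cong[OF this jeq_refl[OF u]]
  have 1: "\<Gamma> \<turnstile> App (transp A B a a (Refl a)) u \<doteq> App (Lam (inst1 a B) (Var 0)) u \<Colon> inst1 a B"
    by (simp add: sub)
  have "inst1 a B # \<Gamma> \<turnstile> Var 0 \<Colon> lift 1 (inst1 a B)"
    using a isty_ctx[OF A] by (auto simp: sub intro!: subst_isty[OF B])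
  from pi_comp[OF this u] have "\<Gamma> \<turnstile> App (Lam (inst1 a B) (Var 0)) u \<doteq> u \<Colon> inst1 a B"
    by (simp add: sub)
  from jeq_trans[OF 1 this] show ?thesis by (simp add: B')
qed

lemma inh_transport:
  "\<lbrakk>isty \<Gamma> A; isty (A # \<Gamma>) B; \<Gamma> \<turnstile> a \<Colon> A; \<Gamma> \<turnstile> b \<Colon> A; inh \<Gamma> (Eq A a b); inh \<Gamma> (inst1 a B); inst1 b B =
      C\<rbrakk>
   \<Longrightarrow> inh \<Gamma> C"
  unfolding inh_def by (blast intro: transp_type)

text \<open>Reflexivity at \<open>a\<close>, retyped by the congruence of identity types; this makes
  computation rules available as paths.\<close>

lemma inh_Eq_conv:
  assumes "isty \<Gamma> A" "\<Gamma> \<turnstile> a \<Colon> A" "\<Gamma> \<turnstile> a \<doteq> b \<Colon> A"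
  shows "inh \<Gamma> (Eq A a b)"
proof -
  obtain i where "\<Gamma> \<turnstile> A \<Colon> U i" using assms by (auto simp: isty_def)
  from eq_form_cong[OF jeq_refl[OF this] jeq_refl[OF assms(2)] assms(3)]
  show ?thesis using inh_conv[OF inh_refl[OF assms(1,2)]] by blast
qed

text \<open>
  Replaces congruence derivations: a judgemental equality acts on types by transport along reflexivity.
\<close>

lemma inh_jeq:
  "\<lbrakk>\<Gamma> \<turnstile> a \<doteq> b \<Colon> A; isty \<Gamma> A; \<Gamma> \<turnstile> a \<Colon> A; \<Gamma> \<turnstile> b \<Colon> A; isty (A # \<Gamma>) C; inh \<Gamma> (inst1 a C); inst1 b C =
      C'\<rbrakk>
   \<Longrightarrow> inh \<Gamma> C'"
  by (rule inh_transport[where a = a and b = b and B = C]) (auto intro: inh_Eq_conv)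

lemma inh_sym:
  assumes "isty \<Gamma> A" "\<Gamma> \<turnstile> a \<Colon> A" "\<Gamma> \<turnstile> b \<Colon> A" "inh \<Gamma> (Eq A a b)"
  shows "inh \<Gamma> (Eq A b a)"
  by (rule inh_transport[where a = a and b = b and A = A
      and B = "Eq (lift 1 A) (Var 0) (lift 1 a)"])
    (use assms isty_ctx[OF assms(1)] in \<open>auto simp: sub intro!: inh_refl subst_isty[OF assms(1)]
        subst_type[OF assms(2)]\<close>)

lemma inh_trans:
  assumes "isty \<Gamma> A" "\<Gamma> \<turnstile> a \<Colon> A" "\<Gamma> \<turnstile> b \<Colon> A" "\<Gamma> \<turnstile> c \<Colon> A" "inh \<Gamma> (Eq A a b)" "inh \<Gamma> (Eq A b c)"
  shows "inh \<Gamma> (Eq A a c)"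
  by (rule inh_transport[where a = b and b = c and A = A
      and B = "Eq (lift 1 A) (lift 1 a) (Var 0)"])
    (use assms isty_ctx[OF assms(1)] in \<open>auto simp: sub intro!: inh_refl subst_isty[OF assms(1)]
        subst_type[OF assms(2)]\<close>)

section \<open>Propositions and sets\<close>

definition is_prop :: "tm \<Rightarrow> tm" where
  "is_prop A = Pi A (Pi (lift 1 A) (Eq (lift 2 A) (Var 1) (Var 0)))"

lemma subst_is_prop [simp]: "subst \<sigma> (is_prop A) = is_prop (subst \<sigma> A)"
  by (simp add: is_prop_def del: One_nat_def)

lemma isty_is_prop [intro!]:
  assumes A: "isty \<Gamma> A"
  shows "isty \<Gamma> (is_prop A)"
  unfolding is_prop_def using assms isty_ctx[OF A] by (auto simp: sub intro!: subst_isty[OF A])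

lemma is_prop_app:
  assumes P: "inh \<Gamma> (is_prop A)" and a: "\<Gamma> \<turnstile> a \<Colon> A" and b: "\<Gamma> \<turnstile> b \<Colon> A"
  shows "inh \<Gamma> (Eq A a b)"
proof -
  have "inh \<Gamma> (Pi A (Eq (lift 1 A) (lift 1 a) (Var 0)))"
    by (rule inh_app[OF P[unfolded is_prop_def] a]) (simp add: sub)
  then show ?thesis by (rule inh_app[OF _ b]) (simp add: sub)
qed

lemma is_propI: "\<lbrakk>isty \<Gamma> A; inh (lift 1 A # A # \<Gamma>) (Eq (lift 2 A) (Var 1) (Var 0))\<rbrakk> \<Longrightarrow> inh \<Gamma> (is_prop
    A)"
  unfolding is_prop_def by (intro inh_Pi) (auto simp: sub isty_ctx intro!: subst_isty)

section \<open>Projections of dependent sums\<close>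

definition pr1 :: "tm \<Rightarrow> tm \<Rightarrow> tm" where
  "pr1 A s = IndSig (lift 1 A) (Var 1) s"

lemma subst_pr1 [simp]: "subst \<sigma> (pr1 A s) = pr1 (subst \<sigma> A) (subst \<sigma> s)"
  by (simp add: pr1_def sub)

lemma pr1_type:
  assumes s: "\<Gamma> \<turnstile> s \<Colon> Sig A B" and A: "isty \<Gamma> A" and B: "isty (A # \<Gamma>) B"
  shows "\<Gamma> \<turnstile> pr1 A s \<Colon> A"
proof -
  have "isty (Sig A B # \<Gamma>) (lift 1 A)"
    using A B isty_ctx[OF A] by (auto simp: sub intro!: subst_isty[OF A])
  then obtain i where i: "Sig A B # \<Gamma> \<turnstile> lift 1 A \<Colon> U i" by (auto simp: isty_def)
  have "B # A # \<Gamma> \<turnstile> Var 1 \<Colon> repl 2 (Tuple (Var 1) (Var 0)) (lift 1 A)"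
    using A B isty_ctx[OF A] by (auto simp: sub)
  from sig_elim[OF i this s] show ?thesis by (simp add: pr1_def sub)
qed

lemma pr1_pair:
  assumes A: "isty \<Gamma> A" and B: "isty (A # \<Gamma>) B" and a: "\<Gamma> \<turnstile> a \<Colon> A" and b: "\<Gamma> \<turnstile> b \<Colon> inst1 a B"
  shows "\<Gamma> \<turnstile> pr1 A (Tuple a b) \<doteq> a \<Colon> A"
proof -
  have "isty (Sig A B # \<Gamma>) (lift 1 A)"
    using A B isty_ctx[OF A] by (auto simp: sub intro!: subst_isty[OF A])
  then obtain i where i: "Sig A B # \<Gamma> \<turnstile> lift 1 A \<Colon> U i" by (auto simp: isty_def)
  have "B # A # \<Gamma> \<turnstile> Var 1 \<Colon> repl 2 (Tuple (Var 1) (Var 0)) (lift 1 A)"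
    using A B isty_ctx[OF A] by (auto simp: sub)
  from sig_comp[OF i this a b] show ?thesis by (simp add: pr1_def sub)
qed

lemma inh_pr1: "\<lbrakk>inh \<Gamma> (Sig A B); isty \<Gamma> A; isty (A # \<Gamma>) B\<rbrakk> \<Longrightarrow> inh \<Gamma> A"
  by (auto simp: inh_def intro: pr1_type)

text \<open>Induction on \<open>s\<close> with motive \<open>B\<close> at the first projection. On a
  pair (x, y) the component y lives over x, which is judgementally the first projection of the pair.
  Only the existence of a second component is recorded.\<close>

lemma inh_pr2:
  assumes A: "isty \<Gamma> A" and B: "isty (A # \<Gamma>) B" and s: "\<Gamma> \<turnstile> s \<Colon> Sig A B"
    and C: "inst1 (pr1 A s) B = C"
  shows "inh \<Gamma> C"
proof -
  let ?C = "subst (scons (pr1 (lift 1 A) (Var 0)) (\<lambda>n. Var (Suc n))) B"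
  have "inh (B # A # \<Gamma>) (repl 2 (Tuple (Var 1) (Var 0)) ?C)"
  proof (rule inh_jeq[OF jeq_sym, OF pr1_pair])
    show "isty (lift 2 A # B # A # \<Gamma>) (subst (scons (Var 0) (\<lambda>n. Var (n + 3))) B)"
      using A B isty_ctx[OF A] by (auto simp: sub intro!: subst_isty[OF A] subst_isty[OF B])
    show "isty (B # A # \<Gamma>) (lift 2 A)"
      using A B isty_ctx[OF A] by (auto simp: sub intro!: subst_isty[OF A] subst_isty[OF B])
    then show "isty (B # A # \<Gamma>) (lift 2 A)" .
    show "isty (lift 2 A # B # A # \<Gamma>) (subst (scons (Var 0) (\<lambda>n. Var (n + 3))) B)"
      using A B isty_ctx[OF A] by (auto simp: sub intro!: subst_isty[OF A] subst_isty[OF B])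
    show "B # A # \<Gamma> \<turnstile> Var 1 \<Colon> lift 2 A" "B # A # \<Gamma> \<turnstile> Var 1 \<Colon> lift 2 A"
      "B # A # \<Gamma> \<turnstile> Var 0 \<Colon> inst1 (Var 1) (subst (scons (Var 0) (\<lambda>n. Var (n + 3))) B)"
      using A B isty_ctx[OF A] by (auto simp: sub)
    show "B # A # \<Gamma> \<turnstile> pr1 (lift 2 A) (Tuple (Var 1) (Var 0)) \<Colon> lift 2 A"
      by (rule pr1_type[where B = "subst (scons (Var 0) (\<lambda>n. Var (n + 3))) B"])
        (use A B isty_ctx[OF A] in \<open>auto simp: sub intro!: pair_type subst_isty[OF A] subst_isty[OF
            B]\<close>)
    show "inh (B # A # \<Gamma>) (inst1 (Var 1) (subst (scons (Var 0) (\<lambda>n. Var (n + 3))) B))"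
      by (rule inhI[of _ "Var 0"]) (use A B isty_ctx[OF A] in \<open>auto simp: sub\<close>)
  qed (simp add: sub)
  moreover have "Sig A B # \<Gamma> \<turnstile> pr1 (lift 1 A) (Var 0) \<Colon> lift 1 A"
    by (rule pr1_type[where B = "subst (scons (Var 0) (\<lambda>n. Var (n + 2))) B"])
      (use A B isty_ctx[OF A] in \<open>auto simp: sub intro!: subst_isty[OF A] subst_isty[OF B]\<close>)
  ultimately show ?thesis
    by (intro inh_Sig_ind[where C = ?C and C' = C, OF _ _ s])
     (use A B isty_ctx[OF A] C in \<open>auto simp: sub intro!: subst_isty[OF A] subst_isty[OF B]\<close>)
qed

text \<open>
  The transport along \<open>u\<close> in the family \<open>z = x'\<close> is \<open>v \<mapsto> u\<^sup>-\<^sup>1 \<cdot> v\<close>.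
\<close>

lemma inv_concat_self:
  assumes X: "isty \<Gamma> X" and x: "\<Gamma> \<turnstile> x \<Colon> X" and x': "\<Gamma> \<turnstile> x' \<Colon> X" and u: "\<Gamma> \<turnstile> u \<Colon> Eq X x x'"
  shows "inh \<Gamma> (Eq (Eq X x' x') (App (transp X (Eq (lift 1 X) (Var 0) (lift 1 x')) x x' u) u) (Refl
      x'))"
proof (rule inh_J[OF _ _ x x' u])
  let ?C = "Eq (Eq (lift 3 X) (Var 1) (Var 1))
    (App (transp (lift 3 X) (Eq (lift 4 X) (Var 0) (Var 2)) (Var 2) (Var 1) (Var 0)) (Var 0)) (Refl
        (Var 1))"
  note [intro!] = transp_type subst_isty[OF X] refl_type
  show "isty (Eq (lift 2 X) (Var 1) (Var 0) # lift 1 X # X # \<Gamma>) ?C"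
    using X isty_ctx[OF X] by (auto simp: sub)
  \<comment> \<open>On the diagonal this is transport of reflexivity along reflexivity, which
    computes.\<close>
  have "inh (X # \<Gamma>) (Eq (Eq (lift 1 X) (Var 0) (Var 0))
    (App (transp (lift 1 X) (Eq (lift 2 X) (Var 0) (Var 1)) (Var 0) (Var 0) (Refl (Var 0))) (Refl
        (Var 0))) (Refl (Var 0)))"
    by (rule inh_Eq_conv) (use X isty_ctx[OF X] in \<open>auto simp: sub intro!: transp_refl\<close>)
  then show "inh (X # \<Gamma>) (subst (scons (Refl (Var 0)) (scons (Var 0) Var)) ?C)"
    by (simp add: sub)
qed (simp add: sub)

text \<open>
  Write \<open>c p\<close> for the path obtained from \<open>p\<close> by passing through the relation \<open>R\<close>.  By path induction
  \<open>p = (c refl)\<^sup>-\<^sup>1 \<cdot> c p\<close>, and \<open>c p\<close> does not depend on \<open>p\<close> since \<open>R\<close> is a proposition.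
\<close>

lemma set_from_relation:
  assumes X: "isty \<Gamma> X" and R: "isty (lift 1 X # X # \<Gamma>) R"
    and H: "inh (Eq (lift 2 X) (Var 1) (Var 0) # lift 1 X # X # \<Gamma>) (lift 1 R)"
    and F: "inh (R # lift 1 X # X # \<Gamma>) (Eq (lift 3 X) (Var 2) (Var 1))"
    and P: "inh (lift 1 X # X # \<Gamma>) (is_prop R)"
    and x: "\<Gamma> \<turnstile> x \<Colon> X" and y: "\<Gamma> \<turnstile> y \<Colon> X" and p: "\<Gamma> \<turnstile> p \<Colon> Eq X x y" and q: "\<Gamma> \<turnstile> q \<Colon> Eq X x y"
  shows "inh \<Gamma> (Eq (Eq X x y) p q)"
proof -
  obtain h where h: "Eq (lift 2 X) (Var 1) (Var 0) # lift 1 X # X # \<Gamma> \<turnstile> h \<Colon> lift 1 R"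
    using H by (rule inhE)
  obtain f where f: "R # lift 1 X # X # \<Gamma> \<turnstile> f \<Colon> Eq (lift 3 X) (Var 2) (Var 1)"
    using F by (rule inhE)
  note ctx = isty_ctx[OF X]
  note [intro!] = transp_type subst_isty[OF X] subst_isty[OF R] refl_type subst_type[OF f]
      subst_type[OF h]
    subst_type[OF x] subst_type[OF y] subst_type[OF p] subst_type[OF q] x y p q
  \<comment> \<open>\<open>h\<close> and \<open>f\<close> are open terms; \<open>h'\<close> and
    \<open>c\<close> are their instances at a path \<open>p\<close> from \<open>x\<close> to
    \<open>y\<close>. The path yields a point of \<open>R\<close>, and that point yields a path
    again.\<close>
  define h' where "h' x y p = subst (scons p (scons y (scons x Var))) h" for x y p
  define c where "c x y p = subst (scons (h' x y p) (scons y (scons x Var))) f" for x y p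
  have claim: "inh \<Gamma> (Eq (Eq X x y)
      (App (transp X (Eq (lift 1 X) (Var 0) (lift 1 y)) x x (c x x (Refl x))) (c x y p)) p)"
    if p: "\<Gamma> \<turnstile> p \<Colon> Eq X x y" for p
  proof (rule inh_J[OF _ _ x y p])
    let ?h = "\<lambda>x y p. subst (scons p (scons y (scons x (\<lambda>n. Var (n + 3))))) h"
    let ?c = "\<lambda>x y p. subst (scons (?h x y p) (scons y (scons x (\<lambda>n. Var (n + 3))))) f"
    let ?C = "Eq (Eq (lift 3 X) (Var 2) (Var 1))
      (App (transp (lift 3 X) (Eq (lift 4 X) (Var 0) (Var 2)) (Var 2) (Var 2) (?c (Var 2) (Var 2)
          (Refl (Var 2))))
        (?c (Var 2) (Var 1) (Var 0))) (Var 0)"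
    show "isty (Eq (lift 2 X) (Var 1) (Var 0) # lift 1 X # X # \<Gamma>) ?C"
      using X ctx R h f by (auto simp: sub)
    \<comment> \<open>\<open>?c1\<close> is \<open>c\<close> at reflexivity; on the diagonal both
      paths in the claim are \<open>?c1\<close>, so they cancel by
      \<open>inv_concat_self\<close>.\<close>
    let ?c1 = "subst (scons (subst (scons (Refl (Var 0)) (scons (Var 0) (scons (Var 0) (\<lambda>n. Var (n +
        1))))) h)
       (scons (Var 0) (scons (Var 0) (\<lambda>n. Var (n + 1))))) f"
    have "X # \<Gamma> \<turnstile> ?c1 \<Colon> Eq (lift 1 X) (Var 0) (Var 0)"
      using X ctx R by (auto simp: sub)
    moreover have "isty (X # \<Gamma>) (lift 1 X)" "X # \<Gamma> \<turnstile> Var 0 \<Colon> lift 1 X"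
      using X ctx by (auto simp: sub)
    ultimately have "inh (X # \<Gamma>) (Eq (Eq (lift 1 X) (Var 0) (Var 0))
      (App (transp (lift 1 X) (Eq (lift 1 (lift 1 X)) (Var 0) (lift 1 (Var 0))) (Var 0) (Var 0) ?c1)
          ?c1) (Refl (Var 0)))"
      by (blast intro: inv_concat_self)
    then show "inh (X # \<Gamma>) (subst (scons (Refl (Var 0)) (scons (Var 0) Var)) ?C)"
      by (simp add: sub)
  qed (simp add: sub h'_def c_def)
  have "inh \<Gamma> (Eq (subst (scons y (scons x Var)) R) (h' x y q) (h' x y p))"
  proof (rule is_prop_app)
    show "inh \<Gamma> (is_prop (subst (scons y (scons x Var)) R))"
      by (rule subst_inh[OF P]) (use ctx in \<open>auto simp: sub\<close>)
  qed (use ctx X R in \<open>auto simp: sub h'_def\<close>)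
  \<comment> \<open>The claim for \<open>q\<close>, with the point \<open>h' x y q\<close> of the
    proposition replaced by \<open>h' x y p\<close>. Thus the left side of the claim for
    \<open>p\<close> also equals \<open>q\<close>.\<close>
  then have "inh \<Gamma> (Eq (Eq X x y) (App (transp X (Eq (lift 1 X) (Var 0) (lift 1 y)) x x (c x x (Refl
      x))) (c x y p)) q)"
  proof (rule inh_transport[rotated 4])
    let ?B = "Eq (Eq (lift 1 X) (lift 1 x) (lift 1 y)) (App (transp (lift 1 X) (Eq (lift 2 X) (Var
        0) (lift 2 y))
      (lift 1 x) (lift 1 x) (lift 1 (c x x (Refl x))))
      (subst (scons (Var 0) (scons (lift 1 y) (scons (lift 1 x) (\<lambda>n. Var (n + 1))))) f)) (lift 1 q)"
    show "inh \<Gamma> (inst1 (h' x y q) ?B)"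
      using claim[OF q] by (simp add: sub c_def)
    show "isty (subst (scons y (scons x Var)) R # \<Gamma>) ?B"
      using X ctx R by (auto simp: sub c_def h'_def)
  qed (use ctx X R in \<open>auto simp: sub h'_def c_def\<close>)
  moreover have D: "\<Gamma> \<turnstile> App (transp X (Eq (lift 1 X) (Var 0) (lift 1 y)) x x (c x x (Refl x))) (c x
      y p) \<Colon> Eq X x y"
    using X ctx R by (auto simp: sub c_def h'_def)
  moreover have E: "isty \<Gamma> (Eq X x y)" using X by auto
  ultimately show ?thesis using inh_trans[OF E p D q inh_sym[OF E D p claim[OF p]]] by blast
qed

text \<open>The centres of the contractible identity types are the required paths.\<close>

lemma trunc1_is_prop:
  assumes A: "isty \<Gamma> A" and T: "inh \<Gamma> (is_trunc 1 A)"
  shows "inh \<Gamma> (is_prop A)"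
proof -
  note [intro!] = subst_isty[OF A]
  note ctx = isty_ctx[OF A]
  have "inh \<Gamma> (Pi A (Pi (lift 1 A) (is_trunc 0 (Eq (lift 2 A) (Var 1) (Var 0)))))"
    using T by simp
  then have "inh (lift 1 A # A # \<Gamma>) (is_trunc 0 (Eq (lift 2 A) (Var 1) (Var 0)))"
    using A ctx by (subst (asm) inh_lam_iff, simp, subst (asm) inh_lam_iff) (auto simp: sub)
  then have "inh (lift 1 A # A # \<Gamma>) (Eq (lift 2 A) (Var 1) (Var 0))"
    unfolding is_trunc.simps by (rule inh_pr1) (use A ctx in \<open>auto simp: sub\<close>)
  then show ?thesis by (rule is_propI[OF A])
qed

text \<open>A proposition is a set: on it even a constantly true relation implies equality, so
  \<open>set_from_relation\<close> applies.\<close>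

lemma is_prop_eq:
  assumes A: "isty \<Gamma> A" and P: "inh \<Gamma> (is_prop A)" and a: "\<Gamma> \<turnstile> a \<Colon> A" and b: "\<Gamma> \<turnstile> b \<Colon> A"
    and p: "\<Gamma> \<turnstile> p \<Colon> Eq A a b" and q: "\<Gamma> \<turnstile> q \<Colon> Eq A a b"
  shows "inh \<Gamma> (Eq (Eq A a b) p q)"
proof (rule set_from_relation[OF A _ _ _ _ a b p q])
  note [intro!] = subst_isty[OF A]
  note ctx = isty_ctx[OF A]
  \<comment> \<open>Truncating \<open>Unit\<close> makes the true relation a proposition directly by
    \<open>TruncIsTrunc\<close>.\<close>
  let ?R = "Trunc 1 Unit"
  show "isty (lift 1 A # A # \<Gamma>) ?R"
    using A ctx by (auto simp: sub)
  have "Eq (lift 2 A) (Var 1) (Var 0) # lift 1 A # A # \<Gamma> \<turnstile> Tr 1 Star \<Colon> lift 1 ?R"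
    using A ctx by (auto simp: sub intro!: trunc_intro unit_intro unit_form)
  then show "inh (Eq (lift 2 A) (Var 1) (Var 0) # lift 1 A # A # \<Gamma>) (lift 1 ?R)"
    by (rule inhI)
  have "ctx (?R # lift 1 A # A # \<Gamma>)"
    using A ctx by (auto simp: sub)
  then have "inh (?R # lift 1 A # A # \<Gamma>) (is_prop (lift 3 A))"
    by (intro subst_inh[OF P, of "\<lambda>n. Var (n + 3)"]) (auto simp: sub)
  then show "inh (?R # lift 1 A # A # \<Gamma>) (Eq (lift 3 A) (Var 2) (Var 1))"
    by (rule is_prop_app) (use A ctx in \<open>auto simp: sub\<close>)
  have "lift 1 A # A # \<Gamma> \<turnstile> TruncIsTrunc 1 Unit \<Colon> is_trunc 1 ?R"
    by (intro trunc_is_trunc unit_form) (use A ctx in \<open>auto simp: sub\<close>)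
  then show "inh (lift 1 A # A # \<Gamma>) (is_prop ?R)"
    by (intro trunc1_is_prop inhI) (use A ctx in \<open>auto simp: sub\<close>)
qed

lemma is_prop_Eq:
  assumes A: "isty \<Gamma> A" and P: "inh \<Gamma> (is_prop A)" and a: "\<Gamma> \<turnstile> a \<Colon> A" and b: "\<Gamma> \<turnstile> b \<Colon> A"
  shows "inh \<Gamma> (is_prop (Eq A a b))"
proof -
  note [intro!] = subst_isty[OF A] subst_type[OF a] subst_type[OF b]
  note ctx = isty_ctx[OF A]
  let ?E = "Eq A a b"
  have E: "isty \<Gamma> ?E" "isty (?E # \<Gamma>) (lift 1 ?E)"
    using A a b ctx by (auto simp: sub)
  then have "inh (lift 1 ?E # ?E # \<Gamma>) (is_prop (lift 2 A))"
    by (intro subst_inh[OF P, of "\<lambda>n. Var (n + 2)"]) (auto simp: sub)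
  moreover have "isty (lift 1 ?E # ?E # \<Gamma>) (lift 2 A)" "lift 1 ?E # ?E # \<Gamma> \<turnstile> lift 2 a \<Colon> lift 2 A"
    "lift 1 ?E # ?E # \<Gamma> \<turnstile> lift 2 b \<Colon> lift 2 A"
    "lift 1 ?E # ?E # \<Gamma> \<turnstile> Var 1 \<Colon> Eq (lift 2 A) (lift 2 a) (lift 2 b)"
    "lift 1 ?E # ?E # \<Gamma> \<turnstile> Var 0 \<Colon> Eq (lift 2 A) (lift 2 a) (lift 2 b)"
    using E ctx by (auto simp: sub)
  ultimately have "inh (lift 1 ?E # ?E # \<Gamma>) (Eq (Eq (lift 2 A) (lift 2 a) (lift 2 b)) (Var 1) (Var
      0))"
    by (intro is_prop_eq)
  then show ?thesis by (intro is_propI E) (simp add: sub)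
qed

text \<open>The first of two points to be compared already witnesses that the type is inhabited.
  This lets \<open>is_prop_is_prop\<close> and \<open>is_prop_is_contr\<close> assume the very
  property whose uniqueness is at stake.\<close>

lemma is_prop_assume:
  assumes A: "isty \<Gamma> A" and P: "inh (A # \<Gamma>) (is_prop (lift 1 A))"
  shows "inh \<Gamma> (is_prop A)"
proof (rule is_propI[OF A])
  note [intro!] = subst_isty[OF A]
  note ctx = isty_ctx[OF A]
  have "inh (lift 1 A # A # \<Gamma>) (is_prop (lift 2 A))"
    by (rule subst_inh[OF P, of "\<lambda>n. Var (n + 1)"]) (use A ctx in \<open>auto simp: sub\<close>)
  then show "inh (lift 1 A # A # \<Gamma>) (Eq (lift 2 A) (Var 1) (Var 0))"
    by (rule is_prop_app) (use A ctx in \<open>auto simp: sub\<close>)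
qed

text \<open>The second component \<open>v\<close> is generalised before transporting along
  \<open>e\<close>, so no path over \<open>e\<close> has to be formed. Over \<open>a\<close> itself
  the claim compares \<open>u\<close> with another point of the same propositional fibre.\<close>

lemma sig_path:
  assumes A: "isty \<Gamma> A" and B: "isty (A # \<Gamma>) B" and P: "inh (A # \<Gamma>) (is_prop B)"
    and a: "\<Gamma> \<turnstile> a \<Colon> A" and a': "\<Gamma> \<turnstile> a' \<Colon> A" and e: "inh \<Gamma> (Eq A a a')"
    and u: "\<Gamma> \<turnstile> u \<Colon> inst1 a B" and v: "\<Gamma> \<turnstile> v \<Colon> inst1 a' B"
  shows "inh \<Gamma> (Eq (Sig A B) (Tuple a u) (Tuple a' v))"
proof -
  note [intro!] = subst_isty[OF A] subst_isty[OF B] subst_type[OF a] subst_type[OF a'] subst_type[OF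
      u]
    subst_type[OF v] a u a' v pair_type
  note ctx = isty_ctx[OF A]
  let ?Ba = "inst1 a B"
  have Ba: "isty \<Gamma> ?Ba" using A B ctx by (auto simp: sub)
  let ?C = "Pi B (Eq (lift 2 (Sig A B)) (lift 2 (Tuple a u)) (Tuple (Var 1) (Var 0)))"
  have "inh (?Ba # \<Gamma>) (is_prop (lift 1 ?Ba))"
    by (rule subst_inh[OF P, of "scons (lift 1 a) (\<lambda>n. Var (n + 1))"]) (use Ba ctx
        in \<open>auto simp: sub\<close>)
  then have "inh (?Ba # \<Gamma>) (Eq (lift 1 ?Ba) (lift 1 u) (Var 0))"
    by (rule is_prop_app) (use Ba ctx in \<open>auto simp: sub\<close>)
  then have "inh (?Ba # \<Gamma>) (Eq (lift 1 (Sig A B)) (lift 1 (Tuple a u)) (Tuple (lift 1 a) (Var 0)))"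
    by (rule inh_transport[rotated 4, where
        B = "Eq (lift 2 (Sig A B)) (lift 2 (Tuple a u)) (Tuple (lift 2 a) (Var 0))"])
      (use A B Ba ctx in \<open>auto simp: sub intro!: inh_refl\<close>)
  then have "inh \<Gamma> (inst1 a ?C)"
    using Ba by (auto simp: sub intro!: inh_Pi)
  then have "inh \<Gamma> (inst1 a' ?C)"
    by (rule inh_transport[OF A _ a a' e, of ?C, rotated]) (use A B ctx in \<open>auto simp: sub\<close>)
  then have "inh \<Gamma> (Pi (inst1 a' B) (Eq (lift 1 (Sig A B)) (lift 1 (Tuple a u)) (Tuple (lift 1 a')
      (Var 0))))"
    by (simp add: sub)
  then show ?thesis
    by (rule inh_app[OF _ v]) (simp add: sub)
qed

text \<open>Sigma induction on both points leaves two pairs, which \<open>sig_path\<close>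
  compares.\<close>

lemma sig_is_prop:
  assumes A: "isty \<Gamma> A" and B: "isty (A # \<Gamma>) B" and PA: "inh \<Gamma> (is_prop A)"
      and P: "inh (A # \<Gamma>) (is_prop B)"
    and s: "\<Gamma> \<turnstile> s \<Colon> Sig A B" and t: "\<Gamma> \<turnstile> t \<Colon> Sig A B"
  shows "inh \<Gamma> (Eq (Sig A B) s t)"
proof -
  note [intro!] = subst_isty[OF A] subst_isty[OF B] pair_type subst_type[OF t] subst_type[OF s]
  note ctx = isty_ctx[OF A]
  let ?S = "Sig A B"
  let ?B = "\<lambda>k. subst (scons (Var 0) (\<lambda>n. Var (n + k))) B"
  let ?G = "?B 3 # lift 2 A # B # A # \<Gamma>"
  have c: "ctx ?G" using A B ctx by (auto simp: sub)
  have AB: "isty ?G (lift 4 A)" "isty (lift 4 A # ?G) (?B 5)"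
    using c A B ctx by (auto simp: sub)
  have "inh ?G (Eq (Sig (lift 4 A) (?B 5)) (Tuple (Var 3) (Var 2)) (Tuple (Var 1) (Var 0)))"
  proof (rule sig_path[OF AB])
    show "inh (lift 4 A # ?G) (is_prop (?B 5))"
      by (rule subst_inh[OF P, of "scons (Var 0) (\<lambda>n. Var (n + 5))"])
        (use AB in \<open>auto simp: sub\<close>)
    have "inh ?G (is_prop (lift 4 A))"
      by (rule subst_inh[OF PA, of "(\<lambda>n. Var (n + 4))"]) (use c in \<open>auto simp: sub\<close>)
    then show "inh ?G (Eq (lift 4 A) (Var 3) (Var 1))"
      by (rule is_prop_app) (use c in \<open>auto simp: sub\<close>)
  qed (use c in \<open>auto simp: sub\<close>)
  note 1 = this
  have 2: "inh (B # A # \<Gamma>) (Eq (lift 2 ?S) (Tuple (Var 1) (Var 0)) (lift 2 t))"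
    by (rule inh_Sig_ind[where A = "lift 2 A" and B = "?B 3" and p = "lift 2 t" and
        C = "Eq (lift 3 ?S) (Tuple (Var 2) (Var 1)) (Var 0)"])
      (use 1 A B ctx in \<open>auto simp: sub\<close>)
  show ?thesis
    by (rule inh_Sig_ind[OF _ _ s, of "Eq (lift 1 ?S) (Var 0) (lift 1 t)"])
      (use 2 A B ctx in \<open>auto simp: sub\<close>)
qed

lemma is_prop_Sig:
  assumes A: "isty \<Gamma> A" and B: "isty (A # \<Gamma>) B" and PA: "inh \<Gamma> (is_prop A)"
      and P: "inh (A # \<Gamma>) (is_prop B)"
  shows "inh \<Gamma> (is_prop (Sig A B))"
proof (rule is_propI)
  note [intro!] = subst_isty[OF A] subst_isty[OF B]
  note ctx = isty_ctx[OF A]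
  let ?S = "Sig A B"
  let ?G = "lift 1 ?S # ?S # \<Gamma>"
  show S: "isty \<Gamma> ?S" using A B by auto
  have c: "isty ?G (lift 2 A)" "isty (lift 2 A # ?G) (subst (scons (Var 0) (\<lambda>n. Var (n + 3))) B)"
    using S ctx by (auto simp: sub)
  have "inh ?G (is_prop (lift 2 A))"
    by (rule subst_inh[OF PA, of "\<lambda>n. Var (n + 2)"]) (use c isty_ctx[OF c(1)] in \<open>auto simp: sub\<close>)
  moreover have "inh (lift 2 A # ?G) (is_prop (subst (scons (Var 0) (\<lambda>n. Var (n + 3))) B))"
    by (rule subst_inh[OF P, of "scons (Var 0) (\<lambda>n. Var (n + 3))"]) (use c isty_ctx[OF c(1)]
        in \<open>auto simp: sub\<close>)
  moreover have "?G \<turnstile> Var 1 \<Colon> lift 2 ?S" "?G \<turnstile> Var 0 \<Colon> lift 2 ?S"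
    using isty_ctx[OF c(1)] by (auto simp: sub)
  ultimately show "inh ?G (Eq (lift 2 ?S) (Var 1) (Var 0))"
    using sig_is_prop[OF c] by (simp add: sub)
qed

section \<open>Function extensionality and univalence\<close>

lemma isty_inverse:
  assumes A: "isty \<Gamma> A" and B: "isty \<Gamma> B" and f: "\<Gamma> \<turnstile> f \<Colon> Arr A B"
  shows "isty (Arr B A # \<Gamma>)
      (Pi (lift 1 B) (Eq (lift 2 B) (App (lift 2 f) (App (Var 1) (Var 0))) (Var 0)))"
    and "isty (Arr B A # \<Gamma>)
      (Pi (lift 1 A) (Eq (lift 2 A) (App (Var 1) (App (lift 2 f) (Var 0))) (Var 0)))"
proof -
  note [intro!] = subst_isty[OF A] subst_isty[OF B] subst_type[OF f]
  note ctx = isty_ctx[OF A]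
  let ?G = "lift 1 B # Arr B A # \<Gamma>" and ?H = "lift 1 A # Arr B A # \<Gamma>"
  have G: "ctx ?G" and H: "ctx ?H" using A B ctx by (auto simp: sub)
  have fG: "?G \<turnstile> lift 2 f \<Colon> Arr (lift 2 A) (lift 2 B)"
      and fH: "?H \<turnstile> lift 2 f \<Colon> Arr (lift 2 A) (lift 2 B)"
    and gG: "?G \<turnstile> Var 1 \<Colon> Arr (lift 2 B) (lift 2 A)"
        and gH: "?H \<turnstile> Var 1 \<Colon> Arr (lift 2 B) (lift 2 A)"
    and bG: "?G \<turnstile> Var 0 \<Colon> lift 2 B" and aH: "?H \<turnstile> Var 0 \<Colon> lift 2 A"
    and BG: "isty ?G (lift 2 B)" and AH: "isty ?H (lift 2 A)"
    using G H by (auto simp: sub)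
  show "isty (Arr B A # \<Gamma>)
      (Pi (lift 1 B) (Eq (lift 2 B) (App (lift 2 f) (App (Var 1) (Var 0))) (Var 0)))"
    using G by (intro isty_Pi isty_Eq BG bG app_Arr[OF fG] app_Arr[OF gG]) simp
  show "isty (Arr B A # \<Gamma>)
      (Pi (lift 1 A) (Eq (lift 2 A) (App (Var 1) (App (lift 2 f) (Var 0))) (Var 0)))"
    using H by (intro isty_Pi isty_Eq AH aH app_Arr[OF gH] app_Arr[OF fH]) simp
qed

lemma isty_is_equiv:
  assumes "isty \<Gamma> A" "isty \<Gamma> B" "\<Gamma> \<turnstile> f \<Colon> Arr A B"
  shows "isty \<Gamma> (is_equiv A B f)"
  unfolding is_equiv_def using assms by (intro isty_Prod isty_Sig isty_Arr isty_inverse)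

text \<open>The backward map carries an inhabitant of \<open>B\<close> to one of \<open>A\<close>.
  \<open>Funext\<close> and \<open>Univalence\<close> assert that certain maps out of identity types
  are equivalences; this is how paths are extracted from them.\<close>

lemma inh_equiv_inverse:
  assumes A: "isty \<Gamma> A" and B: "isty \<Gamma> B" and f: "\<Gamma> \<turnstile> f \<Colon> Arr A B" and e: "\<Gamma> \<turnstile> e \<Colon> is_equiv A B f"
    and b: "inh \<Gamma> B"
  shows "inh \<Gamma> A"
proof -
  let ?S = "Sig (Arr B A) (Pi (lift 1 A) (Eq (lift 2 A) (App (Var 1) (App (lift 2 f) (Var 0))) (Var
      0)))"
  let ?T = "Sig (Arr B A) (Pi (lift 1 B) (Eq (lift 2 B) (App (lift 2 f) (App (Var 1) (Var 0))) (Var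
      0)))"
  have S: "isty \<Gamma> ?S" and T: "isty \<Gamma> ?T"
    using isty_inverse[OF A B f] A B by auto
  have "isty (?T # \<Gamma>) (lift 1 ?S)"
    by (rule isty_lift[OF S T])
  from inh_pr1[OF inhI[OF e[unfolded is_equiv_def Prod_def]] T this]
  have "inh \<Gamma> (Arr B A)"
    using isty_inverse[OF A B f] A B by (auto elim!: inh_pr1)
  then show ?thesis
    using b unfolding inh_def by (blast intro: app_Arr)
qed

lemma isty_equiv_type:
  assumes A: "isty \<Gamma> A" and B: "isty \<Gamma> B"
  shows "isty \<Gamma> (equiv_type A B)"
proof -
  note [intro!] = subst_isty[OF A] subst_isty[OF B]
  note ctx = isty_ctx[OF A]
  have "isty (Arr A B # \<Gamma>) (is_equiv (lift 1 A) (lift 1 B) (Var 0))"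
    by (rule isty_is_equiv) (use A B ctx in \<open>auto simp: sub\<close>)
  then show ?thesis
    unfolding equiv_type_def using A B by auto
qed

text \<open>The single map \<open>g\<close> serves both as right and as left inverse.\<close>

lemma equivI:
  assumes A: "isty \<Gamma> A" and B: "isty \<Gamma> B" and f: "\<Gamma> \<turnstile> f \<Colon> Arr A B" and g: "\<Gamma> \<turnstile> g \<Colon> Arr B A"
    and h: "\<Gamma> \<turnstile> h \<Colon> Pi B (Eq (lift 1 B) (App (lift 1 f) (App (lift 1 g) (Var 0))) (Var 0))"
    and k: "\<Gamma> \<turnstile> k \<Colon> Pi A (Eq (lift 1 A) (App (lift 1 g) (App (lift 1 f) (Var 0))) (Var 0))"
  shows "\<Gamma> \<turnstile> Tuple f (Tuple (Tuple g h) (Tuple g k)) \<Colon> equiv_type A B"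
proof -
  note [intro!] = subst_isty[OF A] subst_isty[OF B]
  note ctx = isty_ctx[OF A]
  let ?S = "Sig (Arr B A) (Pi (lift 1 A) (Eq (lift 2 A) (App (Var 1) (App (lift 2 f) (Var 0))) (Var
      0)))"
  let ?T = "Sig (Arr B A) (Pi (lift 1 B) (Eq (lift 2 B) (App (lift 2 f) (App (Var 1) (Var 0))) (Var
      0)))"
  have ST: "isty \<Gamma> ?S" "isty \<Gamma> ?T"
    using isty_inverse[OF A B f] A B by auto
  then have SI: "isty (?T # \<Gamma>) (lift 1 ?S)"
    by (intro isty_lift)
  have gh: "\<Gamma> \<turnstile> Tuple g h \<Colon> ?T"
    by (rule pair_type) (use isty_inverse[OF A B f] g h in \<open>auto simp: sub\<close>)
  have gk: "\<Gamma> \<turnstile> Tuple g k \<Colon> ?S"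
    by (rule pair_type) (use isty_inverse[OF A B f] g k in \<open>auto simp: sub\<close>)
  have "\<Gamma> \<turnstile> Tuple (Tuple g h) (Tuple g k) \<Colon> is_equiv A B f"
    unfolding is_equiv_def Prod_def by (rule pair_type[OF SI gh]) (use gk in \<open>simp add: sub\<close>)
  moreover have "isty (Arr A B # \<Gamma>) (is_equiv (lift 1 A) (lift 1 B) (Var 0))"
    by (rule isty_is_equiv) (use A B ctx in \<open>auto simp: sub\<close>)
  ultimately show ?thesis
    unfolding equiv_type_def using f by (auto simp: sub intro!: pair_type)
qed

lemma happly_type:
  assumes A: "isty \<Gamma> A" and B: "isty (A # \<Gamma>) B" and f: "\<Gamma> \<turnstile> f \<Colon> Pi A B" and g: "\<Gamma> \<turnstile> g \<Colon> Pi A B"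
  shows "\<Gamma> \<turnstile> happly A B f g \<Colon> Arr (Eq (Pi A B) f g) (homotopy A B f g)"
proof -
  note [intro!] = subst_isty[OF A] subst_isty[OF B] subst_type[OF f] subst_type[OF g] f g
  note ctx = isty_ctx[OF A]
  let ?P = "Pi A B" and ?E = "Eq (Pi A B) f g"
  \<comment> \<open>The three variables of path induction are declared after the path bound by
    \<open>happly\<close>, which accounts for the weakening by 4.\<close>
  let ?G = "Eq (lift 3 ?P) (Var 1) (Var 0) # lift 2 ?P # lift 1 ?P # ?E # \<Gamma>"
  let ?C = "homotopy (lift 4 A) (ren (up_ren (\<lambda>n. n + 4)) B) (Var 2) (Var 1)"
  have c: "ctx ?G" using A B ctx by (auto simp: sub)
  then have c': "ctx (lift 4 A # ?G)" by (auto simp: sub)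
  have "isty ?G ?C"
    unfolding homotopy_def
    by (intro isty_Pi isty_Eq app_type[where A = "lift 5 A"
        and B = "subst (scons (Var 0) (\<lambda>n. Var (n + 6))) B"])
       (use c c' in \<open>auto simp: sub\<close>)
  moreover have "lift 2 A # lift 1 ?P # ?E # \<Gamma> \<turnstile> App (Var 1) (Var 0) \<Colon>
      subst (scons (Var 0) (\<lambda>n. Var (n + 3))) B"
    by (intro app_type[where A = "lift 3 A" and B = "subst (scons (Var 0) (\<lambda>n. Var (n + 4))) B"])
       (use A B ctx in \<open>auto simp: sub\<close>)
  then have "lift 1 ?P # ?E # \<Gamma> \<turnstile> Lam (lift 2 A) (Refl (App (Var 1) (Var 0))) \<Colon>
      subst (scons (Refl (Var 0)) (scons (Var 0) Var)) ?C"
    unfolding homotopy_def using A B ctx by (auto simp: sub intro!: lam_type refl_type)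
  ultimately have "?E # \<Gamma> \<turnstile> IndEq ?C (Lam (lift 2 A) (Refl (App (Var 1) (Var 0)))) (lift 1 f) (lift
      1 g) (Var 0)
      \<Colon> lift 1 (homotopy A B f g)"
    by (intro ind_eq[where A = "lift 1 ?P"]) (use A B ctx in \<open>auto simp: sub homotopy_def\<close>)
  then show ?thesis
    unfolding happly_def Arr_def by (intro lam_type) (use A B in auto)
qed

lemma inh_funext:
  assumes A: "isty \<Gamma> A" and B: "isty (A # \<Gamma>) B" and f: "\<Gamma> \<turnstile> f \<Colon> Pi A B" and g: "\<Gamma> \<turnstile> g \<Colon> Pi A B"
    and h: "inh (A # \<Gamma>) (Eq B (App (lift 1 f) (Var 0)) (App (lift 1 g) (Var 0)))"
  shows "inh \<Gamma> (Eq (Pi A B) f g)"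
proof -
  note [intro!] = subst_isty[OF A] subst_isty[OF B] subst_type[OF f] subst_type[OF g] f g
  note ctx = isty_ctx[OF A]
  have P: "isty \<Gamma> (Pi A B)" using A B by auto
  then obtain i where "\<Gamma> \<turnstile> Pi A B \<Colon> U i" by (auto simp: isty_def)
  from funext[OF this f g] have e: "\<Gamma> \<turnstile> Funext f g \<Colon>
    is_equiv (Eq (Pi A B) f g) (homotopy A B f g) (happly A B f g)" .
  have "isty \<Gamma> (homotopy A B f g)"
    unfolding homotopy_def
    by (intro isty_Pi A isty_Eq B app_type[where A = "lift 1 A"
        and B = "subst (scons (Var 0) (\<lambda>n. Var (n + 2))) B"])
      (use A B ctx in \<open>auto simp: sub\<close>)
  moreover have "inh \<Gamma> (homotopy A B f g)"
    unfolding homotopy_def by (rule inh_Pi[OF A h])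
  ultimately show ?thesis
    using inh_equiv_inverse[OF _ _ happly_type[OF A B f g] e] P f g by blast
qed

lemma is_prop_Pi:
  assumes A: "isty \<Gamma> A" and B: "isty (A # \<Gamma>) B" and P: "inh (A # \<Gamma>) (is_prop B)"
  shows "inh \<Gamma> (is_prop (Pi A B))"
proof (rule is_propI)
  note [intro!] = subst_isty[OF A] subst_isty[OF B]
  note ctx = isty_ctx[OF A]
  let ?P = "Pi A B"
  let ?G = "lift 1 ?P # ?P # \<Gamma>"
  let ?B = "\<lambda>k. subst (scons (Var 0) (\<lambda>n. Var (n + k))) B"
  show AB: "isty \<Gamma> (Pi A B)" using A B by auto
  have c: "isty ?G (lift 2 A)" and c': "isty (lift 2 A # ?G) (?B 3)"
    using AB ctx by (auto simp: sub)
  have "inh ?G (Eq (Pi (lift 2 A) (?B 3)) (Var 1) (Var 0))"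
  proof (rule inh_funext[OF c c'])
    show "?G \<turnstile> Var 1 \<Colon> Pi (lift 2 A) (?B 3)" "?G \<turnstile> Var 0 \<Colon> Pi (lift 2 A) (?B 3)"
      using isty_ctx[OF c] by (auto simp: sub)
    have "inh (lift 2 A # ?G) (is_prop (?B 3))"
      by (rule subst_inh[OF P, of "scons (Var 0) (\<lambda>n. Var (n + 3))"]) (use c isty_ctx[OF c]
          in \<open>auto simp: sub\<close>)
    then show "inh (lift 2 A # ?G) (Eq (?B 3) (App (lift 1 (Var 1)) (Var 0)) (App (lift 1 (Var 0))
        (Var 0)))"
      by (rule is_prop_app; intro app_type[where A = "lift 3 A"
          and B = "subst (scons (Var 0) (\<lambda>n. Var (n + 4))) B"])
        (use c isty_ctx[OF c] in \<open>auto simp: sub\<close>)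
  qed
  then show "inh ?G (Eq (lift 2 ?P) (Var 1) (Var 0))" by (simp add: sub)
qed

text \<open>Once \<open>A\<close> may be assumed to be a proposition, its identity types are
  propositions, and hence so are products of them.\<close>

lemma is_prop_is_prop:
  assumes A: "isty \<Gamma> A"
  shows "inh \<Gamma> (is_prop (is_prop A))"
proof (rule is_prop_assume)
  note [intro!] = subst_isty[OF A]
  note ctx = isty_ctx[OF A]
  show "isty \<Gamma> (is_prop A)" using A by auto
  let ?G = "lift 2 A # lift 1 A # is_prop A # \<Gamma>"
  have c: "isty ?G (lift 3 A)" using A ctx by (auto simp: sub)
  have "inh ?G (is_prop (lift 3 A))"
    by (rule inhI[of _ "Var 2"]) (use isty_ctx[OF c] in \<open>auto simp: sub\<close>)
  then have "inh ?G (is_prop (Eq (lift 3 A) (Var 1) (Var 0)))"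
    by (intro is_prop_Eq c) (use isty_ctx[OF c] in \<open>auto simp: sub\<close>)
  then have "inh (is_prop A # \<Gamma>) (is_prop (Pi (lift 1 A) (Pi (lift 2 A) (Eq (lift 3 A) (Var 1) (Var
      0)))))"
    by (intro is_prop_Pi) (use A ctx in \<open>auto simp: sub\<close>)
  then show "inh (is_prop A # \<Gamma>) (is_prop (lift 1 (is_prop A)))"
    by (simp add: sub is_prop_def)
qed

text \<open>Any two points are joined through the centre.\<close>

lemma is_prop_contr:
  assumes A: "isty \<Gamma> A" and C: "inh \<Gamma> (is_trunc 0 A)"
  shows "inh \<Gamma> (is_prop A)"
proof (rule is_propI[OF A])
  note [intro!] = subst_isty[OF A]
  note ctx = isty_ctx[OF A]
  obtain s where s: "\<Gamma> \<turnstile> s \<Colon> Sig A (Pi (lift 1 A) (Eq (lift 2 A) (Var 1) (Var 0)))"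
    using C by (auto elim: inhE)
  have B: "isty (A # \<Gamma>) (Pi (lift 1 A) (Eq (lift 2 A) (Var 1) (Var 0)))"
    using A ctx by (auto simp: sub)
  let ?c = "pr1 A s"
  have c: "\<Gamma> \<turnstile> ?c \<Colon> A" by (rule pr1_type[OF s A B])
  have h: "inh \<Gamma> (Pi A (Eq (lift 1 A) (lift 1 ?c) (Var 0)))"
    by (rule inh_pr2[OF A B s]) (simp add: sub)
  let ?G = "lift 1 A # A # \<Gamma>"
  have G: "isty ?G (lift 2 A)" "?G \<turnstile> Var 1 \<Colon> lift 2 A" "?G \<turnstile> Var 0 \<Colon> lift 2 A" "ctx ?G"
    using A ctx by (auto simp: sub)
  note c2 = weaken2[OF c G(4)]
  have h2: "inh ?G (Pi (lift 2 A) (Eq (lift 3 A) (lift 3 ?c) (Var 0)))"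
    by (rule subst_inh[OF h, of "\<lambda>n. Var (n + 2)"]) (use G isty_ctx[OF G(1)] in \<open>auto simp: sub\<close>)
  have "inh ?G (Eq (lift 2 A) (lift 2 ?c) (Var 1))" "inh ?G (Eq (lift 2 A) (lift 2 ?c) (Var 0))"
    using inh_app[OF h2 G(2) refl] inh_app[OF h2 G(3) refl] by (simp_all add: sub)
  then show "inh ?G (Eq (lift 2 A) (Var 1) (Var 0))"
    using G c2 by (blast intro: inh_trans inh_sym)
qed

text \<open>Assuming contractibility makes \<open>A\<close> a proposition, hence also its identity
  types and the sum built from them. This qualifies contractibility as a family for
  \<open>connected_component\<close>.\<close>

lemma is_prop_is_contr:
  assumes A: "isty \<Gamma> A"
  shows "inh \<Gamma> (is_prop (is_trunc 0 A))"
proof (rule is_prop_assume)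
  note [intro!] = subst_isty[OF A]
  note ctx = isty_ctx[OF A]
  show T: "isty \<Gamma> (is_trunc 0 A)" using A ctx by (auto simp: sub)
  let ?G = "is_trunc 0 A # \<Gamma>"
  have A': "isty ?G (lift 1 A)" by (rule isty_lift[OF A T])
  have P: "inh ?G (is_prop (lift 1 A))"
    by (rule is_prop_contr[OF A' inhI[of _ "Var 0"]]) (use T ctx in \<open>auto simp: sub\<close>)
  let ?H = "lift 2 A # lift 1 A # ?G"
  have H: "isty ?H (lift 3 A)" "ctx ?H" using A' T ctx by (auto simp: sub)
  have "inh ?H (is_prop (lift 3 A))"
    by (rule subst_inh[OF P, of "\<lambda>n. Var (n + 2)"]) (use H in \<open>auto simp: sub\<close>)
  then have "inh ?H (is_prop (Eq (lift 3 A) (Var 1) (Var 0)))"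
    by (intro is_prop_Eq H) (use H in \<open>auto simp: sub\<close>)
  then have "inh (lift 1 A # ?G) (is_prop (Pi (lift 2 A) (Eq (lift 3 A) (Var 1) (Var 0))))"
    by (intro is_prop_Pi) (use T ctx in \<open>auto simp: sub\<close>)
  moreover have "isty (lift 1 A # ?G) (Pi (lift 2 A) (Eq (lift 3 A) (Var 1) (Var 0)))"
    using T ctx by (auto simp: sub)
  ultimately have "inh ?G (is_prop (Sig (lift 1 A) (Pi (lift 2 A) (Eq (lift 3 A) (Var 1) (Var
      0)))))"
    by (intro is_prop_Sig A' P)
  then show "inh ?G (is_prop (lift 1 (is_trunc 0 A)))"
    by (simp add: sub)
qed

text \<open>The centre of an identity type is the path \<open>e\<close> that propositionality
  provides; the other paths equal it because a proposition is a set.\<close>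

lemma is_prop_trunc1:
  assumes A: "isty \<Gamma> A" and P: "inh \<Gamma> (is_prop A)"
  shows "inh \<Gamma> (is_trunc 1 A)"
proof -
  note [intro!] = subst_isty[OF A]
  note ctx = isty_ctx[OF A]
  let ?G = "lift 1 A # A # \<Gamma>"
  let ?E = "Eq (lift 2 A) (Var 1) (Var 0)"
  have G: "isty ?G (lift 2 A)" "?G \<turnstile> Var 1 \<Colon> lift 2 A" "?G \<turnstile> Var 0 \<Colon> lift 2 A" "ctx ?G"
    using A ctx by (auto simp: sub)
  have P2: "inh ?G (is_prop (lift 2 A))"
    by (rule subst_inh[OF P, of "\<lambda>n. Var (n + 2)"]) (use G in \<open>auto simp: sub\<close>)
  obtain e where e: "?G \<turnstile> e \<Colon> ?E"
    using is_prop_app[OF P2 G(2,3)] by (rule inhE)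
  note [intro!] = subst_type[OF e[simplified sub]]
  have E: "isty ?G ?E" using G by auto
  have "inh (?E # ?G) (is_prop (lift 1 ?E))"
    by (rule subst_inh[OF is_prop_Eq[OF G(1) P2 G(2,3)], of "\<lambda>n. Var (n + 1)"]) (use E G
        in \<open>auto simp: sub\<close>)
  then have "inh (?E # ?G) (Eq (lift 1 ?E) (lift 1 e) (Var 0))"
    by (rule is_prop_app) (use E G in \<open>auto simp: sub\<close>)
  then have "inh ?G (Pi ?E (Eq (lift 1 ?E) (lift 1 e) (Var 0)))"
    by (rule inh_Pi[OF E])
  moreover have "isty (?E # ?G) (Pi (lift 1 ?E) (Eq (lift 2 ?E) (Var 1) (Var 0)))"
    using E G by (auto simp: sub)
  ultimately have "inh ?G (is_trunc 0 ?E)"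
    unfolding is_trunc.simps by (intro inh_pair[OF _ e]) (auto simp: sub)
  then have "inh \<Gamma> (Pi A (Pi (lift 1 A) (is_trunc 0 ?E)))"
    by (intro inh_Pi) (use A ctx in \<open>auto simp: sub\<close>)
  then show ?thesis by simp
qed

lemma is_prop_trunc2:
  assumes A: "isty \<Gamma> A" and P: "inh (lift 1 A # A # \<Gamma>) (is_prop (Eq (lift 2 A) (Var 1) (Var 0)))"
  shows "inh \<Gamma> (is_trunc 2 A)"
proof -
  note [intro!] = subst_isty[OF A]
  note ctx = isty_ctx[OF A]
  have "inh (lift 1 A # A # \<Gamma>) (is_trunc 1 (Eq (lift 2 A) (Var 1) (Var 0)))"
    by (rule is_prop_trunc1[OF _ P]) (use A ctx in \<open>auto simp: sub\<close>)
  then have "inh \<Gamma> (Pi A (Pi (lift 1 A) (is_trunc 1 (Eq (lift 2 A) (Var 1) (Var 0)))))"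
    by (intro inh_Pi) (use A ctx in \<open>auto simp: sub\<close>)
  then show ?thesis by (simp add: numeral_2_eq_2)
qed

lemma trunc2_is_prop:
  assumes A: "isty \<Gamma> A" and T: "inh \<Gamma> (is_trunc 2 A)" and a: "\<Gamma> \<turnstile> a \<Colon> A" and b: "\<Gamma> \<turnstile> b \<Colon> A"
  shows "inh \<Gamma> (is_prop (Eq A a b))"
proof (rule trunc1_is_prop)
  have "inh \<Gamma> (Pi A (Pi (lift 1 A) (is_trunc 1 (Eq (lift 2 A) (Var 1) (Var 0)))))"
    using T by (simp add: numeral_2_eq_2)
  then have "inh \<Gamma> (Pi A (is_trunc 1 (Eq (lift 1 A) (lift 1 a) (Var 0))))"
    by (rule inh_app[OF _ a]) (simp add: sub del: is_trunc.simps)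
  then show "inh \<Gamma> (is_trunc 1 (Eq A a b))"
    by (rule inh_app[OF _ b]) (simp add: sub del: is_trunc.simps)
qed (use A a b in auto)

section \<open>Univalence in terms of inhabitation\<close>

lemma beta_id:
  assumes A: "isty \<Gamma> A" and a: "\<Gamma> \<turnstile> a \<Colon> A"
  shows "\<Gamma> \<turnstile> App (Lam A (Var 0)) a \<doteq> a \<Colon> A"
proof -
  have "A # \<Gamma> \<turnstile> Var 0 \<Colon> lift 1 A" using A isty_ctx[OF A] by auto
  from pi_comp[OF this a] show ?thesis by (simp add: sub)
qed

lemma id_equiv_type:
  assumes A: "isty \<Gamma> A"
  shows "\<Gamma> \<turnstile> id_equiv A \<Colon> equiv_type A A"
proof -
  note ctx = isty_ctx[OF A]
  let ?i = "Lam A (Var 0)" and ?j = "Lam (lift 1 A) (Var 0)"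
  have A1: "isty (A # \<Gamma>) (lift 1 A)" by (rule isty_lift[OF A A])
  then obtain k where k: "A # \<Gamma> \<turnstile> lift 1 A \<Colon> U k" by (auto simp: isty_def)
  have x: "A # \<Gamma> \<turnstile> Var 0 \<Colon> lift 1 A" using A ctx by auto
  have i: "\<Gamma> \<turnstile> ?i \<Colon> Arr A A" unfolding Arr_def by (rule lam_type[OF A x])
  have j: "A # \<Gamma> \<turnstile> ?j \<Colon> Arr (lift 1 A) (lift 1 A)"
    unfolding Arr_def by (rule lam_type[OF A1]) (use A A1 ctx in auto)
  \<comment> \<open>\<open>id_equiv\<close> uses reflexivity where a path from the twice applied
    identity function is expected; beta reduction justifies the retyping.\<close>
  have "A # \<Gamma> \<turnstile> Var 0 \<doteq> App ?j (App ?j (Var 0)) \<Colon> lift 1 A"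
    by (rule jeq_sym, rule jeq_trans[OF beta_id[OF A1 app_Arr[OF j x]] beta_id[OF A1 x]])
  from eq_form_cong[OF jeq_refl[OF k] this jeq_refl[OF x]]
  have "A # \<Gamma> \<turnstile> Refl (Var 0) \<Colon> Eq (lift 1 A) (App ?j (App ?j (Var 0))) (Var 0)"
    by (rule conv[OF refl_type[OF A1 x]])
  then have "\<Gamma> \<turnstile> Lam A (Refl (Var 0)) \<Colon> Pi A (Eq (lift 1 A) (App (lift 1 ?i) (App (lift 1 ?i) (Var
      0))) (Var 0))"
    by (intro lam_type[OF A]) (simp add: sub)
  from equivI[OF A A i i this this] show ?thesis
    by (simp add: id_equiv_def Let_def)
qed

lemma id_to_equiv_type:
  assumes A: "\<Gamma> \<turnstile> A \<Colon> U i" and B: "\<Gamma> \<turnstile> B \<Colon> U i"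
  shows "\<Gamma> \<turnstile> id_to_equiv i A B \<Colon> Arr (Eq (U i) A B) (equiv_type A B)"
proof -
  note [intro!] = subst_type[OF A] subst_type[OF B]
  note ctx = ctx_of_judgement(2)[OF A]
  let ?E = "Eq (U i) A B"
  let ?G = "Eq (U i) (Var 1) (Var 0) # U i # U i # ?E # \<Gamma>"
  have E: "isty \<Gamma> ?E" using A B ctx by auto
  then have "ctx ?G" by (auto simp: sub isty_ctx)
  then have "?G \<turnstile> Var 2 \<Colon> U i" "?G \<turnstile> Var 1 \<Colon> U i" by (auto simp: sub)
  then have C: "isty ?G (equiv_type (Var 2) (Var 1))"
    by (intro isty_equiv_type isty_U)
  have "U i # ?E # \<Gamma> \<turnstile> Var 0 \<Colon> U i" using E by (auto simp: sub isty_ctx)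
  then have c: "U i # ?E # \<Gamma> \<turnstile> id_equiv (Var 0) \<Colon> equiv_type (Var 0) (Var 0)"
    by (intro id_equiv_type isty_U)
  have "?E # \<Gamma> \<turnstile> IndEq (equiv_type (Var 2) (Var 1)) (id_equiv (Var 0)) (lift 1 A) (lift 1 B) (Var 0)
      \<Colon> lift 1 (equiv_type A B)"
    by (rule ind_eq[where A = "U i"]) (use C c E ctx in \<open>auto simp: sub\<close>)
  then show ?thesis
    unfolding id_to_equiv_def Arr_def by (intro lam_type[OF E])
qed

lemma inh_ua:
  assumes A: "\<Gamma> \<turnstile> A \<Colon> U i" and B: "\<Gamma> \<turnstile> B \<Colon> U i" and e: "inh \<Gamma> (equiv_type A B)"
  shows "inh \<Gamma> (Eq (U i) A B)"
  by (rule inh_equiv_inverse[OF _ _ id_to_equiv_type[OF A B] univalence[OF A B] e])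
    (use A B in \<open>auto simp: ctx_of_judgement intro: isty_equiv_type isty_U\<close>)

text \<open>Between propositions any two opposite maps are mutually inverse.\<close>

lemma inh_equiv_of_props:
  assumes A: "isty \<Gamma> A" and B: "isty \<Gamma> B" and PA: "inh \<Gamma> (is_prop A)" and PB: "inh \<Gamma> (is_prop B)"
    and "inh \<Gamma> (Arr A B)" and "inh \<Gamma> (Arr B A)"
  shows "inh \<Gamma> (equiv_type A B)"
proof -
  obtain f g where f: "\<Gamma> \<turnstile> f \<Colon> Arr A B" and g: "\<Gamma> \<turnstile> g \<Colon> Arr B A"
    using assms by (auto simp: inh_def)
  \<comment> \<open>Stated for arbitrary types and maps so that it covers both composites.\<close>
  have *: "inh \<Gamma> (Pi A (Eq (lift 1 A) (App (lift 1 g) (App (lift 1 f) (Var 0))) (Var 0)))"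
    if A: "isty \<Gamma> A" and B: "isty \<Gamma> B" and PA: "inh \<Gamma> (is_prop A)" and f: "\<Gamma> \<turnstile> f \<Colon> Arr A B"
        and g: "\<Gamma> \<turnstile> g \<Colon> Arr B A"
    for A B f g
  proof (rule inh_Pi[OF A])
    have x: "A # \<Gamma> \<turnstile> Var 0 \<Colon> lift 1 A" using A isty_ctx[OF A] by auto
    have f': "A # \<Gamma> \<turnstile> lift 1 f \<Colon> Arr (lift 1 A) (lift 1 B)"
        and g': "A # \<Gamma> \<turnstile> lift 1 g \<Colon> Arr (lift 1 B) (lift 1 A)"
      using weaken[OF f A] weaken[OF g A] by (simp_all add: sub)
    have "inh (A # \<Gamma>) (is_prop (lift 1 A))"
      by (rule subst_inh[OF PA, of "\<lambda>n. Var (n + 1)"]) (use A isty_ctx[OF A] in \<open>auto simp: sub\<close>)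
    then show "inh (A # \<Gamma>) (Eq (lift 1 A) (App (lift 1 g) (App (lift 1 f) (Var 0))) (Var 0))"
      by (rule is_prop_app[OF _ app_Arr[OF g' app_Arr[OF f' x]] x])
  qed
  obtain h k where "\<Gamma> \<turnstile> h \<Colon> Pi B (Eq (lift 1 B) (App (lift 1 f) (App (lift 1 g) (Var 0))) (Var 0))"
    "\<Gamma> \<turnstile> k \<Colon> Pi A (Eq (lift 1 A) (App (lift 1 g) (App (lift 1 f) (Var 0))) (Var 0))"
    using *[OF A B PA f g] *[OF B A PB g f] by (auto simp: inh_def)
  from equivI[OF A B f g this] show ?thesis by (rule inhI)
qed

section \<open>Products and subtypes\<close>

lemma inh_Prod: "\<lbrakk>isty \<Gamma> A; isty \<Gamma> B; inh \<Gamma> A; inh \<Gamma> B\<rbrakk> \<Longrightarrow> inh \<Gamma> (Prod A B)"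
  unfolding Prod_def by (erule inhE[of \<Gamma> A], rule inh_pair[OF isty_lift]) (simp_all add: sub)

lemma inh_Prod1: "\<lbrakk>isty \<Gamma> A; isty \<Gamma> B; inh \<Gamma> (Prod A B)\<rbrakk> \<Longrightarrow> inh \<Gamma> A"
  unfolding Prod_def by (erule inh_pr1) (blast intro: isty_lift)+

lemma inh_Prod2: "\<lbrakk>isty \<Gamma> A; isty \<Gamma> B; inh \<Gamma> (Prod A B)\<rbrakk> \<Longrightarrow> inh \<Gamma> B"
  unfolding Prod_def by (erule inhE, rule inh_pr2[OF _ isty_lift]) (assumption | simp add: sub)+

lemma is_prop_Prod: "\<lbrakk>isty \<Gamma> A; isty \<Gamma> B; inh \<Gamma> (is_prop A); inh \<Gamma> (is_prop B)\<rbrakk> \<Longrightarrow> inh \<Gamma> (is_prop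
    (Prod A B))"
  unfolding Prod_def using inh_lift[of \<Gamma> "is_prop B" A] by (intro is_prop_Sig isty_lift) (simp_all
      add: lift_subst)

lemma is_prop_Arr: "\<lbrakk>isty \<Gamma> A; isty \<Gamma> B; inh \<Gamma> (is_prop B)\<rbrakk> \<Longrightarrow> inh \<Gamma> (is_prop (Arr A B))"
  unfolding Arr_def using inh_lift[of \<Gamma> "is_prop B" A] by (intro is_prop_Pi isty_lift) (simp_all
      add: lift_subst)

lemma inh_Arr_id: "isty \<Gamma> A \<Longrightarrow> inh \<Gamma> (Arr A A)"
  unfolding Arr_def by (intro inh_Pi inhI[of _ "Var 0"]) (auto simp: isty_ctx)

text \<open>Induction on \<open>s\<close> with \<open>v\<close> generalised. On a pair the first
  projection computes, which gives the path that \<open>sig_path\<close> needs, and propositionality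
  of \<open>B\<close> admits every \<open>v\<close>.\<close>

lemma sig_eta:
  assumes A: "isty \<Gamma> A" and B: "isty (A # \<Gamma>) B" and P: "inh (A # \<Gamma>) (is_prop B)"
      and s: "\<Gamma> \<turnstile> s \<Colon> Sig A B"
    and v: "\<Gamma> \<turnstile> v \<Colon> inst1 (pr1 A s) B"
  shows "inh \<Gamma> (Eq (Sig A B) s (Tuple (pr1 A s) v))"
proof -
  note [intro!] = subst_isty[OF A] subst_isty[OF B] subst_type[OF s] pair_type
  note ctx = isty_ctx[OF A]
  let ?S = "Sig A B"
  let ?B = "\<lambda>k. subst (scons (Var 0) (\<lambda>n. Var (n + k))) B"
  let ?p = "\<lambda>k t. pr1 (lift k A) t"
  let ?Bp = "\<lambda>k t. subst (scons (?p k t) (\<lambda>n. Var (n + k))) B"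
  let ?C = "Pi (?Bp 1 (Var 0)) (Eq (lift 2 ?S) (Var 1) (Tuple (?p 2 (Var 1)) (Var 0)))"
  have S: "isty \<Gamma> ?S" using A B by auto
  have c1: "ctx (?S # \<Gamma>)" using S by simp
  have p1: "?S # \<Gamma> \<turnstile> ?p 1 (Var 0) \<Colon> lift 1 A"
    by (rule pr1_type[where B = "?B 2"]) (use c1 ctx in \<open>auto simp: sub\<close>)
  have c2: "ctx (?Bp 1 (Var 0) # ?S # \<Gamma>)" using c1 p1 by (auto simp: sub)
  have p2: "?Bp 1 (Var 0) # ?S # \<Gamma> \<turnstile> ?p 2 (Var 1) \<Colon> lift 2 A"
    by (rule pr1_type[where B = "?B 3"]) (use c2 ctx in \<open>auto simp: sub\<close>)
  have C: "isty (?S # \<Gamma>) ?C"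
    using c2 p2 c1 p1 by (auto simp: sub)
  let ?G = "B # A # \<Gamma>" and ?t = "Tuple (Var 1) (Var 0)"
  have G: "ctx ?G" "isty ?G (lift 2 A)" "isty (lift 2 A # ?G) (?B 3)"
    "?G \<turnstile> Var 1 \<Colon> lift 2 A" "?G \<turnstile> Var 0 \<Colon> inst1 (Var 1) (?B 3)" "?G \<turnstile> ?t \<Colon> Sig (lift 2 A) (?B 3)"
    using A B ctx by (auto simp: sub)
  have pt: "?G \<turnstile> ?p 2 ?t \<Colon> lift 2 A" by (rule pr1_type[OF G(6) G(2,3)])
  have e2: "inh ?G (Eq (lift 2 A) (Var 1) (?p 2 ?t))"
    by (rule inh_Eq_conv[OF G(2,4) jeq_sym[OF pr1_pair[OF G(2-5)]]])
  have HB: "isty ?G (?Bp 2 ?t)" using G pt by (auto simp: sub)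
  have e: "inh (?Bp 2 ?t # ?G) (Eq (lift 3 A) (Var 2) (?p 3 (Tuple (Var 2) (Var 1))))"
    using inh_lift[OF e2 HB] by (simp add: sub)
  let ?H = "?Bp 2 ?t # ?G"
  from HB have H: "ctx ?H" by simp
  have H': "isty ?H (lift 3 A)" "isty (lift 3 A # ?H) (?B 4)" "?H \<turnstile> Var 2 \<Colon> lift 3 A"
    "?H \<turnstile> Var 1 \<Colon> inst1 (Var 2) (?B 4)" "?H \<turnstile> Var 0 \<Colon> inst1 (?p 3 (Tuple (Var 2) (Var 1))) (?B 4)"
    using H by (auto simp: sub)
  have p3: "?H \<turnstile> ?p 3 (Tuple (Var 2) (Var 1)) \<Colon> lift 3 A"
    using weaken[OF pt HB] by (simp add: sub)
  have P3: "inh (lift 3 A # ?H) (is_prop (?B 4))"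
    by (rule subst_inh[OF P, of "scons (Var 0) (\<lambda>n. Var (n + 4))"]) (use H H' in \<open>auto simp: sub\<close>)
  from sig_path[OF H'(1,2) P3 H'(3) p3 e H'(4,5)]
  have "inh ?G (Pi (?Bp 2 ?t) (Eq (Sig (lift 3 A) (?B 4)) (Tuple (Var 2) (Var 1)) (Tuple (?p 3
      (Tuple (Var 2) (Var 1))) (Var 0))))"
    by (intro inh_Pi HB)
  then have "inh ?G (repl 2 ?t ?C)" by (simp add: sub)
  then have "inh \<Gamma> (Pi (inst1 (pr1 A s) B) (Eq (lift 1 ?S) (lift 1 s) (Tuple (lift 1 (pr1 A s)) (Var
      0))))"
    by (rule inh_Sig_ind[OF C _ s]) (simp add: sub)
  then show ?thesis by (rule inh_app[OF _ v]) (simp add: sub)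
qed

text \<open>Equality in a subtype: by \<open>sig_eta\<close> both points may be replaced by pairs of
  their first projections with some second components.\<close>

lemma sig_path_pr1:
  assumes A: "isty \<Gamma> A" and B: "isty (A # \<Gamma>) B" and P: "inh (A # \<Gamma>) (is_prop B)"
    and s: "\<Gamma> \<turnstile> s \<Colon> Sig A B" and t: "\<Gamma> \<turnstile> t \<Colon> Sig A B" and e: "inh \<Gamma> (Eq A (pr1 A s) (pr1 A t))"
  shows "inh \<Gamma> (Eq (Sig A B) s t)"
proof -
  note ps = pr1_type[OF s A B] and pt = pr1_type[OF t A B]
  have S: "isty \<Gamma> (Sig A B)" using A B by auto
  obtain u v where u: "\<Gamma> \<turnstile> u \<Colon> inst1 (pr1 A s) B" and v: "\<Gamma> \<turnstile> v \<Colon> inst1 (pr1 A t) B"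
    using inh_pr2[OF A B s refl] inh_pr2[OF A B t refl] by (auto simp: inh_def)
  note us = pair_type[OF B ps u] and vt = pair_type[OF B pt v]
  have "inh \<Gamma> (Eq (Sig A B) (Tuple (pr1 A s) u) (Tuple (pr1 A t) v))"
    by (rule sig_path[OF A B P ps pt e u v])
  from inh_trans[OF S us vt t this inh_sym[OF S t vt sig_eta[OF A B P t v]]]
  show ?thesis by (rule inh_trans[OF S s us t sig_eta[OF A B P s u]])
qed

section \<open>Connectedness of the fibres of the truncation map\<close>

definition hProp :: "nat \<Rightarrow> tm" where
  "hProp i = Sig (U i) (is_prop (Var 0))"

abbreviation El :: "nat \<Rightarrow> tm \<Rightarrow> tm" where
  "El i s \<equiv> pr1 (U i) s"

lemma isty_is_prop_Var: "ctx \<Gamma> \<Longrightarrow> isty (U i # \<Gamma>) (is_prop (Var 0))"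
  by (intro isty_is_prop isty_U[of _ _ i] var_type) (auto simp: sub)

lemma isty_hProp [intro!]: "ctx \<Gamma> \<Longrightarrow> isty \<Gamma> (hProp i)"
  unfolding hProp_def by (intro isty_Sig isty_is_prop_Var) auto

lemma subst_hProp [simp]: "subst \<sigma> (hProp i) = hProp i"
  by (simp add: hProp_def sub)

lemma lift_hProp [simp]: "lift k (hProp i) = hProp i"
  by (simp add: lift_subst)

lemma El_type:
  assumes s: "\<Gamma> \<turnstile> s \<Colon> hProp i"
  shows "\<Gamma> \<turnstile> El i s \<Colon> U i"
  using ctx_of_judgement(2)[OF s] pr1_type[OF s[unfolded hProp_def] isty_univ isty_is_prop_Var]
      by blast

lemma isty_El: "\<Gamma> \<turnstile> s \<Colon> hProp i \<Longrightarrow> isty \<Gamma> (El i s)"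
  by (blast intro: isty_U El_type)

lemma is_prop_El:
  assumes s: "\<Gamma> \<turnstile> s \<Colon> hProp i"
  shows "inh \<Gamma> (is_prop (El i s))"
  using ctx_of_judgement(2)[OF s]
  by (intro inh_pr2[OF isty_univ isty_is_prop_Var s[unfolded hProp_def]]) (simp_all add: sub)

text \<open>Propositional extensionality: univalence turns the two implications into a path of
  types, and the attached proofs agree because being a proposition is a proposition.\<close>

lemma hProp_path:
  assumes s: "\<Gamma> \<turnstile> s \<Colon> hProp i" and t: "\<Gamma> \<turnstile> t \<Colon> hProp i"
    and "inh \<Gamma> (Arr (El i s) (El i t))" and "inh \<Gamma> (Arr (El i t) (El i s))"
  shows "inh \<Gamma> (Eq (hProp i) s t)"
proof -
  note ctx = ctx_of_judgement(2)[OF s]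
  have "inh \<Gamma> (Eq (U i) (El i s) (El i t))"
    using assms by (intro inh_ua El_type inh_equiv_of_props isty_El is_prop_El)
  moreover have "inh (U i # \<Gamma>) (is_prop (is_prop (Var 0)))"
    by (intro is_prop_is_prop isty_U[of _ _ i] var_type) (use ctx in \<open>auto simp: sub\<close>)
  ultimately show ?thesis
    unfolding hProp_def using s t ctx
    by (intro sig_path_pr1 isty_is_prop_Var) (auto simp: hProp_def)
qed

text \<open>Logical equivalence is a propositional relation that follows from equality and, by
  \<open>hProp_path\<close>, implies it; so \<open>set_from_relation\<close> applies.\<close>

lemma hProp_set:
  assumes ctx: "ctx \<Gamma>" and s: "\<Gamma> \<turnstile> s \<Colon> hProp i" and t: "\<Gamma> \<turnstile> t \<Colon> hProp i"
    and p: "\<Gamma> \<turnstile> p \<Colon> Eq (hProp i) s t" and q: "\<Gamma> \<turnstile> q \<Colon> Eq (hProp i) s t"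
  shows "inh \<Gamma> (Eq (Eq (hProp i) s t) p q)"
proof -
  let ?R = "Prod (Arr (El i (Var 1)) (El i (Var 0))) (Arr (El i (Var 0)) (El i (Var 1)))"
  let ?G = "hProp i # hProp i # \<Gamma>"
  have G: "ctx ?G" using ctx by auto
  have v: "?G \<turnstile> Var 1 \<Colon> hProp i" "?G \<turnstile> Var 0 \<Colon> hProp i" using G by (auto simp: sub)
  have R: "isty ?G ?R" by (intro isty_Prod isty_Arr isty_El v)
  have PR: "inh ?G (is_prop ?R)"
    by (intro is_prop_Prod is_prop_Arr isty_Arr isty_El is_prop_El v)
  have F: "inh (?R # ?G) (Eq (hProp i) (Var 2) (Var 1))"
  proof -
    have c: "ctx (?R # ?G)" using R by simp
    have v: "?R # ?G \<turnstile> Var 2 \<Colon> hProp i" "?R # ?G \<turnstile> Var 1 \<Colon> hProp i" using c by (auto simp: sub)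
    note a = isty_Arr[OF isty_El[OF v(1)] isty_El[OF v(2)]] and a' = isty_Arr[OF isty_El[OF v(2)]
        isty_El[OF v(1)]]
    have R': "inh (?R # ?G) (Prod (Arr (El i (Var 2)) (El i (Var 1))) (Arr (El i (Var 1)) (El i (Var
        2))))"
      by (rule inhI[of _ "Var 0"]) (use c in \<open>auto simp: sub\<close>)
    show ?thesis
      by (rule hProp_path[OF v inh_Prod1[OF a a' R'] inh_Prod2[OF a a' R']])
  qed
  let ?H = "Eq (hProp i) (Var 1) (Var 0) # ?G"
  have H: "ctx ?H" using v G by auto
  have w: "?H \<turnstile> Var 2 \<Colon> hProp i" "?H \<turnstile> Var 1 \<Colon> hProp i" "?H \<turnstile> Var 0 \<Colon> Eq (hProp i) (Var 2) (Var 1)"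
    using H by (auto simp: sub)
  \<comment> \<open>Equal propositions are equivalent: the pair of identity implications is
    transported with its first proposition fixed.\<close>
  let ?B = "Prod (Arr (El i (Var 3)) (El i (Var 0))) (Arr (El i (Var 0)) (El i (Var 3)))"
  have "inh ?H (lift 1 ?R)"
  proof (rule inh_transport[OF _ _ w(1,2) inhI[OF w(3)]])
    have "ctx (hProp i # ?H)" using H by auto
    then have "hProp i # ?H \<turnstile> Var 3 \<Colon> hProp i" "hProp i # ?H \<turnstile> Var 0 \<Colon> hProp i"
      by (auto simp: sub)
    then show "isty (hProp i # ?H) ?B" by (intro isty_Prod isty_Arr isty_El)
    have "inh ?H (Prod (Arr (El i (Var 2)) (El i (Var 2))) (Arr (El i (Var 2)) (El i (Var 2))))"
      by (intro inh_Prod isty_Arr isty_El inh_Arr_id w)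
    then show "inh ?H (inst1 (Var 2) ?B)" by (simp add: sub)
  qed (use H in \<open>auto simp: sub\<close>)
  then show ?thesis
    using isty_hProp[OF ctx] R PR F s t p q
    by (intro set_from_relation[where R = ?R]) simp_all
qed

lemma hProp_is_set:
  assumes ctx: "ctx \<Gamma>"
  shows "inh \<Gamma> (is_trunc 2 (hProp i))"
proof (rule is_prop_trunc2)
  let ?G = "hProp i # hProp i # \<Gamma>"
  let ?E = "Eq (hProp i) (Var 1) (Var 0)"
  have G: "ctx ?G" using ctx by auto
  then have E: "isty ?G ?E" by (auto simp: sub)
  have "inh ?G (is_prop ?E)"
  proof (rule is_propI[OF E])
    let ?H = "lift 1 ?E # ?E # ?G"
    have c: "ctx ?H" using isty_lift[OF E E] by simp
    have "inh ?H (Eq (Eq (hProp i) (Var 3) (Var 2)) (Var 1) (Var 0))"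
      by (rule hProp_set[OF c]) (use c in \<open>auto simp: sub\<close>)
    then show "inh ?H (Eq (lift 2 ?E) (Var 1) (Var 0))" by (simp add: sub)
  qed
  then show "inh (lift 1 (hProp i) # hProp i # \<Gamma>) (is_prop (Eq (lift 2 (hProp i)) (Var 1) (Var 0)))"
    by (simp add: lift_subst)
qed (use ctx in auto)

section \<open>Recursion from a truncation into the propositions\<close>

lemma trunc_hProp_type:
  assumes "isty \<Gamma> A" and "Trunc k A # \<Gamma> \<turnstile> s \<Colon> is_trunc k (hProp j)" and "A # \<Gamma> \<turnstile> g \<Colon> hProp j"
    and "\<Gamma> \<turnstile> x \<Colon> Trunc k A"
  shows "\<Gamma> \<turnstile> IndTrunc k (hProp j) s g x \<Colon> hProp j"
proof -
  have "isty (Trunc k A # \<Gamma>) (hProp j)" using assms by (auto simp: isty_ctx)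
  then obtain i where i: "Trunc k A # \<Gamma> \<turnstile> hProp j \<Colon> U i" by (auto simp: isty_def)
  from trunc_elim[OF this assms(2) _ assms(4)] assms(3) show ?thesis
      by (simp add: inst1_subst repl_subst)
qed

lemma trunc_hProp_comp:
  assumes "isty \<Gamma> A" and "Trunc k A # \<Gamma> \<turnstile> s \<Colon> is_trunc k (hProp j)" and "A # \<Gamma> \<turnstile> g \<Colon> hProp j"
    and "\<Gamma> \<turnstile> a \<Colon> A"
  shows "\<Gamma> \<turnstile> IndTrunc k (hProp j) s g (Tr k a) \<doteq> inst1 a g \<Colon> hProp j"
proof -
  have "isty (Trunc k A # \<Gamma>) (hProp j)" using assms by (auto simp: isty_ctx)
  then obtain i where i: "Trunc k A # \<Gamma> \<turnstile> hProp j \<Colon> U i" by (auto simp: isty_def)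
  from trunc_comp[OF this assms(2) _ assms(4)] assms(3) show ?thesis
      by (simp add: inst1_subst repl_subst)
qed

text \<open>
  The map \<open>x \<mapsto> Q x\<close> into the set of propositions factors through the set truncation, where the
  path \<open>p\<close> lives.
\<close>

lemma connected_component:
  assumes A: "isty \<Gamma> A" and Q: "isty (A # \<Gamma>) Q" and P: "inh (A # \<Gamma>) (is_prop Q)"
    and a: "\<Gamma> \<turnstile> a \<Colon> A" and b: "\<Gamma> \<turnstile> b \<Colon> A"
    and p: "inh \<Gamma> (Eq (Trunc 2 A) (Tr 2 a) (Tr 2 b))" and q: "inh \<Gamma> (inst1 a Q)"
        and C: "inst1 b Q = C"
  shows "inh \<Gamma> C"
proof -
  note ctx = isty_ctx[OF A]
  obtain j where Qj: "A # \<Gamma> \<turnstile> Q \<Colon> U j" using Q by (auto simp: isty_def)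
  obtain h where h: "A # \<Gamma> \<turnstile> h \<Colon> is_prop Q" using P by (rule inhE)
  let ?T = "Trunc 2 A"
  have T: "isty \<Gamma> ?T" using A by auto
  obtain s where s: "?T # \<Gamma> \<turnstile> s \<Colon> is_trunc 2 (hProp j)"
    using hProp_is_set[of "?T # \<Gamma>" j] T by (auto simp: inh_def simp del: is_trunc.simps)
  have iv: "isty (U j # A # \<Gamma>) (is_prop (Var 0))" by (rule isty_is_prop_Var) (use A in simp)
  have iv0: "isty (U j # \<Gamma>) (is_prop (Var 0))" by (rule isty_is_prop_Var[OF ctx])
  have U: "isty \<Gamma> (U j)" using ctx by auto
  \<comment> \<open>A point of \<open>A\<close> goes to the proposition \<open>Q\<close> together
    with its proof of propositionality. Below, \<open>?E\<close> is the extension of this map to the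
    truncation and \<open>?E'\<close> the same extension weakened by one variable.\<close>
  let ?g = "Tuple Q h"
  have g: "A # \<Gamma> \<turnstile> ?g \<Colon> hProp j"
    unfolding hProp_def by (rule pair_type[OF iv Qj]) (use h in \<open>simp add: inst1_subst\<close>)
  let ?E = "IndTrunc 2 (hProp j) s ?g"
  have Ta: "\<Gamma> \<turnstile> Tr 2 a \<Colon> ?T" and Tb: "\<Gamma> \<turnstile> Tr 2 b \<Colon> ?T" using Tr_type[OF A] a b by auto
  note Ea = trunc_hProp_type[OF A s g Ta] and Eb = trunc_hProp_type[OF A s g Tb]
  let ?E' = "IndTrunc 2 (hProp j) (subst (scons (Var 0) (\<lambda>n. Var (n + 2))) s)
    (subst (scons (Var 0) (\<lambda>n. Var (n + 2))) ?g)"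
  have T1: "isty (?T # \<Gamma>) (lift 1 A)" by (rule isty_lift[OF A T])
  have E0: "?T # \<Gamma> \<turnstile> ?E' (Var 0) \<Colon> hProp j"
  proof (rule trunc_hProp_type[OF T1])
    show "Trunc 2 (lift 1 A) # ?T # \<Gamma> \<turnstile> subst (scons (Var 0) (\<lambda>n. Var (n + 2))) s \<Colon> is_trunc 2
        (hProp j)"
      by (rule subst_type[OF s]) (use T T1 ctx in \<open>auto simp: sub\<close>)
    show "lift 1 A # ?T # \<Gamma> \<turnstile> subst (scons (Var 0) (\<lambda>n. Var (n + 2))) ?g \<Colon> hProp j"
      by (rule subst_type[OF g]) (use T T1 ctx in \<open>auto simp: sub\<close>)
  qed (use T ctx in \<open>auto simp: sub\<close>)
  \<comment> \<open>The extended map applied to the path \<open>p\<close>.\<close>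
  have "inh \<Gamma> (Eq (hProp j) (?E (Tr 2 a)) (?E (Tr 2 b)))"
  proof (rule inh_transport[OF T _ Ta Tb p])
    let ?B = "Eq (hProp j) (lift 1 (?E (Tr 2 a))) (?E' (Var 0))"
    show "isty (?T # \<Gamma>) ?B"
      using weaken[OF Ea T] E0 T by (intro isty_Eq isty_hProp) (simp_all add: lift_subst)
    show "inh \<Gamma> (inst1 (Tr 2 a) ?B)"
      using inh_refl[OF _ Ea] isty_hProp[OF ctx] by (simp add: sub)
  qed (simp add: sub)
  \<comment> \<open>The extension agrees with \<open>?g\<close> on points, and the underlying type
    of \<open>?g\<close> is \<open>Q\<close>. Both computation rules are recorded as paths, to be
    composed into a route from \<open>Q\<close> at \<open>a\<close> to \<open>Q\<close> at
    \<open>b\<close>.\<close>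
  moreover have E_eq: "inh \<Gamma> (Eq (hProp j) (?E (Tr 2 x)) (inst1 x ?g))"
      and gx: "\<Gamma> \<turnstile> inst1 x ?g \<Colon> hProp j"
    and El_eq: "inh \<Gamma> (Eq (U j) (El j (inst1 x ?g)) (inst1 x Q))" and Qx: "\<Gamma> \<turnstile> inst1 x Q \<Colon> U j"
    if x: "\<Gamma> \<turnstile> x \<Colon> A" for x
  proof -
    show "inh \<Gamma> (Eq (hProp j) (?E (Tr 2 x)) (inst1 x ?g))"
      by (rule inh_Eq_conv[OF isty_hProp[OF ctx] trunc_hProp_type[OF A s g Tr_type[OF A x]]
          trunc_hProp_comp[OF A s g x]])
    show gx: "\<Gamma> \<turnstile> inst1 x ?g \<Colon> hProp j" unfolding inst1_subst
      by (rule subst_type[OF g]) (use x ctx in \<open>auto simp: sub\<close>)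
    show Qx: "\<Gamma> \<turnstile> inst1 x Q \<Colon> U j" unfolding inst1_subst
      by (rule subst_type[OF Qj]) (use x ctx in \<open>auto simp: sub\<close>)
    have hx: "\<Gamma> \<turnstile> inst1 x h \<Colon> inst1 (inst1 x Q) (is_prop (Var 0))" unfolding inst1_subst
      by (rule subst_type[OF h]) (use x ctx in \<open>auto simp: sub\<close>)
    show "inh \<Gamma> (Eq (U j) (El j (inst1 x ?g)) (inst1 x Q))"
      using inh_Eq_conv[OF U El_type[OF gx]] pr1_pair[OF U iv0 Qx hx] by (simp add: inst1_subst)
  qed
  ultimately have ge: "inh \<Gamma> (Eq (hProp j) (inst1 a ?g) (inst1 b ?g))"
    using isty_hProp[OF ctx, of j] Ea Eb a b by (blast intro: inh_trans inh_sym)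
  have U0: "isty (U j # \<Gamma>) (Var 0)" using ctx by (intro isty_U[of _ _ j] var_type) (auto simp: sub)
  have Ela: "inh \<Gamma> (El j (inst1 a ?g))"
    by (rule inh_transport[OF U U0 Qx[OF a] El_type[OF gx[OF a]] inh_sym[OF U El_type[OF gx[OF a]]
        Qx[OF a] El_eq[OF a]]])
      (use q in \<open>simp_all add: inst1_subst\<close>)
  have El0: "isty (hProp j # \<Gamma>) (El j (Var 0))"
    using ctx by (intro isty_El var_type) (auto simp: sub)
  have Elb: "inh \<Gamma> (El j (inst1 b ?g))"
    by (rule inh_transport[OF isty_hProp[OF ctx] El0 gx[OF a] gx[OF b] ge])
      (use Ela in \<open>simp_all add: inst1_subst\<close>)
  show ?thesis
    by (rule inh_transport[OF U U0 El_type[OF gx[OF b]] Qx[OF b] El_eq[OF b]])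
      (use Elb C in \<open>simp_all add: inst1_subst\<close>)
qed

text \<open>Surjectivity is given by an untruncated sum, so its first projection defines a right
  inverse g. Injectivity applied to f (g (f x)) = f x makes g a left inverse as well.\<close>

lemma inh_equiv_of_bij:
  assumes X: "isty \<Gamma> X" and Y: "isty \<Gamma> Y" and f: "\<Gamma> \<turnstile> f \<Colon> Arr X Y"
    and sur: "inh \<Gamma> (Pi Y (Sig (lift 1 X) (Eq (lift 2 Y) (App (lift 2 f) (Var 0)) (Var 1))))"
    and inj: "inh \<Gamma> (Pi X (Pi (lift 1 X) (Pi (Eq (lift 2 Y) (App (lift 2 f) (Var 1)) (App (lift 2 f)
        (Var 0)))
      (Eq (lift 3 X) (Var 2) (Var 1)))))"
  shows "inh \<Gamma> (equiv_type X Y)"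
proof -
  note ctx = isty_ctx[OF X]
  obtain s where s: "\<Gamma> \<turnstile> s \<Colon> Pi Y (Sig (lift 1 X) (Eq (lift 2 Y) (App (lift 2 f) (Var 0)) (Var 1)))"
    using sur by (rule inhE)
  let ?D = "Y # \<Gamma>"
  have X1: "isty ?D (lift 1 X)" and Y1: "isty ?D (lift 1 Y)"
      by (rule isty_lift[OF X Y], rule isty_lift[OF Y Y])
  have f1: "?D \<turnstile> lift 1 f \<Colon> Arr (lift 1 X) (lift 1 Y)" using weaken[OF f Y]
      by (simp add: lift_subst)
  have y: "?D \<turnstile> Var 0 \<Colon> lift 1 Y" using Y ctx by auto
  let ?S = "Eq (lift 2 Y) (App (lift 2 f) (Var 0)) (Var 1)"
  have f2: "lift 1 X # ?D \<turnstile> lift 2 f \<Colon> Arr (lift 2 X) (lift 2 Y)"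
    using weaken2[OF f, of "lift 1 X" Y] X1 by (simp add: lift_subst)
  have S: "isty (lift 1 X # ?D) ?S"
    using X1 Y1 isty_lift[OF Y1 X1] isty_lift[OF X1 X1] by (intro isty_Eq app_Arr[OF f2]) (auto
        simp: sub)
  have sy: "?D \<turnstile> App (lift 1 s) (Var 0) \<Colon> Sig (lift 1 X) ?S"
    by (rule app_type[OF _ y, of _ "Sig (lift 2 X) (Eq (lift 3 Y) (App (lift 3 f) (Var 0)) (Var
        1))"])
      (use weaken[OF s Y] in \<open>simp_all add: sub\<close>)
  let ?c = "pr1 (lift 1 X) (App (lift 1 s) (Var 0))"
  let ?g = "Lam Y ?c"
  have c: "?D \<turnstile> ?c \<Colon> lift 1 X" by (rule pr1_type[OF sy X1 S])
  have g: "\<Gamma> \<turnstile> ?g \<Colon> Arr Y X" unfolding Arr_def by (rule lam_type[OF Y c])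
  have g1: "?D \<turnstile> lift 1 ?g \<Colon> Arr (lift 1 Y) (lift 1 X)" using weaken[OF g Y]
      by (simp add: lift_subst)
  have gy: "?D \<turnstile> App (lift 1 ?g) (Var 0) \<doteq> ?c \<Colon> lift 1 X"
  proof -
    have "lift 1 Y # ?D \<turnstile> subst (scons (Var 0) (\<lambda>n. Var (n + 2))) ?c \<Colon> lift 2 X"
      by (rule subst_type[OF c]) (use Y1 Y ctx in \<open>auto simp: sub\<close>)
    from pi_comp[OF this y] show ?thesis by (simp add: sub)
  qed
  have fc: "inh ?D (Eq (lift 1 Y) (App (lift 1 f) ?c) (Var 0))"
    by (rule inh_pr2[OF X1 S sy]) (simp add: sub)
  have fg: "inh ?D (Eq (lift 1 Y) (App (lift 1 f) (App (lift 1 ?g) (Var 0))) (Var 0))"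
    by (rule inh_jeq[OF jeq_sym[OF gy] X1 c app_Arr[OF g1 y] S]) (use fc in \<open>simp_all add: sub\<close>)
  obtain h where h: "\<Gamma> \<turnstile> h \<Colon> Pi Y (Eq (lift 1 Y) (App (lift 1 f) (App (lift 1 ?g) (Var 0))) (Var
      0))"
    using inh_Pi[OF Y fg] by (rule inhE)
  let ?K = "X # \<Gamma>"
  have x: "?K \<turnstile> Var 0 \<Colon> lift 1 X" using X ctx by auto
  have fK: "?K \<turnstile> lift 1 f \<Colon> Arr (lift 1 X) (lift 1 Y)"
      and gK: "?K \<turnstile> lift 1 ?g \<Colon> Arr (lift 1 Y) (lift 1 X)"
    using weaken[OF f X] weaken[OF g X] by (simp_all add: lift_subst)
  have fx: "?K \<turnstile> App (lift 1 f) (Var 0) \<Colon> lift 1 Y" by (rule app_Arr[OF fK x])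
  have gfx: "?K \<turnstile> App (lift 1 ?g) (App (lift 1 f) (Var 0)) \<Colon> lift 1 X" by (rule app_Arr[OF gK fx])
  have "inh ?K (Eq (lift 1 Y) (App (lift 1 f) (App (lift 1 ?g) (App (lift 1 f) (Var 0)))) (App (lift
      1 f) (Var 0)))" (is "inh ?K ?E")
    by (rule inh_app[OF inh_lift[OF inhI[OF h] X, unfolded lift_subst subst.simps], of
        "App (lift 1 f) (Var 0)"])
      (use fx in \<open>simp_all add: sub\<close>)
  then obtain e where e: "?K \<turnstile> e \<Colon> ?E" by (rule inhE)
  have "inh ?K (Pi (lift 1 X) (Pi (lift 2 X) (Pi (Eq (lift 3 Y) (App (lift 3 f) (Var 1)) (App (lift
      3 f) (Var 0)))
      (Eq (lift 4 X) (Var 2) (Var 1)))))"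
    using inh_lift[OF inj X] by (simp add: sub)
  from inh_app[OF this gfx refl]
  have "inh ?K (Pi (lift 1 X) (Pi (Eq (lift 2 Y) (App (lift 2 f) (lift 1 (App (lift 1 ?g) (App (lift
      1 f) (Var 0))))) (App (lift 2 f) (Var 0)))
      (Eq (lift 3 X) (lift 2 (App (lift 1 ?g) (App (lift 1 f) (Var 0)))) (Var 1))))"
    by (simp add: sub)
  from inh_app[OF this x refl]
  have "inh ?K (Pi (Eq (lift 1 Y) (App (lift 1 f) (App (lift 1 ?g) (App (lift 1 f) (Var 0)))) (App
      (lift 1 f) (Var 0)))
      (Eq (lift 2 X) (lift 1 (App (lift 1 ?g) (App (lift 1 f) (Var 0)))) (Var 1)))"
    by (simp add: sub)
  from inh_app[OF this e refl]
  have "inh ?K (Eq (lift 1 X) (App (lift 1 ?g) (App (lift 1 f) (Var 0))) (Var 0))"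
    by (simp add: sub)
  from inh_Pi[OF X this]
  obtain k where k: "\<Gamma> \<turnstile> k \<Colon> Pi X (Eq (lift 1 X) (App (lift 1 ?g) (App (lift 1 f) (Var 0))) (Var
      0))"
    by (rule inhE)
  show ?thesis by (rule inhI[OF equivI[OF X Y f g h k]])
qed

section \<open>Braided loops\<close>

lemma subst_concat_path [simp]:
  "subst \<sigma> (concat_path A a b c p q) =
     concat_path (subst \<sigma> A) (subst \<sigma> a) (subst \<sigma> b) (subst \<sigma> c) (subst \<sigma> p) (subst \<sigma> q)"
  by (simp add: concat_path_def sub Arr_def)

lemma concat_motive:
  assumes A: "isty \<Gamma> A" and c: "\<Gamma> \<turnstile> c \<Colon> A"
  shows "isty (Eq (lift 2 A) (Var 1) (Var 0) # lift 1 A # A # \<Gamma>)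
    (Arr (Eq (lift 3 A) (Var 1) (lift 3 c)) (Eq (lift 3 A) (Var 2) (lift 3 c)))"
  using A isty_ctx[OF A] by (auto simp: sub intro!: subst_isty[OF A] subst_type[OF c])

lemma concat_base:
  assumes A: "isty \<Gamma> A" and c: "\<Gamma> \<turnstile> c \<Colon> A"
  shows "A # \<Gamma> \<turnstile> Lam (Eq (lift 1 A) (Var 0) (lift 1 c)) (Var 0) \<Colon>
    subst (scons (Refl (Var 0)) (scons (Var 0) Var))
      (Arr (Eq (lift 3 A) (Var 1) (lift 3 c)) (Eq (lift 3 A) (Var 2) (lift 3 c)))"
  using A isty_ctx[OF A] by (auto simp: sub Arr_def intro!: lam_type subst_isty[OF A] subst_type[OF
      c])

lemma concat_type:
  assumes A: "isty \<Gamma> A" and a: "\<Gamma> \<turnstile> a \<Colon> A" and b: "\<Gamma> \<turnstile> b \<Colon> A" and c: "\<Gamma> \<turnstile> c \<Colon> A"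
    and p: "\<Gamma> \<turnstile> p \<Colon> Eq A a b" and q: "\<Gamma> \<turnstile> q \<Colon> Eq A b c"
  shows "\<Gamma> \<turnstile> concat_path A a b c p q \<Colon> Eq A a c"
  unfolding concat_path_def
  by (rule app_Arr[OF ind_eq[OF concat_motive[OF A c] concat_base[OF A c] a b p] q])
    (simp add: sub Arr_def)

lemma concat_refl:
  assumes A: "isty \<Gamma> A" and a: "\<Gamma> \<turnstile> a \<Colon> A" and c: "\<Gamma> \<turnstile> c \<Colon> A" and q: "\<Gamma> \<turnstile> q \<Colon> Eq A a c"
  shows "\<Gamma> \<turnstile> concat_path A a a c (Refl a) q \<doteq> q \<Colon> Eq A a c"
proof -
  let ?C = "Arr (Eq (lift 3 A) (Var 1) (lift 3 c)) (Eq (lift 3 A) (Var 2) (lift 3 c))"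
  let ?b = "Lam (Eq (lift 1 A) (Var 0) (lift 1 c)) (Var 0)"
  obtain i where "Eq (lift 2 A) (Var 1) (Var 0) # lift 1 A # A # \<Gamma> \<turnstile> ?C \<Colon> U i"
    using concat_motive[OF A c] unfolding isty_def by blast
  from eq_comp[OF this concat_base[OF A c, unfolded scons_def] a]
  have "\<Gamma> \<turnstile> IndEq ?C ?b a a (Refl a) \<doteq> Lam (Eq A a c) (Var 0) \<Colon> Pi (Eq A a c) (lift 1 (Eq A a c))"
    by (simp add: sub Arr_def)
  from pi_elim_cong[OF this jeq_refl[OF q]]
  have "\<Gamma> \<turnstile> concat_path A a a c (Refl a) q \<doteq> App (Lam (Eq A a c) (Var 0)) q \<Colon> Eq A a c"
    by (simp add: concat_path_def sub)
  then show ?thesis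
    by (rule jeq_trans[OF _ beta_id[OF _ q]]) (use A a c in auto)
qed

text \<open>A separate constant, so that simplification does not unfold the nested
  \<open>is_trunc\<close> of a 1-type.\<close>

definition is_groupoid :: "tm \<Rightarrow> tm" where
  "is_groupoid A = is_1type A"

lemma subst_is_groupoid [simp]: "subst \<sigma> (is_groupoid A) = is_groupoid (subst \<sigma> A)"
  by (simp add: is_groupoid_def sub del: is_trunc.simps)

lemma subst_braided_loops [simp]: "subst \<sigma> (braided_loops A) = braided_loops (subst \<sigma> A)"
  by (simp add: braided_loops_def sub)

lemma isty_braided_loops:
  assumes A: "isty \<Gamma> A"
  shows "isty \<Gamma> (braided_loops A)"
proof -
  let ?E = "Eq (lift 2 A) (Var 1) (Var 1)"
  let ?D = "?E # Eq (lift 1 A) (Var 0) (Var 0) # A # \<Gamma>"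
  have E1: "isty (A # \<Gamma>) (Eq (lift 1 A) (Var 0) (Var 0))"
    using A isty_ctx[OF A] by (auto simp: sub intro!: subst_isty[OF A])
  then have E2: "isty (Eq (lift 1 A) (Var 0) (Var 0) # A # \<Gamma>) ?E"
    using A isty_ctx[OF A] by (auto simp: sub intro!: subst_isty[OF A])
  then have D: "ctx ?D" by simp
  have A3: "isty ?D (lift 3 A)" unfolding lift_subst by (rule subst_isty[OF A]) (use D
      in \<open>auto simp: sub\<close>)
  have a: "?D \<turnstile> Var 2 \<Colon> lift 3 A" and p: "?D \<turnstile> Var 1 \<Colon> Eq (lift 3 A) (Var 2) (Var 2)"
    and q: "?D \<turnstile> Var 0 \<Colon> Eq (lift 3 A) (Var 2) (Var 2)"
    using D by (auto simp: sub)
  show ?thesis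
    unfolding braided_loops_def
    by (intro isty_Pi A E1 E2 isty_Eq[OF isty_Eq[OF A3 a a] concat_type[OF A3 a a a p q]
        concat_type[OF A3 a a a q p]])
qed

text \<open>The form in which the assumption that \<open>A\<close> is a 1-type enters the later
  arguments.\<close>

lemma groupoid_is_prop:
  assumes A: "isty \<Gamma> A" and G: "inh \<Gamma> (is_groupoid A)" and a: "\<Gamma> \<turnstile> a \<Colon> A" and b: "\<Gamma> \<turnstile> b \<Colon> A"
    and u: "\<Gamma> \<turnstile> u \<Colon> Eq A a b" and v: "\<Gamma> \<turnstile> v \<Colon> Eq A a b"
  shows "inh \<Gamma> (is_prop (Eq (Eq A a b) u v))"
proof -
  have "inh \<Gamma> (Pi A (is_trunc 2 (Eq (lift 1 A) (lift 1 a) (Var 0))))"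
    by (rule inh_app[OF G[unfolded is_groupoid_def] a]) (simp add: sub del: is_trunc.simps)
  from inh_app[OF this b refl] have "inh \<Gamma> (is_trunc 2 (Eq A a b))"
    by (simp add: sub del: is_trunc.simps)
  from trunc2_is_prop[OF _ this u v] show ?thesis using A a b by auto
qed

lemma braided_app:
  assumes B: "inh \<Gamma> (braided_loops A)" and a: "\<Gamma> \<turnstile> a \<Colon> A" and p: "\<Gamma> \<turnstile> p \<Colon> Eq A a a"
      and q: "\<Gamma> \<turnstile> q \<Colon> Eq A a a"
  shows "inh \<Gamma> (Eq (Eq A a a) (concat_path A a a a p q) (concat_path A a a a q p))"
proof -
  let ?c = "\<lambda>k x y. concat_path (lift k A) (lift k a) (lift k a) (lift k a) x y"
  have "inh \<Gamma> (Pi (Eq A a a) (Pi (Eq (lift 1 A) (lift 1 a) (lift 1 a))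
      (Eq (Eq (lift 2 A) (lift 2 a) (lift 2 a)) (?c 2 (Var 1) (Var 0)) (?c 2 (Var 0) (Var 1)))))"
    by (rule inh_app[OF B[unfolded braided_loops_def] a]) (simp add: sub)
  from inh_app[OF this p refl]
  have "inh \<Gamma> (Pi (Eq A a a) (Eq (Eq (lift 1 A) (lift 1 a) (lift 1 a)) (?c 1 (lift 1 p) (Var 0))
      (?c 1 (Var 0) (lift 1 p))))"
    by (simp add: sub)
  from inh_app[OF this q refl] show ?thesis by (simp add: sub)
qed

text \<open>For loops the right unit law is the braiding with the trivial loop, so no path induction is needed.\<close>

lemma concat_refl_right:
  assumes A: "isty \<Gamma> A" and B: "inh \<Gamma> (braided_loops A)" and a: "\<Gamma> \<turnstile> a \<Colon> A"
      and l: "\<Gamma> \<turnstile> l \<Colon> Eq A a a"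
  shows "inh \<Gamma> (Eq (Eq A a a) (concat_path A a a a l (Refl a)) l)"
proof -
  note r = refl_type[OF A a]
  have E: "isty \<Gamma> (Eq A a a)" using A a by auto
  note c = concat_type[OF A a a a l r] and c' = concat_type[OF A a a a r l]
  show ?thesis
    by (rule inh_trans[OF E c c' l braided_app[OF B a l r] inh_Eq_conv[OF E c' concat_refl[OF A a a
        l]]])
qed

text \<open>
  The loops \<open>y\<close> at \<open>b\<close> such that \<open>l \<cdot> r = r \<cdot> y\<close> for all \<open>r : a = b\<close>.
\<close>

definition conjugate_rel :: "tm \<Rightarrow> tm \<Rightarrow> tm \<Rightarrow> tm \<Rightarrow> tm" where
  "conjugate_rel A a b l = Pi (Eq (lift 1 A) (lift 1 a) (lift 1 b))
     (Eq (Eq (lift 2 A) (lift 2 a) (lift 2 b))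
       (concat_path (lift 2 A) (lift 2 a) (lift 2 a) (lift 2 b) (lift 2 l) (Var 0))
       (concat_path (lift 2 A) (lift 2 a) (lift 2 b) (lift 2 b) (Var 0) (Var 1)))"

definition conjugate :: "tm \<Rightarrow> tm \<Rightarrow> tm \<Rightarrow> tm \<Rightarrow> tm" where
  "conjugate A a b l = Sig (Eq A b b) (conjugate_rel A a b l)"

lemma subst_conjugate [simp]:
  "subst \<sigma> (conjugate A a b l) = conjugate (subst \<sigma> A) (subst \<sigma> a) (subst \<sigma> b) (subst \<sigma> l)"
  by (simp add: conjugate_def conjugate_rel_def sub)

context
  fixes \<Gamma> A a b l
  assumes A: "isty \<Gamma> A" and a: "\<Gamma> \<turnstile> a \<Colon> A" and b: "\<Gamma> \<turnstile> b \<Colon> A" and l: "\<Gamma> \<turnstile> l \<Colon> Eq A a a"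
begin

lemma conjugate_rel_types:
  shows "isty (Eq A b b # \<Gamma>) (Eq (lift 1 A) (lift 1 a) (lift 1 b))" (is "isty ?D ?E")
    and "isty (Eq (lift 1 A) (lift 1 a) (lift 1 b) # Eq A b b # \<Gamma>) (lift 2 A)"
    and "Eq (lift 1 A) (lift 1 a) (lift 1 b) # Eq A b b # \<Gamma> \<turnstile> lift 2 a \<Colon> lift 2 A"
    and "Eq (lift 1 A) (lift 1 a) (lift 1 b) # Eq A b b # \<Gamma> \<turnstile> lift 2 b \<Colon> lift 2 A"
    and "Eq (lift 1 A) (lift 1 a) (lift 1 b) # Eq A b b # \<Gamma> \<turnstile>
      concat_path (lift 2 A) (lift 2 a) (lift 2 a) (lift 2 b) (lift 2 l) (Var 0) \<Colon> Eq (lift 2 A)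
          (lift 2 a) (lift 2 b)"
    and "Eq (lift 1 A) (lift 1 a) (lift 1 b) # Eq A b b # \<Gamma> \<turnstile>
      concat_path (lift 2 A) (lift 2 a) (lift 2 b) (lift 2 b) (Var 0) (Var 1) \<Colon> Eq (lift 2 A) (lift
          2 a) (lift 2 b)"
proof -
  note [intro!] = subst_isty[OF A] subst_type[OF a] subst_type[OF b] subst_type[OF l]
  show E: "isty ?D ?E" using A b isty_ctx[OF A] by (auto simp: sub)
  then have c: "ctx (?E # ?D)" by simp
  show A2: "isty (?E # ?D) (lift 2 A)" and a2: "?E # ?D \<turnstile> lift 2 a \<Colon> lift 2 A"
      and b2: "?E # ?D \<turnstile> lift 2 b \<Colon> lift 2 A"
    using c by (auto simp: sub)
  have "?E # ?D \<turnstile> lift 2 l \<Colon> Eq (lift 2 A) (lift 2 a) (lift 2 a)" "?E # ?D \<turnstile> Var 0 \<Colon> Eq (lift 2 A)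
      (lift 2 a) (lift 2 b)"
    "?E # ?D \<turnstile> Var 1 \<Colon> Eq (lift 2 A) (lift 2 b) (lift 2 b)"
    using c by (auto simp: sub)
  then show "?E # ?D \<turnstile> concat_path (lift 2 A) (lift 2 a) (lift 2 a) (lift 2 b) (lift 2 l) (Var 0) \<Colon>
      Eq (lift 2 A) (lift 2 a) (lift 2 b)"
    and "?E # ?D \<turnstile> concat_path (lift 2 A) (lift 2 a) (lift 2 b) (lift 2 b) (Var 0) (Var 1) \<Colon> Eq
        (lift 2 A) (lift 2 a) (lift 2 b)"
    using A2 a2 b2 by (blast intro: concat_type)+
qed

lemma isty_conjugate_rel: "isty (Eq A b b # \<Gamma>) (conjugate_rel A a b l)"
  unfolding conjugate_rel_def by (intro isty_Pi isty_Eq conjugate_rel_types)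

lemma isty_loop: "isty \<Gamma> (Eq A b b)"
  using A b by auto

lemma isty_conjugate: "isty \<Gamma> (conjugate A a b l)"
  unfolding conjugate_def by (intro isty_Sig isty_conjugate_rel isty_loop)

lemma is_prop_conjugate_rel:
  assumes G: "inh \<Gamma> (is_groupoid A)"
  shows "inh (Eq A b b # \<Gamma>) (is_prop (conjugate_rel A a b l))"
proof -
  have "ctx (Eq (lift 1 A) (lift 1 a) (lift 1 b) # Eq A b b # \<Gamma>)"
    using conjugate_rel_types(1) by simp
  from inh_lift2[OF G this]
  have "inh (Eq (lift 1 A) (lift 1 a) (lift 1 b) # Eq A b b # \<Gamma>) (is_groupoid (lift 2 A))"
    by (simp add: lift_subst)
  from is_prop_Pi[OF conjugate_rel_types(1) _ groupoid_is_prop[OF conjugate_rel_types(2) this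
      conjugate_rel_types(3-6)]]
  show ?thesis
    unfolding conjugate_rel_def using conjugate_rel_types by blast
qed

end

text \<open>At the trivial path the relation reads l . refl = refl . y. The right side computes to
  y, and the left side equals l by the braiding.\<close>

lemma conjugate_centre:
  assumes A: "isty \<Gamma> A" and B: "inh \<Gamma> (braided_loops A)" and a: "\<Gamma> \<turnstile> a \<Colon> A"
      and l: "\<Gamma> \<turnstile> l \<Colon> Eq A a a"
    and s: "\<Gamma> \<turnstile> s \<Colon> conjugate A a a l"
  shows "inh \<Gamma> (Eq (Eq A a a) l (pr1 (Eq A a a) s))"
proof -
  let ?y = "pr1 (Eq A a a) s"
  note E = isty_loop[OF A a a l] and R = isty_conjugate_rel[OF A a a l]
  note s' = s[unfolded conjugate_def]
  note y = pr1_type[OF s' E R]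
  have "inh \<Gamma> (Pi (Eq A a a) (Eq (Eq (lift 1 A) (lift 1 a) (lift 1 a))
       (concat_path (lift 1 A) (lift 1 a) (lift 1 a) (lift 1 a) (lift 1 l) (Var 0))
       (concat_path (lift 1 A) (lift 1 a) (lift 1 a) (lift 1 a) (Var 0) (lift 1 ?y))))"
    by (rule inh_pr2[OF E R s']) (simp add: conjugate_rel_def sub)
  from inh_app[OF this refl_type[OF A a] refl]
  have 1: "inh \<Gamma> (Eq (Eq A a a) (concat_path A a a a l (Refl a)) (concat_path A a a a (Refl a) ?y))"
    by (simp add: sub)
  note r = refl_type[OF A a]
  note c = concat_type[OF A a a a l r] and c' = concat_type[OF A a a a r y]
  have "inh \<Gamma> (Eq (Eq A a a) (concat_path A a a a l (Refl a)) ?y)"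
    by (rule inh_trans[OF E c c' y 1 inh_Eq_conv[OF E c' concat_refl[OF A a a y]]])
  then show ?thesis
    by (rule inh_trans[OF E l c y inh_sym[OF E c l concat_refl_right[OF A B a l]]])
qed

text \<open>Both first components equal \<open>l\<close>, and the relation attached to them is a
  proposition.\<close>

lemma conjugate_path:
  assumes A: "isty \<Gamma> A" and G: "inh \<Gamma> (is_groupoid A)" and B: "inh \<Gamma> (braided_loops A)"
    and a: "\<Gamma> \<turnstile> a \<Colon> A" and l: "\<Gamma> \<turnstile> l \<Colon> Eq A a a"
    and s: "\<Gamma> \<turnstile> s \<Colon> conjugate A a a l" and t: "\<Gamma> \<turnstile> t \<Colon> conjugate A a a l"
  shows "inh \<Gamma> (Eq (conjugate A a a l) s t)"
proof -
  note E = isty_loop[OF A a a l] and R = isty_conjugate_rel[OF A a a l]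
  note s' = s[unfolded conjugate_def] and t' = t[unfolded conjugate_def]
  note ps = pr1_type[OF s' E R] and pt = pr1_type[OF t' E R]
  have "inh \<Gamma> (Eq (Eq A a a) (pr1 (Eq A a a) s) (pr1 (Eq A a a) t))"
    by (rule inh_trans[OF E ps l pt inh_sym[OF E l ps conjugate_centre[OF A B a l s]]
        conjugate_centre[OF A B a l t]])
  from sig_path_pr1[OF E R is_prop_conjugate_rel[OF A a a l G] s' t' this]
  show ?thesis unfolding conjugate_def .
qed

text \<open>The centre is \<open>l\<close> itself: the relation it has to satisfy, l . r = r . l for
  all loops r, is an instance of the braiding.\<close>

lemma contr_conjugate:
  assumes A: "isty \<Gamma> A" and G: "inh \<Gamma> (is_groupoid A)" and B: "inh \<Gamma> (braided_loops A)"
    and a: "\<Gamma> \<turnstile> a \<Colon> A" and l: "\<Gamma> \<turnstile> l \<Colon> Eq A a a"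
  shows "inh \<Gamma> (is_trunc 0 (conjugate A a a l))"
proof -
  note E = isty_loop[OF A a a l] and R = isty_conjugate_rel[OF A a a l]
      and C = isty_conjugate[OF A a a l]
  let ?D = "Eq A a a # \<Gamma>" and ?C = "conjugate A a a l"
  have "inh ?D (Eq (Eq (lift 1 A) (lift 1 a) (lift 1 a))
       (concat_path (lift 1 A) (lift 1 a) (lift 1 a) (lift 1 a) (lift 1 l) (Var 0))
       (concat_path (lift 1 A) (lift 1 a) (lift 1 a) (lift 1 a) (Var 0) (lift 1 l)))"
    by (rule braided_app)
      (use inh_lift[OF B E] weaken[OF a E] weaken[OF l E] E isty_ctx[OF A]
          in \<open>auto simp: lift_subst\<close>)
  from inh_Pi[OF E this] have "inh \<Gamma> (inst1 l (conjugate_rel A a a l))"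
    by (simp add: conjugate_rel_def sub)
  then obtain k where k: "\<Gamma> \<turnstile> k \<Colon> inst1 l (conjugate_rel A a a l)" by (rule inhE)
  let ?c = "Tuple l k"
  have c: "\<Gamma> \<turnstile> ?c \<Colon> ?C" unfolding conjugate_def by (rule pair_type[OF R l k])
  have "inh (?C # \<Gamma>) (Eq (conjugate (lift 1 A) (lift 1 a) (lift 1 a) (lift 1 l)) (lift 1 ?c) (Var
      0))"
    by (rule conjugate_path)
      (use isty_lift[OF A C] inh_lift[OF G C] inh_lift[OF B C] weaken[OF a C] weaken[OF l C]
          weaken[OF c C] C isty_ctx[OF A]
       in \<open>auto simp: lift_subst\<close>)
  then have "inh \<Gamma> (Pi ?C (Eq (lift 1 ?C) (lift 1 ?c) (Var 0)))"
    by (intro inh_Pi[OF C]) (simp add: sub)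
  moreover have "isty (?C # \<Gamma>) (Pi (lift 1 ?C) (Eq (lift 2 ?C) (Var 1) (Var 0)))"
    by (rule isty_contr_tail[OF C])
  ultimately show ?thesis
    unfolding is_trunc.simps by (intro inh_pair[OF _ c]) (simp_all add: sub)
qed

text \<open>
  The family \<open>A\<^sub>1\<close>: functions assigning to each \<open>b : A\<close> with \<open>x = |b|\<close> a loop at \<open>b\<close>.
\<close>

definition loop_family :: "tm \<Rightarrow> tm \<Rightarrow> tm" where
  "loop_family A x = Pi A (Pi (Eq (Trunc 2 (lift 1 A)) (lift 1 x) (Tr 2 (Var 0))) (Eq (lift 2 A)
      (Var 1) (Var 1)))"

lemma subst_loop_family [simp]: "subst \<sigma> (loop_family A x) = loop_family (subst \<sigma> A) (subst \<sigma> x)"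
  by (simp add: loop_family_def sub)

section \<open>Evaluation at the base point is an equivalence\<close>

definition eval_refl :: "tm \<Rightarrow> tm \<Rightarrow> tm" where
  "eval_refl a f = App (App f a) (Refl (Tr 2 a))"

lemma subst_eval_refl [simp]: "subst \<sigma> (eval_refl a f) = eval_refl (subst \<sigma> a) (subst \<sigma> f)"
  by (simp add: eval_refl_def)

text \<open>Truncation does not raise the universe level, and neither do products over
  \<open>A\<close> or over paths in its truncation. Hence the family lands in the universe
  \<open>U i\<close> of \<open>A\<close>, as representability demands.\<close>

lemma loop_family_type:
  assumes A: "\<Gamma> \<turnstile> A \<Colon> U i" and x: "\<Gamma> \<turnstile> x \<Colon> Trunc 2 A"
  shows "\<Gamma> \<turnstile> loop_family A x \<Colon> U i"
proof -
  note ctx = ctx_of_judgement(2)[OF A] and A' = isty_U[OF A]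
  let ?D = "A # \<Gamma>"
  let ?E = "Eq (Trunc 2 (lift 1 A)) (lift 1 x) (Tr 2 (Var 0))"
  have A1: "?D \<turnstile> lift 1 A \<Colon> U i" using weaken[OF A A'] by (simp add: lift_subst)
  have x1: "?D \<turnstile> lift 1 x \<Colon> Trunc 2 (lift 1 A)" using weaken[OF x A'] by (simp add: lift_subst)
  have v: "?D \<turnstile> Var 0 \<Colon> lift 1 A" using A' by auto
  have E: "?D \<turnstile> ?E \<Colon> U i" by (rule eq_form[OF trunc_form[OF A1] x1 trunc_intro[OF A1 v]])
  have c: "ctx (?E # ?D)" using isty_U[OF E] by simp
  have A2: "?E # ?D \<turnstile> lift 2 A \<Colon> U i" using weaken2[OF A c] by (simp add: lift_subst)
  have w: "?E # ?D \<turnstile> Var 1 \<Colon> lift 2 A" using c by (auto simp: sub)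
  show ?thesis unfolding loop_family_def by (rule pi_form[OF A pi_form[OF E eq_form[OF A2 w w]]])
qed

lemma isty_loop_family:
  assumes A: "isty \<Gamma> A" and x: "\<Gamma> \<turnstile> x \<Colon> Trunc 2 A"
  shows "isty \<Gamma> (loop_family A x)"
  using loop_family_type[OF _ x] A unfolding isty_def by blast

lemma isty_loop_family_path:
  assumes A: "isty \<Gamma> A" and x: "\<Gamma> \<turnstile> x \<Colon> Trunc 2 A"
  shows "isty (A # \<Gamma>) (Eq (Trunc 2 (lift 1 A)) (lift 1 x) (Tr 2 (Var 0)))"
  using isty_lift[OF A A] weaken[OF x A] A isty_ctx[OF A]
  by (intro isty_Eq isty_Trunc Tr_type) (auto simp: lift_subst)

lemma loop_family_app:
  assumes f: "\<Gamma> \<turnstile> f \<Colon> loop_family A x" and b: "\<Gamma> \<turnstile> b \<Colon> A" and p: "\<Gamma> \<turnstile> p \<Colon> Eq (Trunc 2 A) x (Tr 2 b)"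
  shows "\<Gamma> \<turnstile> App (App f b) p \<Colon> Eq A b b"
proof -
  have "\<Gamma> \<turnstile> App f b \<Colon> Pi (Eq (Trunc 2 A) x (Tr 2 b)) (Eq (lift 1 A) (lift 1 b) (lift 1 b))"
    by (rule app_type[OF f[unfolded loop_family_def] b]) (simp add: sub)
  then show ?thesis by (rule app_type[OF _ p]) (simp add: sub)
qed

lemma eval_refl_type:
  assumes A: "isty \<Gamma> A" and a: "\<Gamma> \<turnstile> a \<Colon> A" and f: "\<Gamma> \<turnstile> f \<Colon> loop_family A (Tr 2 a)"
  shows "\<Gamma> \<turnstile> eval_refl a f \<Colon> Eq A a a"
  unfolding eval_refl_def by (rule loop_family_app[OF f a]) (use A a
      in \<open>auto intro!: refl_type Tr_type\<close>)

lemma eval_refl_surj: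
  assumes A: "isty \<Gamma> A" and G: "inh \<Gamma> (is_groupoid A)" and B: "inh \<Gamma> (braided_loops A)"
    and a: "\<Gamma> \<turnstile> a \<Colon> A" and l: "\<Gamma> \<turnstile> l \<Colon> Eq A a a"
  obtains f where "\<Gamma> \<turnstile> f \<Colon> loop_family A (Tr 2 a)" "inh \<Gamma> (Eq (Eq A a a) (eval_refl a f) l)"
proof -
  note ctx = isty_ctx[OF A]
  note ta = Tr_type[OF A a, of 2]
  let ?P = "Eq (Trunc 2 (lift 1 A)) (Tr 2 (lift 1 a)) (Tr 2 (Var 0))"
  let ?D = "?P # A # \<Gamma>"
  have P: "isty (A # \<Gamma>) ?P" using isty_loop_family_path[OF A ta] by (simp add: lift_subst)
  then have D: "ctx ?D" by simp
  have A2: "isty ?D (lift 2 A)" unfolding lift_subst by (rule subst_isty[OF A]) (use D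
      in \<open>auto simp: sub\<close>)
  have a2: "?D \<turnstile> lift 2 a \<Colon> lift 2 A" and l2: "?D \<turnstile> lift 2 l \<Colon> Eq (lift 2 A) (lift 2 a) (lift 2 a)"
    and G2: "inh ?D (is_groupoid (lift 2 A))" and B2: "inh ?D (braided_loops (lift 2 A))"
    using weaken2[OF a D] weaken2[OF l D] inh_lift2[OF G D] inh_lift2[OF B D]
        by (simp_all add: lift_subst)
  have b2: "?D \<turnstile> Var 1 \<Colon> lift 2 A" and p2: "?D \<turnstile> Var 0 \<Colon> Eq (Trunc 2 (lift 2 A)) (Tr 2 (lift 2 a))
      (Tr 2 (Var 1))"
    using D by (auto simp: sub)
  \<comment> \<open>The conjugates of \<open>l\<close> at a variable end point, in the context of a
    point b and a path from |a| to |b|: the family whose contractibility is moved from a to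
    b.\<close>
  let ?C = "conjugate (lift 3 A) (lift 3 a) (Var 0) (lift 3 l)"
  have C3: "isty (lift 2 A # ?D) ?C"
    by (rule isty_conjugate)
      (use isty_lift[OF A2 A2] weaken[OF a2 A2] weaken[OF l2 A2] A2 D in \<open>auto simp: sub\<close>)
  have C2: "isty ?D (conjugate (lift 2 A) (lift 2 a) (Var 1) (lift 2 l))"
    by (rule isty_conjugate[OF A2 a2 b2 l2])
  have "inh ?D (is_trunc 0 (conjugate (lift 2 A) (lift 2 a) (Var 1) (lift 2 l)))"
  proof (rule connected_component[OF A2 _ is_prop_is_contr[OF C3] a2 b2 inhI[OF p2]])
    show "isty (lift 2 A # ?D) (is_trunc 0 ?C)"
      using isty_contr_tail[OF C3] C3 by auto
    show "inh ?D (inst1 (lift 2 a) (is_trunc 0 ?C))"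
      using contr_conjugate[OF A2 G2 B2 a2 l2] by (simp add: sub del: is_trunc.simps)
  qed (simp add: sub del: is_trunc.simps)
  from inh_pr1[OF this[unfolded is_trunc.simps] C2 isty_contr_tail[OF C2]]
  obtain s where s: "?D \<turnstile> s \<Colon> conjugate (lift 2 A) (lift 2 a) (Var 1) (lift 2 l)" by (rule inhE)
  let ?c = "pr1 (Eq (lift 2 A) (Var 1) (Var 1)) s"
  have c: "?D \<turnstile> ?c \<Colon> Eq (lift 2 A) (Var 1) (Var 1)"
    by (rule pr1_type[OF s[unfolded conjugate_def] isty_loop[OF A2 a2 b2 l2] isty_conjugate_rel[OF
        A2 a2 b2 l2]])
  let ?f = "Lam A (Lam ?P ?c)"
  have f1: "A # \<Gamma> \<turnstile> Lam ?P ?c \<Colon> Pi ?P (Eq (lift 2 A) (Var 1) (Var 1))"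
    by (rule lam_type[OF P c])
  have f: "\<Gamma> \<turnstile> ?f \<Colon> loop_family A (Tr 2 a)"
    using lam_type[OF A f1] by (simp add: loop_family_def lift_subst)
  let ?Pa = "Eq (Trunc 2 A) (Tr 2 a) (Tr 2 a)"
  have r: "\<Gamma> \<turnstile> Refl (Tr 2 a) \<Colon> ?Pa" using A ta by (intro refl_type) auto
  let ?\<tau> = "scons (Var 0) (scons (lift 1 a) (\<lambda>n. Var (n + 1)))"
  have Pa: "isty \<Gamma> ?Pa" using A ta by auto
  have c1: "?Pa # \<Gamma> \<turnstile> subst ?\<tau> ?c \<Colon> Eq (lift 1 A) (lift 1 a) (lift 1 a)"
    by (rule subst_type[OF c]) (use Pa ctx weaken[OF a Pa] in \<open>auto simp: sub\<close>)
  have "\<Gamma> \<turnstile> App ?f a \<doteq> Lam ?Pa (subst ?\<tau> ?c) \<Colon> Pi ?Pa (Eq (lift 1 A) (lift 1 a) (lift 1 a))"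
    using pi_comp[OF f1 a] by (simp add: sub)
  from pi_elim_cong[OF this jeq_refl[OF r]]
  have "\<Gamma> \<turnstile> eval_refl a ?f \<doteq> App (Lam ?Pa (subst ?\<tau> ?c)) (Refl (Tr 2 a)) \<Colon> Eq A a a"
    by (simp add: eval_refl_def sub)
  \<comment> \<open>At \<open>a\<close> and reflexivity the chosen conjugate \<open>s\<close>
    specialises to an unknown point \<open>?s\<close> of the conjugates at \<open>a\<close>. By
    \<open>conjugate_centre\<close> its first component equals \<open>l\<close> whichever point it
    is.\<close>
  moreover let ?s = "inst2 a (Refl (Tr 2 a)) s"
  have "\<Gamma> \<turnstile> App (Lam ?Pa (subst ?\<tau> ?c)) (Refl (Tr 2 a)) \<doteq> pr1 (Eq A a a) ?s \<Colon> Eq A a a"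
    using pi_comp[OF c1 r] by (simp add: sub)
  ultimately have j: "\<Gamma> \<turnstile> eval_refl a ?f \<doteq> pr1 (Eq A a a) ?s \<Colon> Eq A a a" by (rule jeq_trans)
  have s': "\<Gamma> \<turnstile> ?s \<Colon> conjugate A a a l" unfolding inst2_subst
    by (rule subst_type[OF s]) (use a r ctx in \<open>auto simp: sub\<close>)
  note E = isty_loop[OF A a a l]
  note y = pr1_type[OF s'[unfolded conjugate_def] E isty_conjugate_rel[OF A a a l]]
  note e = eval_refl_type[OF A a f]
  have "inh \<Gamma> (Eq (Eq A a a) (eval_refl a ?f) l)"
    by (rule inh_trans[OF E e y l inh_Eq_conv[OF E e j] inh_sym[OF E l y conjugate_centre[OF A B a l
        s']]])
  with f show thesis by (rule that)
qed

lemma loop_family_path_at: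
  assumes A: "isty \<Gamma> A" and G: "inh \<Gamma> (is_groupoid A)" and a: "\<Gamma> \<turnstile> a \<Colon> A"
    and f: "\<Gamma> \<turnstile> f \<Colon> loop_family A (Tr 2 a)" and g: "\<Gamma> \<turnstile> g \<Colon> loop_family A (Tr 2 a)"
    and e: "inh \<Gamma> (Eq (Eq A a a) (eval_refl a f) (eval_refl a g))"
    and b: "\<Gamma> \<turnstile> b \<Colon> A" and p: "\<Gamma> \<turnstile> p \<Colon> Eq (Trunc 2 A) (Tr 2 a) (Tr 2 b)"
  shows "inh \<Gamma> (Eq (Eq A b b) (App (App f b) p) (App (App g b) p))"
proof -
  note ctx = isty_ctx[OF A]
  note ta = Tr_type[OF A a, of 2]
  let ?P = "Eq (Trunc 2 (lift 1 A)) (Tr 2 (lift 1 a)) (Tr 2 (Var 0))"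
  let ?D = "?P # A # \<Gamma>"
  have P: "isty (A # \<Gamma>) ?P" using isty_loop_family_path[OF A ta] by (simp add: lift_subst)
  then have D: "ctx ?D" by simp
  have A2: "isty ?D (lift 2 A)" unfolding lift_subst by (rule subst_isty[OF A]) (use D
      in \<open>auto simp: sub\<close>)
  have G2: "inh ?D (is_groupoid (lift 2 A))" using inh_lift2[OF G D] by (simp add: lift_subst)
  have b2: "?D \<turnstile> Var 1 \<Colon> lift 2 A" and p2: "?D \<turnstile> Var 0 \<Colon> Eq (Trunc 2 (lift 2 A)) (Tr 2 (lift 2 a))
      (Tr 2 (Var 1))"
    using D by (auto simp: sub)
  have f2: "?D \<turnstile> lift 2 f \<Colon> loop_family (lift 2 A) (Tr 2 (lift 2 a))"
      and g2: "?D \<turnstile> lift 2 g \<Colon> loop_family (lift 2 A) (Tr 2 (lift 2 a))"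
    using weaken2[OF f D] weaken2[OF g D] by (simp_all add: lift_subst)
  let ?u = "App (App (lift 2 f) (Var 1)) (Var 0)" and ?v = "App (App (lift 2 g) (Var 1)) (Var 0)"
  have u: "?D \<turnstile> ?u \<Colon> Eq (lift 2 A) (Var 1) (Var 1)" and v: "?D \<turnstile> ?v \<Colon> Eq (lift 2 A) (Var 1) (Var 1)"
    by (rule loop_family_app[OF f2 b2 p2], rule loop_family_app[OF g2 b2 p2])
  let ?E = "Eq (Eq (lift 2 A) (Var 1) (Var 1)) ?u ?v"
  have E: "isty ?D ?E" using A2 b2 u v by blast
  \<comment> \<open>Quantifying over the path turns the claim into a family over \<open>A\<close>,
    the form that \<open>connected_component\<close> handles; the given \<open>p\<close> is inserted
    at the end.\<close>
  let ?Q = "Pi ?P ?E"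
  have Q: "isty (A # \<Gamma>) ?Q" using P E by blast
  have PQ: "inh (A # \<Gamma>) (is_prop ?Q)"
    by (rule is_prop_Pi[OF P E groupoid_is_prop[OF A2 G2 b2 b2 u v]])
  let ?T = "Trunc 2 A" and ?Pa = "Eq (Trunc 2 A) (Tr 2 a) (Tr 2 a)"
  have T: "isty \<Gamma> ?T" and Pa: "isty \<Gamma> ?Pa" using A ta by auto
  have r: "\<Gamma> \<turnstile> Refl (Tr 2 a) \<Colon> ?Pa" by (rule refl_type[OF T ta])
  have "inh \<Gamma> (is_trunc 2 ?T)"
    using A unfolding isty_def by (blast intro: inhI trunc_is_trunc)
  from inh_lift[OF trunc2_is_prop[OF T this ta ta] Pa]
  have "inh (?Pa # \<Gamma>) (is_prop (lift 1 ?Pa))" by (simp add: lift_subst)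
  \<comment> \<open>The truncation is a set, so every path from |a| to itself equals reflexivity.
    Hence the family at \<open>a\<close> reduces to the assumption \<open>e\<close>.\<close>
  then have rp: "inh (?Pa # \<Gamma>) (Eq (lift 1 ?Pa) (lift 1 (Refl (Tr 2 a))) (Var 0))"
    by (rule is_prop_app) (use weaken[OF r Pa] Pa ctx in auto)
  let ?B = "subst (scons (Var 0) (scons (lift 2 a) (\<lambda>n. Var (n + 2)))) ?E"
  have Pa1: "isty (?Pa # \<Gamma>) (lift 1 ?Pa)" by (rule isty_lift[OF Pa Pa])
  then have c: "ctx (lift 1 ?Pa # ?Pa # \<Gamma>)" by simp
  have B: "isty (lift 1 ?Pa # ?Pa # \<Gamma>) ?B"
    by (rule subst_isty[OF E]) (use c weaken2[OF a c] in \<open>auto simp: sub\<close>)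
  have "inh (?Pa # \<Gamma>) (subst (scons (Var 0) (scons (lift 1 a) (\<lambda>n. Var (n + 1)))) ?E)"
    by (rule inh_transport[OF Pa1 B _ _ rp])
      (use weaken[OF r Pa] Pa ctx inh_lift[OF e Pa] in \<open>auto simp: sub eval_refl_def\<close>)
  from inh_Pi[OF Pa this] have q: "inh \<Gamma> (inst1 a ?Q)" by (simp add: sub)
  have "inh \<Gamma> (inst1 b ?Q)"
    by (rule connected_component[OF A Q PQ a b inhI[OF p] q refl])
  then have "inh \<Gamma> (Pi (Eq (Trunc 2 A) (Tr 2 a) (Tr 2 b)) (Eq (Eq (lift 1 A) (lift 1 b) (lift 1 b))
      (App (App (lift 1 f) (lift 1 b)) (Var 0)) (App (App (lift 1 g) (lift 1 b)) (Var 0))))"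
    by (simp add: sub)
  from inh_app[OF this p refl] show ?thesis by (simp add: sub)
qed

text \<open>Function extensionality, used once for the point and once for the path, reduces the
  claim to \<open>loop_family_path_at\<close> in a generic context.\<close>

lemma eval_refl_inj:
  assumes A: "isty \<Gamma> A" and G: "inh \<Gamma> (is_groupoid A)" and a: "\<Gamma> \<turnstile> a \<Colon> A"
    and f: "\<Gamma> \<turnstile> f \<Colon> loop_family A (Tr 2 a)" and g: "\<Gamma> \<turnstile> g \<Colon> loop_family A (Tr 2 a)"
    and e: "inh \<Gamma> (Eq (Eq A a a) (eval_refl a f) (eval_refl a g))"
  shows "inh \<Gamma> (Eq (loop_family A (Tr 2 a)) f g)"
proof -
  note ctx = isty_ctx[OF A]
  note ta = Tr_type[OF A a, of 2]
  let ?P = "Eq (Trunc 2 (lift 1 A)) (Tr 2 (lift 1 a)) (Tr 2 (Var 0))"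
  let ?D = "?P # A # \<Gamma>"
  have P: "isty (A # \<Gamma>) ?P" using isty_loop_family_path[OF A ta] by (simp add: lift_subst)
  then have D: "ctx ?D" by simp
  have A2: "isty ?D (lift 2 A)" unfolding lift_subst by (rule subst_isty[OF A]) (use D
      in \<open>auto simp: sub\<close>)
  have b2: "?D \<turnstile> Var 1 \<Colon> lift 2 A" and p2: "?D \<turnstile> Var 0 \<Colon> Eq (Trunc 2 (lift 2 A)) (Tr 2 (lift 2 a))
      (Tr 2 (Var 1))"
    using D by (auto simp: sub)
  have a2: "?D \<turnstile> lift 2 a \<Colon> lift 2 A"
    and f2: "?D \<turnstile> lift 2 f \<Colon> loop_family (lift 2 A) (Tr 2 (lift 2 a))"
        and g2: "?D \<turnstile> lift 2 g \<Colon> loop_family (lift 2 A) (Tr 2 (lift 2 a))"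
    and G2: "inh ?D (is_groupoid (lift 2 A))"
    and e2: "inh ?D (Eq (Eq (lift 2 A) (lift 2 a) (lift 2 a)) (eval_refl (lift 2 a) (lift 2 f))
        (eval_refl (lift 2 a) (lift 2 g)))"
    using weaken2[OF a D] weaken2[OF f D] weaken2[OF g D] inh_lift2[OF G D] inh_lift2[OF e D]
    by (simp_all add: lift_subst)
  let ?L = "Eq (lift 2 A) (Var 1) (Var 1)"
  have L: "isty ?D ?L" using A2 b2 by auto
  have "inh ?D (Eq ?L (App (App (lift 2 f) (Var 1)) (Var 0)) (App (App (lift 2 g) (Var 1)) (Var
      0)))"
    by (rule loop_family_path_at[OF A2 G2 a2 f2 g2 e2 b2 p2])
  then have h: "inh ?D (Eq ?L (App (lift 1 (App (lift 1 f) (Var 0))) (Var 0)) (App (lift 1 (App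
      (lift 1 g) (Var 0))) (Var 0)))"
    by (simp add: sub)
  have "A # \<Gamma> \<turnstile> App (lift 1 k) (Var 0) \<Colon> Pi ?P ?L" if k: "\<Gamma> \<turnstile> k \<Colon> loop_family A (Tr 2 a)" for k
    by (rule app_type[of _ _ "lift 1 A" "subst (scons (Var 0) (\<lambda>n. Var (n + 2))) (Pi ?P ?L)"])
      (use weaken[OF k A] A ctx in \<open>auto simp: sub loop_family_def\<close>)
  from inh_funext[OF P L this[OF f] this[OF g] h]
  have "inh (A # \<Gamma>) (Eq (Pi ?P ?L) (App (lift 1 f) (Var 0)) (App (lift 1 g) (Var 0)))" .
  from inh_funext[OF A _ _ _ this] P L f g show ?thesis
    by (simp add: loop_family_def lift_subst) blast
qed

lemma loop_family_equiv:
  assumes A: "isty \<Gamma> A" and G: "inh \<Gamma> (is_groupoid A)" and B: "inh \<Gamma> (braided_loops A)"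
      and a: "\<Gamma> \<turnstile> a \<Colon> A"
  shows "inh \<Gamma> (equiv_type (loop_family A (Tr 2 a)) (Eq A a a))"
proof -
  note ctx = isty_ctx[OF A]
  note ta = Tr_type[OF A a, of 2]
  let ?X = "loop_family A (Tr 2 a)" and ?Y = "Eq A a a"
  have X: "isty \<Gamma> ?X" by (rule isty_loop_family[OF A ta])
  have Y: "isty \<Gamma> ?Y" using A a by auto
  have "?X # \<Gamma> \<turnstile> eval_refl (lift 1 a) (Var 0) \<Colon> Eq (lift 1 A) (lift 1 a) (lift 1 a)"
    by (rule eval_refl_type) (use isty_lift[OF A X] weaken[OF a X] X ctx in \<open>auto simp: lift_subst\<close>)
  then have evX: "?X # \<Gamma> \<turnstile> eval_refl (lift 1 a) (Var 0) \<Colon> lift 1 ?Y" by (simp add: lift_subst)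
  let ?F = "Lam ?X (eval_refl (lift 1 a) (Var 0))"
  have F: "\<Gamma> \<turnstile> ?F \<Colon> Arr ?X ?Y" unfolding Arr_def by (rule lam_type[OF X evX])
  \<comment> \<open>Stated for every substitution because this beta step is taken in two contexts:
    that of a loop, and that of two functions with a path between their values.\<close>
  have F_eval_refl: "inh \<Delta> (Eq (Eq (subst \<sigma> A) (subst \<sigma> a) (subst \<sigma> a)) (App (subst \<sigma> ?F) f)
      (eval_refl (subst \<sigma> a) f))"
    and F_type: "\<Delta> \<turnstile> App (subst \<sigma> ?F) f \<Colon> Eq (subst \<sigma> A) (subst \<sigma> a) (subst \<sigma> a)"
    if s: "wf_subst \<sigma> \<Gamma> \<Delta>" and c: "ctx \<Delta>"
        and f: "\<Delta> \<turnstile> f \<Colon> loop_family (subst \<sigma> A) (Tr 2 (subst \<sigma> a))" for \<sigma> \<Delta> f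
  proof -
    have As: "isty \<Delta> (subst \<sigma> A)" and as: "\<Delta> \<turnstile> subst \<sigma> a \<Colon> subst \<sigma> A"
      using subst_isty[OF A s c] subst_type[OF a s c refl] by auto
    have Xs: "isty \<Delta> (loop_family (subst \<sigma> A) (Tr 2 (subst \<sigma> a)))"
      using subst_isty[OF X s c] by simp
    have "\<Delta> \<turnstile> subst \<sigma> ?F \<Colon> Arr (loop_family (subst \<sigma> A) (Tr 2 (subst \<sigma> a))) (Eq (subst \<sigma> A) (subst \<sigma>
        a) (subst \<sigma> a))"
      by (rule subst_type[OF F s c]) simp
    from app_Arr[OF this f]
    show Ft: "\<Delta> \<turnstile> App (subst \<sigma> ?F) f \<Colon> Eq (subst \<sigma> A) (subst \<sigma> a) (subst \<sigma> a)" .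
    have "loop_family (subst \<sigma> A) (Tr 2 (subst \<sigma> a)) # \<Delta> \<turnstile> eval_refl (lift 1 (subst \<sigma> a)) (Var 0) \<Colon>
        Eq (lift 1 (subst \<sigma> A)) (lift 1 (subst \<sigma> a)) (lift 1 (subst \<sigma> a))"
      by (rule eval_refl_type) (use isty_lift[OF As Xs] weaken[OF as Xs] Xs c
          in \<open>auto simp: lift_subst\<close>)
    from pi_comp[OF this f]
    have "\<Delta> \<turnstile> App (subst \<sigma> ?F) f \<doteq> eval_refl (subst \<sigma> a) f \<Colon> Eq (subst \<sigma> A) (subst \<sigma> a) (subst \<sigma> a)"
      by (simp add: sub)
    from inh_Eq_conv[OF isty_Eq[OF As as as] Ft this]
    show "inh \<Delta> (Eq (Eq (subst \<sigma> A) (subst \<sigma> a) (subst \<sigma> a)) (App (subst \<sigma> ?F) f) (eval_refl (subst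
        \<sigma> a) f))" .
  qed
  note F_eval_refl = F_eval_refl[where \<sigma> = "\<lambda>n. Var (n + k)" for k, folded lift_subst]
    and F_type = F_type[where \<sigma> = "\<lambda>n. Var (n + k)" for k, folded lift_subst]
  show ?thesis
  proof (rule inh_equiv_of_bij[OF X Y F])
    let ?D = "?Y # \<Gamma>"
    have D: "ctx ?D" using Y by simp
    have A1: "isty ?D (lift 1 A)" and a1: "?D \<turnstile> lift 1 a \<Colon> lift 1 A"
        and G1: "inh ?D (is_groupoid (lift 1 A))"
      and B1: "inh ?D (braided_loops (lift 1 A))"
      using isty_lift[OF A Y] weaken[OF a Y] inh_lift[OF G Y] inh_lift[OF B Y]
          by (simp_all add: lift_subst)
    have l1: "?D \<turnstile> Var 0 \<Colon> Eq (lift 1 A) (lift 1 a) (lift 1 a)" using D by (auto simp: sub)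
    obtain f where f: "?D \<turnstile> f \<Colon> loop_family (lift 1 A) (Tr 2 (lift 1 a))"
      and e: "inh ?D (Eq (Eq (lift 1 A) (lift 1 a) (lift 1 a)) (eval_refl (lift 1 a) f) (Var 0))"
      by (rule eval_refl_surj[OF A1 G1 B1 a1 l1])
    have w: "wf_subst (\<lambda>n. Var (n + 1)) \<Gamma> ?D" using D by (auto simp: sub)
    note Fe = F_eval_refl[OF w D f] and Ft = F_type[OF w D f]
    have Fl: "inh ?D (Eq (Eq (lift 1 A) (lift 1 a) (lift 1 a)) (App (lift 1 ?F) f) (Var 0))"
      by (rule inh_trans[OF isty_Eq[OF A1 a1 a1] Ft eval_refl_type[OF A1 a1 f] l1 Fe e])
    have X1: "isty ?D (lift 1 ?X)" by (rule isty_lift[OF X Y])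
    have c2: "ctx (lift 1 ?X # ?D)" using X1 by simp
    have "lift 1 ?X # ?D \<turnstile> App (lift 2 ?F) (Var 0) \<Colon> lift 2 ?Y"
      by (rule app_Arr[of _ _ "lift 2 ?X"]) (use weaken2[OF F c2] c2 in \<open>auto simp: sub\<close>)
    moreover have "lift 1 ?X # ?D \<turnstile> Var 1 \<Colon> lift 2 ?Y" using c2 by (auto simp: sub)
    moreover have "isty (lift 1 ?X # ?D) (lift 2 ?Y)"
      using isty_lift[OF isty_lift[OF Y Y] X1] by (simp add: sub)
    ultimately have S: "isty (lift 1 ?X # ?D) (Eq (lift 2 ?Y) (App (lift 2 ?F) (Var 0)) (Var 1))"
      by (intro isty_Eq)
    have "inh ?D (Sig (lift 1 ?X) (Eq (lift 2 ?Y) (App (lift 2 ?F) (Var 0)) (Var 1)))"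
      by (rule inh_pair[OF S, of f]) (use f Fl in \<open>simp_all add: sub\<close>)
    then show "inh \<Gamma> (Pi ?Y (Sig (lift 1 ?X) (Eq (lift 2 ?Y) (App (lift 2 ?F) (Var 0)) (Var 1))))"
      by (rule inh_Pi[OF Y])
  next
    let ?E = "Eq (lift 2 ?Y) (App (lift 2 ?F) (Var 1)) (App (lift 2 ?F) (Var 0))"
    let ?D2 = "lift 1 ?X # ?X # \<Gamma>"
    have X1: "isty (?X # \<Gamma>) (lift 1 ?X)" by (rule isty_lift[OF X X])
    then have D2: "ctx ?D2" by simp
    have F2: "?D2 \<turnstile> lift 2 ?F \<Colon> Arr (lift 2 ?X) (lift 2 ?Y)"
      using weaken2[OF F D2] by (simp add: lift_subst)
    have v: "?D2 \<turnstile> Var 1 \<Colon> lift 2 ?X" "?D2 \<turnstile> Var 0 \<Colon> lift 2 ?X" using D2 by (auto simp: sub)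
    have "isty ?D2 (lift 2 ?Y)"
      using isty_lift[OF isty_lift[OF Y X] X1] by (simp add: sub)
    then have E: "isty ?D2 ?E"
      by (intro isty_Eq app_Arr[OF F2] v)
    let ?D = "?E # ?D2"
    have D: "ctx ?D" using E by simp
    have w: "wf_subst (\<lambda>n. Var (n + 3)) \<Gamma> ?D" using D by (auto simp: sub)
    have A3: "isty ?D (lift 3 A)" and a3: "?D \<turnstile> lift 3 a \<Colon> lift 3 A"
        and G3: "inh ?D (is_groupoid (lift 3 A))"
      using subst_isty[OF A w D] subst_type[OF a w D refl] subst_inh[OF G w D refl]
          by (simp_all add: lift_subst)
    have f: "?D \<turnstile> Var 2 \<Colon> loop_family (lift 3 A) (Tr 2 (lift 3 a))"
        and g: "?D \<turnstile> Var 1 \<Colon> loop_family (lift 3 A) (Tr 2 (lift 3 a))"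
      using D by (auto simp: sub)
    let ?Y3 = "Eq (lift 3 A) (lift 3 a) (lift 3 a)"
    have Y3: "isty ?D ?Y3" using A3 a3 by auto
    note ff = F_eval_refl[OF w D f] F_type[OF w D f]
    note gg = F_eval_refl[OF w D g] F_type[OF w D g]
    have h: "inh ?D (Eq ?Y3 (App (lift 3 ?F) (Var 2)) (App (lift 3 ?F) (Var 1)))"
      by (rule inhI[of _ "Var 0"]) (use D in \<open>auto simp: sub\<close>)
    note ef = eval_refl_type[OF A3 a3 f] and eg = eval_refl_type[OF A3 a3 g]
    have "inh ?D (Eq ?Y3 (eval_refl (lift 3 a) (Var 2)) (eval_refl (lift 3 a) (Var 1)))"
      by (rule inh_trans[OF Y3 ef ff(2) eg inh_sym[OF Y3 ff(2) ef ff(1)] inh_trans[OF Y3 ff(2) gg(2)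
          eg h gg(1)]])
    from eval_refl_inj[OF A3 G3 a3 f g this]
    have "inh ?D (Eq (lift 3 ?X) (Var 2) (Var 1))" by (simp add: lift_subst)
    then show "inh \<Gamma> (Pi ?X (Pi (lift 1 ?X) (Pi ?E (Eq (lift 3 ?X) (Var 2) (Var 1)))))"
      by (intro inh_Pi X X1 E)
  qed
qed

lemma set_based_representable:
  assumes A: "\<Gamma> \<turnstile> A \<Colon> U i" and G: "inh \<Gamma> (is_groupoid A)" and B: "inh \<Gamma> (braided_loops A)"
  shows "inh \<Gamma> (set_based_representable i A)"
proof -
  note A' = isty_U[OF A] and ctx = ctx_of_judgement(2)[OF A]
  let ?T = "Trunc 2 A"
  have T: "isty \<Gamma> ?T" using A' by auto
  have loop_family: "Trunc 2 A # \<Gamma> \<turnstile> loop_family (lift 1 A) (Var 0) \<Colon> U i" if A: "\<Gamma> \<turnstile> A \<Colon> U i"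
      for \<Gamma> A
    by (rule loop_family_type)
      (use weaken[OF A, of "Trunc 2 A"] isty_U[OF A] ctx_of_judgement(2)[OF A]
          in \<open>auto simp: lift_subst\<close>)
  let ?F = "Lam ?T (loop_family (lift 1 A) (Var 0))"
  have F: "\<Gamma> \<turnstile> ?F \<Colon> Arr ?T (U i)"
    unfolding Arr_def by (rule lam_type[OF T]) (use loop_family[OF A] in \<open>simp add: lift_subst\<close>)
  let ?D = "A # \<Gamma>"
  have A1: "?D \<turnstile> lift 1 A \<Colon> U i" using weaken[OF A A'] by (simp add: lift_subst)
  note A1' = isty_U[OF A1]
  have a: "?D \<turnstile> Var 0 \<Colon> lift 1 A" using A' ctx by auto
  note ta = Tr_type[OF A1' a, of 2]
  have eq: "inh ?D (equiv_type (loop_family (lift 1 A) (Tr 2 (Var 0))) (Eq (lift 1 A) (Var 0) (Var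
      0)))"
    by (rule loop_family_equiv[OF A1' _ _ a]) (use inh_lift[OF G A'] inh_lift[OF B A']
        in \<open>simp_all add: lift_subst\<close>)
  have F1: "?D \<turnstile> lift 1 ?F \<Colon> Arr (Trunc 2 (lift 1 A)) (U i)"
    using weaken[OF F A'] by (simp add: lift_subst)
  have beta: "?D \<turnstile> App (lift 1 ?F) (Tr 2 (Var 0)) \<doteq> loop_family (lift 1 A) (Tr 2 (Var 0)) \<Colon> U i"
    using pi_comp[OF loop_family[OF A1] ta] by (simp add: sub)
  have U: "isty ?D (U i)" using A' by auto
  \<comment> \<open>The motive abstracts the left type of the equivalence. Applying
    \<open>?F\<close> to |a| gives \<open>loop_family\<close> at |a| by beta reduction, and
    \<open>inh_jeq\<close> moves the equivalence along that equality.\<close>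
  have "isty (U i # ?D) (equiv_type (Var 0) (Eq (lift 2 A) (Var 1) (Var 1)))"
    by (intro isty_equiv_type isty_Eq isty_U[of _ "Var 0" i])
      (use isty_lift[OF A1' U] U in \<open>auto simp: sub\<close>)
  from inh_jeq[OF jeq_sym[OF beta] U loop_family_type[OF A1 ta] app_Arr[OF F1 ta] this]
  have eqF: "inh ?D (equiv_type (App (lift 1 ?F) (Tr 2 (Var 0))) (Eq (lift 1 A) (Var 0) (Var 0)))"
    using eq by (simp add: sub)
  let ?B = "Arr ?T (U i)"
  have Bt: "isty \<Gamma> ?B" using T ctx by auto
  have AB: "isty (?B # \<Gamma>) (lift 1 A)" by (rule isty_lift[OF A' Bt])
  let ?H = "lift 1 A # ?B # \<Gamma>"
  have H: "ctx ?H" using AB by simp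
  have A2: "isty ?H (lift 2 A)" using isty_lift[OF AB AB] by (simp add: sub)
  have v: "?H \<turnstile> Var 0 \<Colon> lift 2 A" and w: "?H \<turnstile> Var 1 \<Colon> Arr (Trunc 2 (lift 2 A)) (U i)"
    using H by (auto simp: sub)
  have body: "isty (?B # \<Gamma>) (Pi (lift 1 A) (equiv_type (App (Var 1) (Tr 2 (Var 0))) (Eq (lift 2 A)
      (Var 0) (Var 0))))"
    by (rule isty_Pi[OF AB isty_equiv_type[OF isty_U[OF app_Arr[OF w Tr_type[OF A2 v]]] isty_Eq[OF
        A2 v v]]])
  show ?thesis
    unfolding set_based_representable_def
    by (rule inh_pair[OF body F]) (use inh_Pi[OF A' eqF] in \<open>simp add: sub\<close>)
qed

theorem theorem14:
  fixes i :: nat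
  shows "\<exists>t. [] \<turnstile> t \<Colon>
    Pi (U i)
      (Pi (is_1type (Var 0))
        (Pi (braided_loops (Var 1))
          (set_based_representable i (Var 2))))"
proof -
  let ?G = "is_1type (Var 0) # [U i]"
  let ?D = "braided_loops (Var 1) # ?G"
  have U: "isty [] (U i)" by auto
  have "[U i] \<turnstile> Var 0 \<Colon> U i" using U by (auto simp: sub)
  then have S: "isty [U i] (is_1type (Var 0))" by (intro isty_is_1type isty_U)
  have "?G \<turnstile> Var 1 \<Colon> U i" using S by (auto simp: sub)
  then have B: "isty ?G (braided_loops (Var 1))" by (intro isty_braided_loops isty_U)
  then have D: "ctx ?D" by simp
  have "inh ?D (set_based_representable i (Var 2))"
  proof (rule set_based_representable)
    show "?D \<turnstile> Var 2 \<Colon> U i" using D by (auto simp: sub)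
    show "inh ?D (is_groupoid (Var 2))" unfolding is_groupoid_def
      by (rule inhI[of _ "Var 1"]) (use D in \<open>auto simp: sub simp del: is_trunc.simps\<close>)
    show "inh ?D (braided_loops (Var 2))"
      by (rule inhI[of _ "Var 0"]) (use D in \<open>auto simp: sub\<close>)
  qed
  then show ?thesis
    unfolding inh_def[symmetric] by (intro inh_Pi U S B)
qed

end
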